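(* Let $1<p<\infty$. Let $(b_n)_{n\ge1}$ be a sequence of elements of the closed unit ball of $H^\infty$. Put $B_0=1$ and $B_n:=b_1b_2\cdots b_n$ for $n\ge1$. Assume that the product $B:=\prod_{n=1}^\infty b_n$ converges uniformly on compact subsets of $\mathbb{D}$ to an element $B\in H^\infty$. Then for every $f\in H^p$, \[ f=B\,T_{\bar B}f+\sum_{n=1}^{\infty}B_{n-1}\cdot Q_{b_n}T_{\bar B_{n-1}}f, \] where the series converges in $H^p$-norm.
   Context: $\mathbb{D}$ is the open unit disc and $\mathbb{T}$ the unit circle; $H^p$ ($1<p<\infty$) is the Hardy space on $\mathbb{D}$, identified with a closed subspace of $L^p(\mathbb{T})$ via boundary values, and $H^\infty$ is the space of bounded analytic functions on $\mathbb{D}$ with the sup norm. $P_+:L^p(\mathbb{T})\to H^p$ is the M. Riesz (Szegő) projection. For $\varphi\in L^\infty(\mathbb{T})$ the Toeplitz operator $T_\varphi:H^p\to H^p$ is $T_\varphi f=P_+(\varphi f)$; for $B\in H^\infty$, $\bar B$ denotes the complex conjugate of its boundary function. For $b$ in the closed unit ball of $H^\infty$, $P_b:=T_bT_{\bar b}$ and $Q_b:=I-P_b$. *)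

theory Defs
  imports "HOL-Complex_Analysis.Complex_Analysis"
begin

text \<open>Functions on the unit circle are represented as functions of the angle t,
  considered on the interval [0, 2 pi] with Lebesgue measure.\<close>

definition circle_measure :: "real measure" where
  "circle_measure = lebesgue_on {0..2*pi}"

definition Lp :: "real \<Rightarrow> (real \<Rightarrow> complex) set" where
  "Lp p = {f. f \<in> borel_measurable circle_measure \<and>
               integrable circle_measure (\<lambda>t. norm (f t) powr p)}"

definition Lp_norm :: "real \<Rightarrow> (real \<Rightarrow> complex) \<Rightarrow> real" where
  "Lp_norm p f = (integral\<^sup>L circle_measure (\<lambda>t. norm (f t) powr p)) powr (1/p)"

definition fourier_coeff :: "(real \<Rightarrow> complex) \<Rightarrow> int \<Rightarrow> complex" where
  "fourier_coeff f k = complex_of_real (1/(2*pi)) *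
      integral\<^sup>L circle_measure (\<lambda>t. f t * cis (- (of_int k) * t))"

definition Hp :: "real \<Rightarrow> (real \<Rightarrow> complex) set" where
  "Hp p = {f. f \<in> Lp p \<and> (\<forall>k<0. fourier_coeff f k = 0)}"

text \<open>Riesz (Szego) projection: the H^p function with the same nonnegative Fourier
  coefficients (determined up to a.e. equality).\<close>
definition riesz_proj :: "real \<Rightarrow> (real \<Rightarrow> complex) \<Rightarrow> (real \<Rightarrow> complex)" where
  "riesz_proj p f = (SOME g. g \<in> Hp p \<and> (\<forall>k\<ge>0. fourier_coeff g k = fourier_coeff f k))"

definition Hinf :: "(complex \<Rightarrow> complex) set" where
  "Hinf = {b. b holomorphic_on ball 0 1 \<and> bounded (b ` ball 0 1)}"

text \<open>Boundary function (radial limit, exists a.e. by Fatou's theorem).\<close>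
definition boundary_fn :: "(complex \<Rightarrow> complex) \<Rightarrow> real \<Rightarrow> complex" where
  "boundary_fn b t = Lim (at_left 1) (\<lambda>r::real. b (of_real r * cis t))"

definition toeplitz :: "real \<Rightarrow> (real \<Rightarrow> complex) \<Rightarrow> (real \<Rightarrow> complex) \<Rightarrow> (real \<Rightarrow> complex)" where
  "toeplitz p \<phi> f = riesz_proj p (\<lambda>t. \<phi> t * f t)"

definition Pop :: "real \<Rightarrow> (complex \<Rightarrow> complex) \<Rightarrow> (real \<Rightarrow> complex) \<Rightarrow> (real \<Rightarrow> complex)" where
  "Pop p b g = toeplitz p (boundary_fn b) (toeplitz p (\<lambda>t. cnj (boundary_fn b t)) g)"

definition Qop :: "real \<Rightarrow> (complex \<Rightarrow> complex) \<Rightarrow> (real \<Rightarrow> complex) \<Rightarrow> (real \<Rightarrow> complex)" where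
  "Qop p b g = (\<lambda>t. g t - Pop p b g t)"

end

theory Submission
  imports Defs
begin

text \<open>Since \<open>T\<^sub>b h = b h\<close> on \<open>H\<^sup>p\<close> and the co-analytic Toeplitz operators multiply,
  the partial sums telescope: the \<open>N\<close>-th remainder is, with \<open>g\<^sub>N = T f\<close> for the conjugate symbol
  of \<open>B\<^sub>N\<close> and \<open>g\<close> likewise for \<open>B\<close>,
  \<open>B\<^sub>N g\<^sub>N - B g = B\<^sub>N (g\<^sub>N - g) + (B\<^sub>N - B) g\<close>.
  For trigonometric polynomials \<open>f\<close> the convergence \<open>g\<^sub>N \<longlonglongrightarrow> g\<close> is convergence of finitely many
  Taylor coefficients; the M. Riesz inequality extends it to all of \<open>L\<^sup>p\<close>. The second term vanishes
  if \<open>B = 0\<close>. Otherwise \<open>B z\<^sub>0 \<noteq> 0\<close> for some \<open>z\<^sub>0\<close>, and the tail products \<open>D = b\<^sub>N\<^sub>+\<^sub>1 \<cdots> b\<^sub>M\<close> satisfy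
  \<open>\<integral> |1 - D|\<^sup>2 \<le> 2 \<integral> Re (1 - D) \<le> C |1 - D z\<^sub>0|\<close> by Harnack's inequality, so the boundary functions
  of the \<open>B\<^sub>N\<close> converge to that of \<open>B\<close> in \<open>L\<^sup>2\<close>.

  The M. Riesz inequality is obtained for \<open>1 < p \<le> 2\<close> by Calderon's argument and for \<open>p > 2\<close> by duality.
  Radial limits exist almost everywhere because a square summable boundary series is the derivative
  almost everywhere of its primitive (Lebesgue differentiation).\<close>

section \<open>The circle: integrability, L^p functions and Fourier coefficients\<close>

text \<open>Locally uniform convergence of the \<open>B\<^sub>N\<close> controls their boundary
  functions only weakly, coefficient by coefficient: the powers \<open>z ^ n\<close> tend to 0 in
  this sense although their boundary values have modulus 1. Strong convergence has to come from
  elsewhere in each of the two terms of the remainder. In the first it comes from the projection: a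
  conjugate symbol moves frequencies down, so of its product with a trigonometric polynomial only
  finitely many coefficients survive. In the second it comes from the product structure: a later
  partial product is an earlier one times \<open>D\<close>, and since the moduli at
  \<open>z\<^sub>0\<close> decrease to a positive limit, the Cauchy property at that single point
  makes \<open>D z\<^sub>0\<close> close to 1. The other obstacle is that \<open>riesz_proj\<close>
  is a choice and \<open>boundary_fn\<close> a bare limit operator. They say nothing until the M.
  Riesz inequality supplies an element to choose and Fatou's theorem supplies the limit, and the
  resulting functions are then identified mostly almost everywhere only. Identities on the circle
  are therefore obtained by comparing Fourier coefficients.\<close>

lemma space_circle_measure [simp]: "space circle_measure = {0..2*pi}"
  by (simp add: circle_measure_def)

lemma emeasure_circle_measure: "emeasure circle_measure {0..2*pi} = ennreal (2*pi)"
  by (simp add: circle_measure_def emeasure_restrict_space)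

interpretation circle: finite_measure circle_measure
  by (standard) (simp add: emeasure_circle_measure)

lemma measure_circle_measure [simp]: "measure circle_measure {0..2*pi} = 2*pi"
  by (simp add: measure_def emeasure_circle_measure)

lemma continuous_measurable_circle:
  fixes f :: "real \<Rightarrow> 'a::euclidean_space"
  assumes "continuous_on {0..2*pi} f"
  shows "f \<in> borel_measurable circle_measure"
  unfolding circle_measure_def using assms
  by (intro continuous_imp_measurable_on_sets_lebesgue) auto

lemma integrable_circle_bounded:
  fixes f :: "real \<Rightarrow> 'a::euclidean_space"
  assumes "f \<in> borel_measurable circle_measure" "AE t in circle_measure. norm (f t) \<le> K"
  shows "integrable circle_measure f"
  using circle.integrable_const_bound assms by blast

lemma integrable_circle_continuous:
  fixes f :: "real \<Rightarrow> 'a::euclidean_space"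
  assumes "continuous_on {0..2*pi} f"
  shows "integrable circle_measure f"
proof -
  have "compact (f ` {0..2*pi})" using assms compact_continuous_image by blast
  then obtain K where "\<forall>x\<in>{0..2*pi}. norm (f x) \<le> K"
    by (meson bounded_iff compact_imp_bounded imageI)
  then show ?thesis
    by (intro integrable_circle_bounded[where K=K] continuous_measurable_circle assms) auto
qed

lemma integral_circle_eq:
  fixes f :: "real \<Rightarrow> 'a::euclidean_space"
  assumes "continuous_on {0..2*pi} f"
  shows "integral\<^sup>L circle_measure f = integral {0..2*pi} f"
  using lebesgue_integral_eq_integral[of "{0..2*pi}" f] integrable_circle_continuous[OF assms]
  by (simp add: circle_measure_def)

lemma integral_circle_const [simp]:
  "integral\<^sup>L circle_measure (\<lambda>t. c::'a::euclidean_space) = (2*pi) *\<^sub>R c"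
  by (simp add: measure_circle_measure)

text \<open>Holds because Lebesgue measure is complete: after extension by 0 to the whole line, a
  change on a null set keeps measurability. This is what makes boundary functions measurable, which
  are identified only almost everywhere.\<close>

lemma circle_measurable_AE:
  fixes f g :: "real \<Rightarrow> complex"
  assumes f: "f \<in> borel_measurable circle_measure" and ae: "AE t in circle_measure. f t = g t"
  shows "g \<in> borel_measurable circle_measure"
proof -
  let ?e = "\<lambda>f x. if x \<in> {0..2*pi} then f x else (0::complex)"
  have "?e f \<in> borel_measurable lebesgue"
    using f unfolding circle_measure_def by (subst borel_measurable_if) auto
  moreover have "AE x in lebesgue. ?e f x = ?e g x"
    using ae unfolding circle_measure_def by (subst (asm) AE_restrict_space_iff) auto
  ultimately have "?e g \<in> borel_measurable lebesgue" by (rule borel_measurable_AE)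
  then show ?thesis
    unfolding circle_measure_def by (subst (asm) borel_measurable_if) auto
qed

lemma integral_cis:
  "integral\<^sup>L circle_measure (\<lambda>t. cis (of_int k * t)) = (if k = 0 then of_real (2*pi) else 0)"
proof (cases "k = 0")
  case True then show ?thesis by (simp add: scaleR_conv_of_real)
next
  case False
  have d: "((\<lambda>t. cis (of_int k * t) / (\<i> * of_int k)) has_vector_derivative cis (of_int k * t)) (at t within S)" for t S
  proof -
    have "((\<lambda>t. exp (\<i> * of_int k * of_real t) / (\<i> * of_int k)) has_vector_derivative 
      exp (\<i> * of_int k * of_real t)) (at t within S)"
      by (rule derivative_eq_intros has_vector_derivative_real_field refl | simp add: False)+
    then show ?thesis by (simp add: cis_conv_exp mult_ac)
  qed
  have "((\<lambda>t. cis (of_int k * t)) has_integral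
      (cis (of_int k * (2*pi)) / (\<i> * of_int k) - cis (of_int k * 0) / (\<i> * of_int k))) {0..2*pi}"
    by (intro fundamental_theorem_of_calculus d) auto
  moreover have "cis (of_int k * (2*pi)) = 1"
    by (metis cis_2pi cis_power_int mult.commute power_int_1_left)
  ultimately have "integral {0..2*pi} (\<lambda>t. cis (of_int k * t)) = 0" 
    by (simp add: integral_unique)
  then show ?thesis using False 
    by (subst integral_circle_eq) (auto intro!: continuous_intros)
qed

section \<open>The space L^p through integrals of p-th powers\<close>

lemma powr_sum_le:
  fixes x y :: "'a::real_normed_vector"
  assumes "0 \<le> p"
  shows "norm (x + y) powr p \<le> 2 powr p * (norm x powr p + norm y powr p)"
proof -
  have "norm (x + y) powr p \<le> (2 * max (norm x) (norm y)) powr p"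
    using norm_triangle_ineq[of x y] assms by (intro powr_mono2) auto
  also have "\<dots> = 2 powr p * (max (norm x) (norm y)) powr p" by (simp add: powr_mult)
  also have "\<dots> \<le> 2 powr p * (norm x powr p + norm y powr p)"
    by (intro mult_left_mono) (auto simp: max_def)
  finally show ?thesis .
qed

lemma powr_diff_le:
  fixes x y :: "'a::real_normed_vector"
  assumes "0 \<le> p"
  shows "norm (x - y) powr p \<le> 2 powr p * (norm x powr p + norm y powr p)"
  using powr_sum_le[OF assms, of x "-y"] by simp

text \<open>The \<open>p\<close>-th power of the norm. The crude triangle inequality with constant \<open>2 powr p\<close>
  is all that is needed of it, so Minkowski is avoided.\<close>

definition p_int :: "real \<Rightarrow> (real \<Rightarrow> complex) \<Rightarrow> real" where
  "p_int p f = integral\<^sup>L circle_measure (\<lambda>t. norm (f t) powr p)"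

lemma p_int_nonneg [simp]: "0 \<le> p_int p f"
  by (simp add: p_int_def)

lemma LpD: assumes "f \<in> Lp p"
  shows Lp_measurable: "f \<in> borel_measurable circle_measure" 
    and Lp_integrable_powr: "integrable circle_measure (\<lambda>t. norm (f t) powr p)"
  using assms by (auto simp: Lp_def)

lemma p_int_AE_cong:
  assumes "f \<in> borel_measurable circle_measure" "AE t in circle_measure. f t = g t"
  shows "p_int p f = p_int p g"
  unfolding p_int_def 
  using circle_measurable_AE[OF assms] assms
  by (intro integral_cong_AE) auto

lemma Lp_bounded:
  assumes "f \<in> borel_measurable circle_measure" "AE t in circle_measure. norm (f t) \<le> K" "0 \<le> p"
  shows "f \<in> Lp p"
proof -
  have "AE t in circle_measure. norm (norm (f t) powr p) \<le> K powr p"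
    using assms(2) by eventually_elim (auto intro!: powr_mono2 assms)
  then show ?thesis unfolding Lp_def using assms
    by (auto intro!: integrable_circle_bounded[where K="K powr p"])
qed

lemma Lp_continuous:
  fixes f :: "real \<Rightarrow> complex"
  assumes "continuous_on {0..2*pi} f" "0 \<le> p"
  shows "f \<in> Lp p"
proof -
  have "compact (f ` {0..2*pi})" using assms compact_continuous_image by blast
  then obtain K where "\<forall>x\<in>{0..2*pi}. norm (f x) \<le> K"
    by (meson bounded_iff compact_imp_bounded imageI)
  then show ?thesis
    by (intro Lp_bounded[where K=K] continuous_measurable_circle assms) auto
qed

lemma Lp_diff:
  assumes "f \<in> Lp p" "g \<in> Lp p" "0 \<le> p"
  shows "(\<lambda>t. f t - g t) \<in> Lp p"
    and p_int_diff_le: "p_int p (\<lambda>t. f t - g t) \<le> 2 powr p * (p_int p f + p_int p g)"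
proof -
  note m[measurable] = LpD(1)[OF assms(1)] LpD(1)[OF assms(2)]
  have i: "integrable circle_measure (\<lambda>t. 2 powr p * (norm (f t) powr p + norm (g t) powr p))"
    using assms by (auto dest: LpD)
  have i2: "integrable circle_measure (\<lambda>t. norm (f t - g t) powr p)"
    by (rule Bochner_Integration.integrable_bound[OF i])
       (use powr_diff_le[OF assms(3)] in \<open>auto simp: abs_mult\<close>)
  then show "(\<lambda>t. f t - g t) \<in> Lp p" by (simp add: Lp_def)
  have "p_int p (\<lambda>t. f t - g t) \<le> integral\<^sup>L circle_measure (\<lambda>t. 2 powr p * (norm (f t) powr p + norm (g t) powr p))"
    unfolding p_int_def by (intro integral_mono i i2 powr_diff_le assms)
  also have "\<dots> = 2 powr p * (p_int p f + p_int p g)"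
    using LpD(2)[OF assms(1)] LpD(2)[OF assms(2)] by (simp add: p_int_def)
  finally show "p_int p (\<lambda>t. f t - g t) \<le> 2 powr p * (p_int p f + p_int p g)" .
qed

lemma Lp_uminus: "f \<in> Lp p \<Longrightarrow> (\<lambda>t. - f t) \<in> Lp p"
  by (simp add: Lp_def)

lemma p_int_uminus [simp]: "p_int p (\<lambda>t. - f t) = p_int p f"
  by (simp add: p_int_def)

lemma p_int_diff_commute: "p_int p (\<lambda>t. f t - g t) = p_int p (\<lambda>t. g t - f t)"
  by (simp add: p_int_def norm_minus_commute)

lemma Lp_add:
  assumes "f \<in> Lp p" "g \<in> Lp p" "0 \<le> p"
  shows "(\<lambda>t. f t + g t) \<in> Lp p"
    and p_int_add_le: "p_int p (\<lambda>t. f t + g t) \<le> 2 powr p * (p_int p f + p_int p g)"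
  using Lp_diff(1)[OF assms(1) Lp_uminus[OF assms(2)] assms(3)] 
        p_int_diff_le[OF assms(1) Lp_uminus[OF assms(2)] assms(3)] by auto

lemma p_int_triangle:
  assumes "f \<in> Lp p" "g \<in> Lp p" "h \<in> Lp p" "0 \<le> p"
  shows "p_int p (\<lambda>t. f t - h t) \<le> 2 powr p * (p_int p (\<lambda>t. f t - g t) + p_int p (\<lambda>t. g t - h t))"
  using p_int_add_le[OF Lp_diff(1)[OF assms(1,2,4)] Lp_diff(1)[OF assms(2,3,4)] assms(4)] by simp

lemma Lp_mult_bounded:
  assumes "f \<in> Lp p" "h \<in> borel_measurable circle_measure" "AE t in circle_measure. norm (h t) \<le> K" "0 \<le> p"
  shows "(\<lambda>t. h t * f t) \<in> Lp p"
    and p_int_mult_bounded: "p_int p (\<lambda>t. h t * f t) \<le> K powr p * p_int p f"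
proof -
  note m[measurable] = LpD(1)[OF assms(1)] assms(2)
  have i: "integrable circle_measure (\<lambda>t. K powr p * norm (f t) powr p)"
    using assms by (auto dest: LpD)
  have b: "AE t in circle_measure. norm (h t * f t) powr p \<le> K powr p * norm (f t) powr p"
    using assms(3)
  proof eventually_elim
    case (elim t)
    have "norm (h t * f t) powr p = norm (h t) powr p * norm (f t) powr p" by (simp add: norm_mult powr_mult)
    also have "\<dots> \<le> K powr p * norm (f t) powr p" using elim assms(4) by (intro mult_right_mono powr_mono2) auto
    finally show ?case .
  qed
  have i2: "integrable circle_measure (\<lambda>t. norm (h t * f t) powr p)"
    by (rule Bochner_Integration.integrable_bound[OF i]) (use b in auto)
  then show "(\<lambda>t. h t * f t) \<in> Lp p" by (simp add: Lp_def)
  have "p_int p (\<lambda>t. h t * f t) \<le> integral\<^sup>L circle_measure (\<lambda>t. K powr p * norm (f t) powr p)"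
    unfolding p_int_def by (intro integral_mono_AE i i2 b)
  also have "\<dots> = K powr p * p_int p f"
    using assms by (auto simp: p_int_def dest: LpD)
  finally show "p_int p (\<lambda>t. h t * f t) \<le> K powr p * p_int p f" .
qed

text \<open>Where \<open>x > \<delta>\<close>, the power with the nonpositive exponent
  \<open>1 - p\<close> is at most its value at \<open>\<delta>\<close>. This split takes the place
  of Hoelder's inequality in comparing L^1 with L^p; the free \<open>\<delta>\<close> makes the
  constant term as small as desired.\<close>

lemma norm_le_eps_powr:
  fixes \<delta> p x :: real
  assumes "0 < \<delta>" "1 \<le> p" "0 \<le> x"
  shows "x \<le> \<delta> + \<delta> powr (1 - p) * x powr p"
proof (cases "x \<le> \<delta>")
  case False
  have "x powr (1 - p) \<le> \<delta> powr (1 - p)"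
    by (rule powr_mono2') (use False assms in auto)
  then have "x powr (1 - p) * x powr p \<le> \<delta> powr (1 - p) * x powr p"
    by (rule mult_right_mono) auto
  moreover have "x powr (1 - p) * x powr p = x"
    using False assms by (subst powr_add[symmetric]) auto
  ultimately show ?thesis using assms by simp
qed (auto intro: add_increasing2)

lemma Lp_integrable:
  assumes "f \<in> Lp p" "1 \<le> p"
  shows "integrable circle_measure f"
    and Lp_L1_le: "0 < \<delta> \<Longrightarrow> integral\<^sup>L circle_measure (\<lambda>t. norm (f t)) \<le> 2*pi*\<delta> + \<delta> powr (1 - p) * p_int p f"
proof -
  note m[measurable] = LpD(1)[OF assms(1)]
  have i: "integrable circle_measure (\<lambda>t. d + d powr (1 - p) * norm (f t) powr p)" for d :: real
    using assms by (auto dest: LpD)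
  show i2: "integrable circle_measure f"
    by (rule Bochner_Integration.integrable_bound[OF i[of 1]])
       (use norm_le_eps_powr[of 1 p "norm (f x)" for x] assms(2) in \<open>auto\<close>)
  assume d: "0 < \<delta>"
  have "integral\<^sup>L circle_measure (\<lambda>t. norm (f t)) \<le> integral\<^sup>L circle_measure (\<lambda>t. \<delta> + \<delta> powr (1 - p) * norm (f t) powr p)"
    by (intro integral_mono i integrable_norm i2 norm_le_eps_powr d assms) auto
  also have "\<dots> = 2*pi*\<delta> + \<delta> powr (1 - p) * p_int p f"
    using assms by (subst Bochner_Integration.integral_add) (auto simp: p_int_def dest: LpD)
  finally show "integral\<^sup>L circle_measure (\<lambda>t. norm (f t)) \<le> 2*pi*\<delta> + \<delta> powr (1 - p) * p_int p f" .
qed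

lemma p_int_tendsto_0_imp_L1:
  assumes "\<And>n. f n \<in> Lp p" "1 \<le> p" "(\<lambda>n. p_int p (f n)) \<longlonglongrightarrow> 0"
  shows "(\<lambda>n. integral\<^sup>L circle_measure (\<lambda>t. norm (f n t))) \<longlonglongrightarrow> 0"
proof (rule LIMSEQ_I)
  fix e :: real assume e: "0 < e"
  \<comment> \<open>The level \<open>d\<close> is fixed first, so that the part of the bound
    independent of \<open>n\<close> is \<open>2*pi*d = e/4\<close>; the factor
    \<open>d powr (1 - p)\<close>, large as it may be, is then a constant.\<close>
  define d where "d = e / (8*pi)"
  have d: "d > 0" using e by (simp add: d_def)
  have "(\<lambda>n. d powr (1 - p) * p_int p (f n)) \<longlonglongrightarrow> d powr (1 - p) * 0"
    by (intro tendsto_intros assms)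
  then have "eventually (\<lambda>n. d powr (1 - p) * p_int p (f n) < e/2) sequentially"
    using e by (intro order_tendstoD) auto
  then obtain N where N: "\<And>n. n \<ge> N \<Longrightarrow> d powr (1 - p) * p_int p (f n) < e/2"
    by (auto simp: eventually_sequentially)
  show "\<exists>N. \<forall>n\<ge>N. norm (integral\<^sup>L circle_measure (\<lambda>t. norm (f n t)) - 0) < e"
  proof (intro exI allI impI)
    fix n assume "N \<le> n"
    have "integral\<^sup>L circle_measure (\<lambda>t. norm (f n t)) \<le> 2*pi*d + d powr (1 - p) * p_int p (f n)"
      using Lp_L1_le assms d by blast
    moreover have "2*pi*d < e/2" using e by (simp add: d_def field_simps)
    ultimately show "norm (integral\<^sup>L circle_measure (\<lambda>t. norm (f n t)) - 0) < e"
      using N[OF \<open>N \<le> n\<close>] by simp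
  qed
qed

section \<open>Fourier coefficients of integrable functions\<close>

lemma integrable_mult_bounded:
  fixes f h :: "real \<Rightarrow> complex"
  assumes "integrable circle_measure f" "h \<in> borel_measurable circle_measure" 
    "AE t in circle_measure. norm (h t) \<le> K"
  shows "integrable circle_measure (\<lambda>t. h t * f t)"
proof (rule Bochner_Integration.integrable_bound)
  show "integrable circle_measure (\<lambda>t. K *\<^sub>R f t)" using assms by simp
  show "AE t in circle_measure. norm (h t * f t) \<le> norm (K *\<^sub>R f t)"
    using assms(3) by eventually_elim (auto simp: norm_mult intro!: mult_right_mono)
qed (use assms in auto)

lemma measurable_cis [measurable]: "(\<lambda>t. cis (c * t)) \<in> borel_measurable circle_measure"
  by (intro continuous_measurable_circle continuous_intros)

lemma integrable_mult_cis:
  assumes "integrable circle_measure f"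
  shows "integrable circle_measure (\<lambda>t. f t * cis (c * t))"
  using integrable_mult_bounded[OF assms measurable_cis, of c 1] by (subst mult.commute) simp

lemma fourier_coeff_diff:
  assumes "integrable circle_measure f" "integrable circle_measure g"
  shows "fourier_coeff (\<lambda>t. f t - g t) k = fourier_coeff f k - fourier_coeff g k"
  using integrable_mult_cis[OF assms(1), of "- of_int k"] integrable_mult_cis[OF assms(2), of "- of_int k"]
  by (simp add: fourier_coeff_def left_diff_distrib right_diff_distrib)

lemma fourier_coeff_add:
  assumes "integrable circle_measure f" "integrable circle_measure g"
  shows "fourier_coeff (\<lambda>t. f t + g t) k = fourier_coeff f k + fourier_coeff g k"
  using integrable_mult_cis[OF assms(1), of "- of_int k"] integrable_mult_cis[OF assms(2), of "- of_int k"]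
  by (simp add: fourier_coeff_def distrib_right distrib_left)

lemma fourier_coeff_cmult: "fourier_coeff (\<lambda>t. c * f t) k = c * fourier_coeff f k"
  by (simp add: fourier_coeff_def mult.assoc)

lemma fourier_coeff_AE_cong:
  assumes "f \<in> borel_measurable circle_measure" "AE t in circle_measure. f t = g t"
  shows "fourier_coeff f k = fourier_coeff g k"
  unfolding fourier_coeff_def
  using assms circle_measurable_AE[OF assms]
  by (intro arg_cong2[where f="(*)"] refl integral_cong_AE borel_measurable_times measurable_cis) auto

lemma fourier_coeff_cis: "fourier_coeff (\<lambda>t. cis (of_int j * t)) k = (if j = k then 1 else 0)"
proof -
  have "cis (of_int j * t) * cis (- (of_int k) * t) = cis (of_int (j - k) * t)" for t
    by (simp add: cis_mult algebra_simps)
  then show ?thesis unfolding fourier_coeff_def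
    by (simp only: integral_cis) (auto)
qed

lemma fourier_coeff_sum:
  assumes "\<And>i. i \<in> I \<Longrightarrow> integrable circle_measure (f i)"
  shows "fourier_coeff (\<lambda>t. \<Sum>i\<in>I. f i t) k = (\<Sum>i\<in>I. fourier_coeff (f i) k)"
  using integrable_mult_cis[OF assms, of _ "- of_int k"]
  by (simp add: fourier_coeff_def sum_distrib_left sum_distrib_right)

lemma norm_fourier_coeff_le:
  assumes "integrable circle_measure f"
  shows "norm (fourier_coeff f k) \<le> 1/(2*pi) * integral\<^sup>L circle_measure (\<lambda>t. norm (f t))"
proof -
  have "norm (integral\<^sup>L circle_measure (\<lambda>t. f t * cis (- (of_int k) * t))) \<le> integral\<^sup>L circle_measure (\<lambda>t. norm (f t * cis (- (of_int k) * t)))"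
    by (rule integral_norm_bound)
  then show ?thesis unfolding fourier_coeff_def norm_mult by (simp add: norm_divide divide_simps mult.commute)
qed

lemma fourier_coeff_tendsto_L1:
  assumes "\<And>n. integrable circle_measure (f n)" "integrable circle_measure g"
    "(\<lambda>n. integral\<^sup>L circle_measure (\<lambda>t. norm (f n t - g t))) \<longlonglongrightarrow> 0"
  shows "(\<lambda>n. fourier_coeff (f n) k) \<longlonglongrightarrow> fourier_coeff g k"
proof (rule LIM_zero_cancel, rule tendsto_0_le[OF assms(3)], rule always_eventually, rule allI)
  fix n
  show "norm (fourier_coeff (f n) k - fourier_coeff g k) \<le> norm (integral\<^sup>L circle_measure (\<lambda>t. norm (f n t - g t))) * (1/(2*pi))"
    using norm_fourier_coeff_le[of "\<lambda>t. f n t - g t" k] assms(1,2) fourier_coeff_diff[OF assms(1)[of n] assms(2), of k]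
    by (simp add: mult.commute)
qed

lemma fourier_coeff_tendsto_Lp:
  assumes "\<And>n. f n \<in> Lp p" "g \<in> Lp p" "1 \<le> p" "(\<lambda>n. p_int p (\<lambda>t. f n t - g t)) \<longlonglongrightarrow> 0"
  shows "(\<lambda>n. fourier_coeff (f n) k) \<longlonglongrightarrow> fourier_coeff g k"
  using assms
  by (intro fourier_coeff_tendsto_L1 p_int_tendsto_0_imp_L1[where p=p and f="\<lambda>n t. f n t - g t"]) (auto intro: Lp_integrable Lp_diff)

section \<open>Trigonometric polynomials\<close>

text \<open>Generated by single exponentials and sums so that closure properties follow by rule
  induction; the finite set of frequencies is recovered in
  \<open>trig_fourier_expansion\<close>.\<close>

inductive trig :: "(real \<Rightarrow> complex) \<Rightarrow> bool" where
  trig_cis: "trig (\<lambda>t. c * cis (of_int k * t))"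
| trig_add: "trig f \<Longrightarrow> trig g \<Longrightarrow> trig (\<lambda>t. f t + g t)"

lemma trig_const: "trig (\<lambda>t. c)"
  using trig_cis[of c 0] by simp

lemma trig_cmult: "trig f \<Longrightarrow> trig (\<lambda>t. c * f t)"
proof (induction rule: trig.induct)
  case (trig_cis d k) then show ?case using trig.trig_cis[of "c * d" k] by (simp add: mult.assoc)
qed (auto simp: distrib_left intro: trig_add)

lemma trig_diff: "trig f \<Longrightarrow> trig g \<Longrightarrow> trig (\<lambda>t. f t - g t)"
  using trig_add[OF _ trig_cmult[of g "-1"], of f] by simp

lemma trig_sum: "(\<And>i. i \<in> I \<Longrightarrow> trig (f i)) \<Longrightarrow> trig (\<lambda>t. \<Sum>i\<in>I. f i t)"
  by (induction I rule: infinite_finite_induct) (auto intro: trig_const trig_add)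

lemma trig_mult_cis: "trig f \<Longrightarrow> trig (\<lambda>t. c * cis (of_int j * t) * f t)"
proof (induction rule: trig.induct)
  case (trig_cis d k)
  have "c * cis (of_int j * t) * (d * cis (of_int k * t)) = (c * d) * cis (of_int (j + k) * t)" for t
    by (simp add: cis_mult[symmetric] algebra_simps)
  then show ?case using trig.trig_cis[of "c * d" "j + k"] by (simp only:)
qed (auto simp: distrib_left intro: trig_add)

lemma trig_mult: "trig f \<Longrightarrow> trig g \<Longrightarrow> trig (\<lambda>t. f t * g t)"
  by (induction rule: trig.induct) (auto simp: distrib_right intro: trig_add trig_mult_cis)

lemma continuous_on_trig: "trig f \<Longrightarrow> continuous_on S f"
  by (induction rule: trig.induct) (auto intro!: continuous_intros)

lemma integrable_trig: "trig f \<Longrightarrow> integrable circle_measure f"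
  by (intro integrable_circle_continuous continuous_on_trig)

lemma Lp_trig: "trig f \<Longrightarrow> 0 \<le> p \<Longrightarrow> f \<in> Lp p"
  by (intro Lp_continuous continuous_on_trig)

lemma trig_bounded: assumes "trig f" obtains K where "\<And>t. norm (f t) \<le> K"
proof -
  have "\<exists>K. \<forall>t. norm (f t) \<le> K" using assms
  proof induction
    case (trig_cis c k) then show ?case by (auto simp: norm_mult)
  next
    case (trig_add f g) then show ?case by (meson add_mono norm_triangle_ineq order_trans)
  qed
  then show ?thesis using that by blast
qed

lemma trig_fourier_expansion:
  assumes "trig f"
  obtains S where "finite S" "\<And>k. k \<notin> S \<Longrightarrow> fourier_coeff f k = 0" 
    "f = (\<lambda>t. \<Sum>k\<in>S. fourier_coeff f k * cis (of_int k * t))"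
proof -
  have "\<exists>S. finite S \<and> (\<forall>k. k \<notin> S \<longrightarrow> fourier_coeff f k = 0) \<and>
    f = (\<lambda>t. \<Sum>k\<in>S. fourier_coeff f k * cis (of_int k * t))" using assms
  proof induction
    case (trig_cis c k)
    show ?case by (rule exI[of _ "{k}"]) (auto simp: fourier_coeff_cmult fourier_coeff_cis)
  next
    case (trig_add f g)
    then obtain S T where S: "finite S" "\<And>k. k \<notin> S \<Longrightarrow> fourier_coeff f k = 0" 
       "f = (\<lambda>t. \<Sum>k\<in>S. fourier_coeff f k * cis (of_int k * t))"
       and T: "finite T" "\<And>k. k \<notin> T \<Longrightarrow> fourier_coeff g k = 0" 
       "g = (\<lambda>t. \<Sum>k\<in>T. fourier_coeff g k * cis (of_int k * t))" by blast
    note c = fourier_coeff_add[OF integrable_trig integrable_trig, OF trig_add.hyps]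
    have "f t = (\<Sum>k\<in>S \<union> T. fourier_coeff f k * cis (of_int k * t))" for t
      by (rule trans[OF fun_cong[OF S(3)] sum.mono_neutral_left]) (auto simp: S(1,2) T(1,2))
    moreover have "g t = (\<Sum>k\<in>S \<union> T. fourier_coeff g k * cis (of_int k * t))" for t
      by (rule trans[OF fun_cong[OF T(3)] sum.mono_neutral_left]) (auto simp: S(1,2) T(1,2))
    ultimately have "f t + g t = (\<Sum>k\<in>S \<union> T. fourier_coeff (\<lambda>t. f t + g t) k * cis (of_int k * t))" for t
      unfolding c by (simp add: distrib_right sum.distrib)
    moreover have "finite (S \<union> T)" "\<And>k. k \<notin> S \<union> T \<Longrightarrow> fourier_coeff (\<lambda>t. f t + g t) k = 0"
      by (simp_all add: c S(1,2) T(1,2))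
    ultimately show ?case by (intro exI[of _ "S \<union> T"]) blast
  qed
  then show ?thesis using that by blast
qed

lemma trig_real_polynomial:
  fixes g :: "complex \<Rightarrow> real"
  assumes "real_polynomial_function g"
  shows "trig (\<lambda>t. of_real (g (cis t)))"
  using assms
proof induction
  case (linear g)
  \<comment> \<open>A real-linear \<open>g\<close> gives
    \<open>cos t * g 1 + sin t * g \<i>\<close>; the two coefficients come from Euler's formulas for
    \<open>cos\<close> and \<open>sin\<close>.\<close>
  have "of_real (g (cis t)) = ((of_real (g 1) - \<i> * of_real (g \<i>)) / 2) * cis (of_int 1 * t)
     + ((of_real (g 1) + \<i> * of_real (g \<i>)) / 2) * cis (of_int (-1) * t)" for t
  proof -
    have "cis t = cos t *\<^sub>R 1 + sin t *\<^sub>R \<i>" by (simp add: complex_eq_iff)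
    then have "g (cis t) = cos t * g 1 + sin t * g \<i>"
      using linear by (simp only: bounded_linear.linear linear_add linear_scale) (simp add: bounded_linear.linear linear_add linear_scale)
    then show ?thesis by (simp add: complex_eq_iff field_simps)
  qed
  then show ?case by (simp only:) (intro trig_add trig_cis)
qed (auto intro: trig_const trig_add trig_mult)

text \<open>Stone-Weierstrass for polynomials in the real and imaginary parts, which become
  trigonometric polynomials on the circle.\<close>

lemma trig_approx_continuous:
  fixes h :: "complex \<Rightarrow> complex"
  assumes h: "continuous_on (sphere 0 1) h" and e: "0 < e"
  obtains q where "trig q" "\<And>t. norm (h (cis t) - q t) < e"
proof -
  obtain g where g: "polynomial_function g" "\<And>z. z \<in> sphere 0 1 \<Longrightarrow> norm (h z - g z) < e"
    using Stone_Weierstrass_polynomial_function[OF _ h e] by auto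
  have "trig (\<lambda>t. of_real (Re (g (cis t))) + \<i> * of_real (Im (g (cis t))))"
  proof (intro trig_add trig_cmult)
    show "trig (\<lambda>t. of_real (Re (g (cis t))))" "trig (\<lambda>t. of_real (Im (g (cis t))))"
      using g(1) trig_real_polynomial[of "Re o g"] trig_real_polynomial[of "Im o g"]
      by (auto simp: polynomial_function_def bounded_linear_Re bounded_linear_Im o_def)
  qed
  then have "trig (\<lambda>t. g (cis t))" by (simp add: complex_eq[symmetric])
  then show ?thesis using that g(2) by auto
qed

section \<open>Bounded trigonometric approximation, uniqueness of coefficients, density\<close>

lemma cis_inj_on: "inj_on cis {0..<2*pi}"
proof (rule inj_onI)
  fix x y assume xy: "x \<in> {0..<2*pi}" "y \<in> {0..<2*pi}" "cis x = cis y"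
  then have "Arg2pi (cis x) = Arg2pi (cis y)" by simp
  moreover have "Arg2pi (cis x) = x" if "x \<in> {0..<2*pi}" for x
    by (rule Arg2pi_unique[of 1]) (use that in \<open>auto simp: cis_conv_exp\<close>)
  ultimately show "x = y" using xy by metis
qed

text \<open>A measurable function is almost everywhere a limit of continuous ones; these are
  transported to the circle and approximated uniformly by trigonometric polynomials. The bound
  uniform in \<open>n\<close> and \<open>t\<close> is the point: it admits dominated convergence
  later.\<close>

lemma bounded_measurable_trig_limit:
  assumes f: "f \<in> borel_measurable circle_measure" and K: "\<And>t. norm (f t) \<le> K"
  obtains q where "\<And>n. trig (q n)" "\<And>n t. norm (q n t) \<le> K + 1"
    "AE t in circle_measure. (\<lambda>n. q n t) \<longlonglongrightarrow> f t"
proof -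
  have K0: "0 \<le> K" using K[of 0] norm_ge_zero order_trans by blast
  have "f measurable_on {0..2*pi}"
    using f unfolding circle_measure_def by (subst measurable_on_iff_borel_measurable) auto
  then obtain N g where N: "negligible N" and g: "\<And>n::nat. continuous_on UNIV (g n)"
     and lim: "\<And>x. x \<notin> N \<Longrightarrow> (\<lambda>n. g n x) \<longlonglongrightarrow> (if x \<in> {0..2*pi} then f x else 0)"
    unfolding measurable_on_def by blast
  \<comment> \<open>The nearest-point map of the ball is continuous and fixes the values of
    \<open>f\<close>, so clipping keeps the limit and imposes the bound \<open>K\<close>.\<close>
  define k where "k n t = closest_point (cball 0 K) (g n t)" for n t
  have cK: "continuous_on UNIV (closest_point (cball (0::complex) K))"
    by (rule continuous_on_closest_point) (use K0 in auto)
  have k: "continuous_on UNIV (k n)" for n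
    unfolding k_def by (rule continuous_on_compose2[OF cK g]) auto
  have kK: "norm (k n t) \<le> K" for n t
    using closest_point_in_set[of "cball 0 K" "g n t"] K0 by (simp add: k_def)
  have klim: "(\<lambda>n. k n x) \<longlonglongrightarrow> f x" if "x \<notin> N" "x \<in> {0..2*pi}" for x
  proof -
    have "(\<lambda>n. k n x) \<longlonglongrightarrow> closest_point (cball 0 K) (f x)"
      unfolding k_def
      by (rule continuous_on_tendsto_compose[OF cK]) (use lim[OF that(1)] that in auto)
    then show ?thesis using K[of x] by (simp add: closest_point_self)
  qed
  \<comment> \<open>Away from both end points \<open>cis\<close> is a homeomorphism onto an arc. The
    intervals exhaust \<open>{0<..<2*pi}\<close>, and the end points go into the exceptional null
    set.\<close>
  define I where "I n = {inverse (real (Suc n))..2*pi - inverse (real (Suc n))}" for n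
  have Isub: "I n \<subseteq> {0..<2*pi}" for n 
  proof
    fix x assume "x \<in> I n"
    moreover have "0 < inverse (real (Suc n))" by simp
    ultimately have "0 < x" "x < 2*pi" by (auto simp only: I_def atLeastAtMost_iff)
    then show "x \<in> {0..<2*pi}" by simp
  qed
  have "\<exists>q. trig q \<and> (\<forall>t. norm (q t) \<le> K + 1) \<and> (\<forall>t\<in>I n. norm (k n t - q t) < inverse (real (Suc n)))" for n
  proof -
    have "compact (I n)" by (simp add: I_def)
    have "inj_on cis (I n)" using cis_inj_on Isub inj_on_subset by blast
    moreover have "continuous_on (I n) cis"
      unfolding cis_conv_exp by (intro continuous_intros)
    ultimately obtain u where u: "homeomorphism (I n) (cis ` I n) cis u"
      using homeomorphism_compact[of "I n" cis "cis ` I n"] \<open>compact (I n)\<close>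
      by (auto intro!: continuous_intros)
    have cu: "continuous_on (cis ` I n) (\<lambda>z. k n (u z))"
      by (rule continuous_on_compose2[OF k]) (use u in \<open>auto simp: homeomorphism_def\<close>)
    have cl: "closedin (top_of_set UNIV) (cis ` I n)"
      using \<open>compact (I n)\<close> by (auto intro!: compact_imp_closed compact_continuous_image continuous_intros)
    \<comment> \<open>Tietze extends the function off the arc, so its values at the end points \<open>0, 2 * pi\<close> need not match.\<close>
    obtain h where h: "continuous_on UNIV h" "\<And>z. z \<in> cis ` I n \<Longrightarrow> h z = k n (u z)" "\<And>z. norm (h z) \<le> K"
      using Tietze[OF cu cl K0] kK by (metis UNIV_I)
    obtain q where q: "trig q" "\<And>t. norm (h (cis t) - q t) < inverse (real (Suc n))"
      using trig_approx_continuous[OF continuous_on_subset[OF h(1)], of "inverse (real (Suc n))"] by auto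
    have "norm (q t) \<le> K + 1" for t
    proof -
      have "norm (q t) \<le> norm (h (cis t)) + norm (h (cis t) - q t)" by norm
      moreover have "inverse (real (Suc n)) \<le> 1" by (simp add: field_simps)
      ultimately show ?thesis using h(3)[of "cis t"] q(2)[of t] by linarith
    qed
    moreover have "h (cis t) = k n t" if "t \<in> I n" for t
      using h(2)[of "cis t"] that u by (auto simp: homeomorphism_def)
    ultimately show ?thesis using q by metis
  qed
  then obtain q where q: "\<And>n. trig (q n)" "\<And>n t. norm (q n t) \<le> K + 1" 
    "\<And>n t. t \<in> I n \<Longrightarrow> norm (k n t - q n t) < inverse (real (Suc n))" by metis
  have lim': "(\<lambda>n. q n t) \<longlonglongrightarrow> f t" if t: "t \<notin> N" "t \<in> {0<..<2*pi}" for t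
  proof -
    have "eventually (\<lambda>n. inverse (real (Suc n)) < min t (2*pi - t)) sequentially"
      by (rule order_tendstoD[OF LIMSEQ_inverse_real_of_nat]) (use t in auto)
    then have "eventually (\<lambda>n. norm (k n t - q n t) \<le> inverse (real (Suc n))) sequentially"
      by eventually_elim (use q(3) in \<open>auto simp: I_def intro!: less_imp_le\<close>)
    then have "(\<lambda>n. k n t - q n t) \<longlonglongrightarrow> 0"
      by (rule Lim_null_comparison[OF _ LIMSEQ_inverse_real_of_nat])
    from tendsto_diff[OF klim[of t] this] show ?thesis using t by simp
  qed
  have "negligible (N \<union> {0, 2*pi})" using N by (simp add: negligible_Un)
  then have "AE t in lebesgue. t \<notin> N \<union> {0, 2*pi}"
    by (intro AE_not_in) (simp only: negligible_iff_null_sets)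
  then have "AE t in circle_measure. t \<notin> N \<union> {0, 2*pi}"
    unfolding circle_measure_def by (subst AE_restrict_space_iff) auto
  then have "AE t in circle_measure. (\<lambda>n. q n t) \<longlonglongrightarrow> f t"
    using AE_space by eventually_elim (auto intro!: lim')
  then show ?thesis using that q by blast
qed

lemma fourier_coeff_zero_imp_integral_trig:
  assumes "integrable circle_measure f" "\<And>k. fourier_coeff f k = 0" "trig q"
  shows "integrable circle_measure (\<lambda>t. f t * q t) \<and> integral\<^sup>L circle_measure (\<lambda>t. f t * q t) = 0"
  using assms(3)
proof induction
  case (trig_cis c k)
  have "integrable circle_measure (\<lambda>t. c * (f t * cis (of_int k * t)))"
    using integrable_mult_cis[OF assms(1), of "of_int k"] by simp
  moreover have "integral\<^sup>L circle_measure (\<lambda>t. f t * cis (of_int k * t)) = 0"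
    using assms(2)[of "-k"] by (simp add: fourier_coeff_def)
  ultimately show ?case by (simp add: mult.left_commute)
next
  case (trig_add g h)
  then show ?case by (simp add: distrib_left)
qed

text \<open>Dominated convergence carries the vanishing of the integral of \<open>f * q\<close> from
  trigonometric polynomials \<open>q\<close> to \<open>cnj (sgn f)\<close>, whose product with
  \<open>f\<close> is \<open>norm f\<close>.\<close>

lemma fourier_coeff_unique:
  assumes f: "integrable circle_measure f" and 0: "\<And>k. fourier_coeff f k = 0"
  shows "AE t in circle_measure. f t = 0"
proof -
  have [measurable]: "f \<in> borel_measurable circle_measure" using f by auto
  have [measurable]: "cnj \<in> borel_measurable borel"
    by (intro borel_measurable_continuous_onI continuous_intros)
  have m: "(\<lambda>t. cnj (sgn (f t))) \<in> borel_measurable circle_measure"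
    unfolding sgn_div_norm by measurable
  have b: "norm (cnj (sgn (f t))) \<le> 1" for t by (simp add: norm_sgn)
  obtain q :: "nat \<Rightarrow> real \<Rightarrow> complex" where q: "\<And>n. trig (q n)" "\<And>n t. norm (q n t) \<le> 1 + 1"
    "AE t in circle_measure. (\<lambda>n. q n t) \<longlonglongrightarrow> cnj (sgn (f t))"
    using bounded_measurable_trig_limit[OF m b] by blast
  have [measurable]: "q n \<in> borel_measurable circle_measure" for n using integrable_trig[OF q(1)] by auto
  have "(\<lambda>n. integral\<^sup>L circle_measure (\<lambda>t. f t * q n t)) \<longlonglongrightarrow> integral\<^sup>L circle_measure (\<lambda>t. f t * cnj (sgn (f t)))"
  proof (rule integral_dominated_convergence[where w="\<lambda>t. norm (f t) * 2"])
    show "AE t in circle_measure. (\<lambda>n. f t * q n t) \<longlonglongrightarrow> f t * cnj (sgn (f t))"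
      using q(3) by eventually_elim (intro tendsto_intros)
    show "AE t in circle_measure. norm (f t * q n t) \<le> norm (f t) * 2" for n
      using q(2) by (auto simp: norm_mult intro!: mult_left_mono)
    show "(\<lambda>t. f t * cnj (sgn (f t))) \<in> borel_measurable circle_measure"
      using m by measurable
  qed (use f in auto)
  then have "integral\<^sup>L circle_measure (\<lambda>t. f t * cnj (sgn (f t))) = 0"
    using fourier_coeff_zero_imp_integral_trig[OF f 0 q(1)] LIMSEQ_unique by (simp add: LIMSEQ_const_iff)
  moreover have "f t * cnj (sgn (f t)) = of_real (norm (f t))" for t
    using complex_norm_square[of "f t"]
    by (cases "f t = 0") (auto simp: sgn_div_norm scaleR_conv_of_real power2_eq_square divide_simps)
  ultimately have "integral\<^sup>L circle_measure (\<lambda>t. norm (f t)) = 0"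
    by (simp add: integral_complex_of_real)
  then have "AE t in circle_measure. norm (f t) = 0"
    using f by (subst (asm) integral_nonneg_eq_0_iff_AE) auto
  then show ?thesis by simp
qed

lemma fourier_coeff_eq_imp_AE_eq:
  assumes "integrable circle_measure f" "integrable circle_measure g" "\<And>k. fourier_coeff f k = fourier_coeff g k"
  shows "AE t in circle_measure. f t = g t"
proof -
  have "AE t in circle_measure. f t - g t = 0"
    by (rule fourier_coeff_unique) (use assms in \<open>auto simp: fourier_coeff_diff\<close>)
  then show ?thesis by simp
qed

text \<open>Truncation at height \<open>m\<close> reduces to bounded functions, for which the
  bounded approximation converges in \<open>p_int\<close> by dominated convergence.\<close>

lemma trig_dense_Lp:
  assumes f: "f \<in> Lp p" and p: "0 < p" and e: "0 < e"
  obtains q where "trig q" "p_int p (\<lambda>t. f t - q t) < e"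
proof -
  note [measurable] = LpD(1)[OF f]
  \<comment> \<open>Compensates the factor \<open>2 powr p\<close> of the triangle inequality for
    \<open>p_int\<close> and its two summands.\<close>
  define e' where "e' = e / (2 powr p * 2)"
  have e': "e' > 0" using e by (simp add: e'_def)
  define F where "F m t = (if norm (f t) \<le> real m then f t else 0)" for m t
  have Fm[measurable]: "F m \<in> borel_measurable circle_measure" for m
    unfolding F_def by measurable
  have Fb: "norm (F m t) \<le> real m" for m t by (simp add: F_def)
  have FL: "F m \<in> Lp p" for m
    by (rule Lp_bounded[where K="real m"]) (use Fb p in auto)
  have "(\<lambda>m. p_int p (\<lambda>t. f t - F m t)) \<longlonglongrightarrow> integral\<^sup>L circle_measure (\<lambda>t. 0::real)"
    unfolding p_int_def
  proof (rule integral_dominated_convergence[where w="\<lambda>t. norm (f t) powr p"])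
    show "AE t in circle_measure. (\<lambda>m. norm (f t - F m t) powr p) \<longlonglongrightarrow> 0"
    proof (rule AE_I2)
      fix t
      have "eventually (\<lambda>m. real m \<ge> norm (f t)) sequentially"
        by (meson eventually_sequentiallyI nat_ceiling_le_eq)
      then have "eventually (\<lambda>m. norm (f t - F m t) powr p = 0) sequentially"
        by eventually_elim (simp add: F_def)
      then show "(\<lambda>m. norm (f t - F m t) powr p) \<longlonglongrightarrow> 0" by (rule tendsto_eventually)
    qed
    show "AE t in circle_measure. norm (norm (f t - F m t) powr p) \<le> norm (f t) powr p" for m
      by (auto simp: F_def)
  qed (use LpD[OF f] in auto)
  then have "eventually (\<lambda>m. p_int p (\<lambda>t. f t - F m t) < e') sequentially"
    using e' by (intro order_tendstoD) auto
  then obtain m where m: "p_int p (\<lambda>t. f t - F m t) < e'"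
    by (auto simp: eventually_sequentially)
  obtain q where q: "\<And>n. trig (q n)" "\<And>n t. norm (q n t) \<le> real m + 1"
    "AE t in circle_measure. (\<lambda>n. q n t) \<longlonglongrightarrow> F m t"
    using bounded_measurable_trig_limit[OF Fm Fb] by blast
  have [measurable]: "q n \<in> borel_measurable circle_measure" for n using integrable_trig[OF q(1)] by auto
  have "(\<lambda>n. p_int p (\<lambda>t. F m t - q n t)) \<longlonglongrightarrow> integral\<^sup>L circle_measure (\<lambda>t. 0::real)"
    unfolding p_int_def
  proof (rule integral_dominated_convergence[where w="\<lambda>t. (real m + (real m + 1)) powr p"])
    show "AE t in circle_measure. (\<lambda>n. norm (F m t - q n t) powr p) \<longlonglongrightarrow> 0"
      using q(3)
    proof eventually_elim
      case (elim t)
      then have "(\<lambda>n. norm (F m t - q n t)) \<longlonglongrightarrow> 0"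
        using tendsto_norm[OF tendsto_diff[OF tendsto_const[of "F m t"] elim]] by simp
      then show ?case
        using p by (intro tendsto_zero_powrI[where b=p]) auto
    qed
    show "AE t in circle_measure. norm (norm (F m t - q n t) powr p) \<le> (real m + (real m + 1)) powr p" for n
    proof (rule AE_I2)
      fix t
      have "norm (F m t - q n t) \<le> real m + (real m + 1)"
        using norm_triangle_ineq4[of "F m t" "q n t"] Fb[of m t] q(2)[of n t] by linarith
      then show "norm (norm (F m t - q n t) powr p) \<le> (real m + (real m + 1)) powr p"
        using p by (auto intro!: powr_mono2)
    qed
  qed auto
  then have "eventually (\<lambda>n. p_int p (\<lambda>t. F m t - q n t) < e') sequentially"
    using e' by (intro order_tendstoD) auto
  then obtain n where n: "p_int p (\<lambda>t. F m t - q n t) < e'"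
    by (auto simp: eventually_sequentially)
  have "p_int p (\<lambda>t. f t - q n t) \<le> 2 powr p * (p_int p (\<lambda>t. f t - F m t) + p_int p (\<lambda>t. F m t - q n t))"
    by (rule p_int_triangle[OF f FL Lp_trig[OF q(1)]]) (use p in auto)
  also have "\<dots> < 2 powr p * (e' + e')" using m n by (intro mult_strict_left_mono add_strict_mono) auto
  also have "\<dots> = e" by (simp add: e'_def)
  finally show ?thesis using that q(1) by blast
qed

section \<open>Completeness of L^p\<close>

lemma tendsto_norm_powr:
  fixes f :: "nat \<Rightarrow> 'a::real_normed_vector"
  assumes "(f \<longlongrightarrow> a) F" "0 < p"
  shows "((\<lambda>n. norm (f n) powr p) \<longlongrightarrow> norm a powr p) F"
  by (intro tendsto_powr2 tendsto_norm assms tendsto_const always_eventually allI norm_ge_zero)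

text \<open>The Riesz-Fischer argument: a rapidly convergent subsequence converges almost
  everywhere, and Fatou's lemma for integrals along it bounds the distance of every late
  \<open>f n\<close> from that limit.\<close>

theorem Lp_complete:
  fixes f :: "nat \<Rightarrow> real \<Rightarrow> complex"
  assumes p: "1 \<le> p" and f: "\<And>n. f n \<in> Lp p"
    and cauchy: "\<And>e. 0 < e \<Longrightarrow> \<exists>N. \<forall>m\<ge>N. \<forall>n\<ge>N. p_int p (\<lambda>t. f m t - f n t) < e"
  obtains g where "g \<in> Lp p" "(\<lambda>n. p_int p (\<lambda>t. f n t - g t)) \<longlonglongrightarrow> 0"
proof -
  have [measurable]: "f n \<in> borel_measurable circle_measure" for n using f LpD by blast
  \<comment> \<open>Closeness to within \<open>((1/2)^j) powr p\<close> is matched to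
    \<open>Lp_L1_le\<close> at the level \<open>(1/2)^j\<close>, which makes consecutive L^1
    distances along the subsequence at most \<open>(2*pi + 1) * (1/2)^j\<close>, a summable
    bound.\<close>
  have "\<forall>j. \<exists>N. \<forall>m\<ge>N. \<forall>n\<ge>N. p_int p (\<lambda>t. f m t - f n t) < ((1/2)^j) powr p"
    using cauchy by simp
  then obtain N where N: "\<And>j m n. m \<ge> N j \<Longrightarrow> n \<ge> N j \<Longrightarrow> p_int p (\<lambda>t. f m t - f n t) < ((1/2)^j) powr p"
    by metis
  \<comment> \<open>Cumulative sums give increasing indices with \<open>r j \<ge> N j\<close>; the
    summand 1 gives \<open>r j \<ge> j\<close>.\<close>
  define r where "r j = (\<Sum>i\<le>j. N i + 1)" for j
  have rN: "N j \<le> r j" "r j \<le> r (Suc j)" for j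
    by (auto simp: r_def intro!: order_trans[OF _ member_le_sum[of j]])
  have rj: "j \<le> r j" for j by (induction j) (auto simp: r_def)
  define d where "d j t = f (r (Suc j)) t - f (r j) t" for j t
  have dL: "d j \<in> Lp p" for j
    unfolding d_def by (intro Lp_diff f) (use p in auto)
  have [measurable]: "d j \<in> borel_measurable circle_measure" for j using dL LpD by blast
  have dint: "integral\<^sup>L circle_measure (\<lambda>t. norm (d j t)) \<le> (2*pi + 1) * (1/2)^j" for j
  proof -
    define x :: real where "x = (1/2)^j"
    have x: "x > 0" by (simp add: x_def)
    have "integral\<^sup>L circle_measure (\<lambda>t. norm (d j t)) \<le> 2*pi*x + x powr (1 - p) * p_int p (d j)"
      by (rule Lp_L1_le[OF dL p x])
    also have "\<dots> \<le> 2*pi*x + x powr (1 - p) * x powr p"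
      using N[of j "r (Suc j)" "r j"] rN[of j] by (intro add_left_mono mult_left_mono) (auto simp: x_def d_def[abs_def])
    also have "x powr (1 - p) * x powr p = x" using x by (simp flip: powr_add)
    finally show ?thesis by (simp add: x_def algebra_simps)
  qed
  have "(\<integral>\<^sup>+t. (\<Sum>j. ennreal (norm (d j t))) \<partial>circle_measure) = (\<Sum>j. \<integral>\<^sup>+t. ennreal (norm (d j t)) \<partial>circle_measure)"
    by (intro nn_integral_suminf) auto
  also have "\<dots> = (\<Sum>j. ennreal (integral\<^sup>L circle_measure (\<lambda>t. norm (d j t))))"
    using Lp_integrable[OF dL p] by (intro suminf_cong nn_integral_eq_integral) auto
  also have "\<dots> \<le> (\<Sum>j. ennreal ((2*pi + 1) * (1/2)^j))"
    by (intro suminf_le ennreal_leI dint) auto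
  also have "\<dots> = ennreal (\<Sum>j. (2*pi + 1) * (1/2)^j)"
    by (intro suminf_ennreal2 summable_mult summable_geometric) auto
  also have "\<dots> < \<infinity>" by simp
  finally have "(\<integral>\<^sup>+t. (\<Sum>j. ennreal (norm (d j t))) \<partial>circle_measure) \<noteq> \<infinity>" by simp
  then have "AE t in circle_measure. (\<Sum>j. ennreal (norm (d j t))) \<noteq> \<infinity>"
    by (intro nn_integral_PInf_AE) auto
  then have conv: "AE t in circle_measure. convergent (\<lambda>j. f (r j) t)"
  proof eventually_elim
    case (elim t)
    then have "summable (\<lambda>j. norm (d j t))"
      by (intro summable_suminf_not_top) auto
    then have "summable (\<lambda>j. d j t)" by (rule summable_norm_cancel)
    then have "convergent (\<lambda>n. \<Sum>j<n. d j t)" by (simp add: summable_iff_convergent)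
    moreover have "(\<Sum>j<n. d j t) = f (r n) t - f (r 0) t" for n
      by (simp add: d_def sum_lessThan_telescope[of "\<lambda>j. f (r j) t"])
    ultimately have "convergent (\<lambda>n. f (r n) t - f (r 0) t)" by (simp only:)
    from convergent_add[OF this convergent_const[of "f (r 0) t"]] show ?case by simp
  qed
  define g where "g t = lim (\<lambda>j. f (r j) t)" for t
  have [measurable]: "g \<in> borel_measurable circle_measure"
    unfolding g_def by (rule borel_measurable_lim_metric) simp
  have lim: "AE t in circle_measure. (\<lambda>j. f (r j) t) \<longlonglongrightarrow> g t"
    using conv by eventually_elim (simp add: g_def convergent_LIMSEQ_iff)
  have key: "(\<lambda>t. f n t - g t) \<in> Lp p \<and> p_int p (\<lambda>t. f n t - g t) \<le> e" 
    if n: "\<forall>m\<ge>K. \<forall>n\<ge>K. p_int p (\<lambda>t. f m t - f n t) < e" "n \<ge> K" "0 < e" for n e K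
  proof -
    have "(\<integral>\<^sup>+t. ennreal (norm (f n t - g t) powr p) \<partial>circle_measure) = 
        (\<integral>\<^sup>+t. liminf (\<lambda>j. ennreal (norm (f n t - f (r j) t) powr p)) \<partial>circle_measure)"
    proof (rule nn_integral_cong_AE, use lim in eventually_elim)
      case (elim t)
      have "(\<lambda>j. ennreal (norm (f n t - f (r j) t) powr p)) \<longlonglongrightarrow> ennreal (norm (f n t - g t) powr p)"
        by (intro tendsto_ennrealI tendsto_norm_powr tendsto_intros elim) (use p in auto)
      then show ?case by (rule lim_imp_Liminf[OF sequentially_bot, symmetric])
    qed
    also have "\<dots> \<le> liminf (\<lambda>j. \<integral>\<^sup>+t. ennreal (norm (f n t - f (r j) t) powr p) \<partial>circle_measure)"
      by (rule nn_integral_liminf) measurable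
    also have "\<dots> \<le> liminf (\<lambda>j. ennreal e)"
    proof (rule Liminf_mono, rule eventually_sequentiallyI[of K])
      fix j assume "K \<le> j"
      then have "r j \<ge> K" using rj[of j] by simp
      have "(\<integral>\<^sup>+t. ennreal (norm (f n t - f (r j) t) powr p) \<partial>circle_measure) = ennreal (p_int p (\<lambda>t. f n t - f (r j) t))"
        unfolding p_int_def
        by (intro nn_integral_eq_integral LpD(2) Lp_diff f) (use p in auto)
      also have "\<dots> \<le> ennreal e" using n \<open>r j \<ge> K\<close> by (intro ennreal_leI less_imp_le) auto
      finally show "(\<integral>\<^sup>+t. ennreal (norm (f n t - f (r j) t) powr p) \<partial>circle_measure) \<le> ennreal e" .
    qed
    also have "\<dots> = ennreal e" by (rule Liminf_const[OF sequentially_bot])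
    finally have le: "(\<integral>\<^sup>+t. ennreal (norm (f n t - g t) powr p) \<partial>circle_measure) \<le> ennreal e" .
    have "integrable circle_measure (\<lambda>t. norm (f n t - g t) powr p)"
      by (rule integrableI_nonneg) (use le in \<open>auto simp: top_unique intro: le_less_trans\<close>)
    moreover from this have "ennreal (p_int p (\<lambda>t. f n t - g t)) \<le> ennreal e"
      using le unfolding p_int_def by (subst (asm) nn_integral_eq_integral) auto
    ultimately show ?thesis using \<open>0 < e\<close> by (auto simp: Lp_def)
  qed
  obtain K where K: "\<forall>m\<ge>K. \<forall>n\<ge>K. p_int p (\<lambda>t. f m t - f n t) < 1" using cauchy[of 1] by auto
  have "(\<lambda>t. f K t - (f K t - g t)) \<in> Lp p"
    by (rule Lp_diff(1)[OF f]) (use key[OF K, of K] p in auto)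
  then have "g \<in> Lp p" by simp
  moreover have "(\<lambda>n. p_int p (\<lambda>t. f n t - g t)) \<longlonglongrightarrow> 0"
  proof (rule LIMSEQ_I)
    fix e :: real assume "0 < e"
    then obtain K where K: "\<forall>m\<ge>K. \<forall>n\<ge>K. p_int p (\<lambda>t. f m t - f n t) < e/2" using cauchy[of "e/2"] by auto
    show "\<exists>no. \<forall>n\<ge>no. norm (p_int p (\<lambda>t. f n t - g t) - 0) < e"
      using key[OF K] \<open>0 < e\<close> by (intro exI[of _ K]) fastforce
  qed
  ultimately show ?thesis using that by blast
qed

section \<open>Cauchy and Poisson integrals\<close>

lemma fourier_coeff_uniform_limit:
  assumes "\<And>n. continuous_on {0..2*pi} (f n)" "uniform_limit {0..2*pi} f g sequentially"
  shows "(\<lambda>n. fourier_coeff (f n) k) \<longlonglongrightarrow> fourier_coeff g k"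
proof (rule fourier_coeff_tendsto_L1)
  have g: "continuous_on {0..2*pi} g"
    by (rule uniform_limit_theorem[OF _ assms(2)]) (use assms(1) in auto)
  then show ig: "integrable circle_measure g" by (rule integrable_circle_continuous)
  show i: "integrable circle_measure (f n)" for n by (intro integrable_circle_continuous assms)
  show "(\<lambda>n. LINT t|circle_measure. norm (f n t - g t)) \<longlonglongrightarrow> 0"
  proof (rule LIMSEQ_I)
    fix e :: real assume e: "0 < e"
    then have "eventually (\<lambda>n. \<forall>x\<in>{0..2*pi}. dist (f n x) (g x) < e / (4*pi)) sequentially"
      using uniform_limitD[OF assms(2), of "e / (4*pi)"] by simp
    then obtain N where N: "\<And>n x. n \<ge> N \<Longrightarrow> x\<in>{0..2*pi} \<Longrightarrow> dist (f n x) (g x) < e / (4*pi)"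
      unfolding eventually_sequentially by blast
    show "\<exists>N. \<forall>n\<ge>N. norm ((LINT t|circle_measure. norm (f n t - g t)) - 0) < e"
    proof (intro exI allI impI)
      fix n assume n: "N \<le> n"
      have "(LINT t|circle_measure. norm (f n t - g t)) \<le> (LINT t|circle_measure. e / (4*pi))"
        by (rule integral_mono) (use i ig N[OF n] in \<open>auto simp: dist_norm intro!: less_imp_le\<close>)
      also have "\<dots> = e/2" by simp
      finally show "norm ((LINT t|circle_measure. norm (f n t - g t)) - 0) < e" using e by simp
    qed
  qed
qed

lemma absolutely_summable_cis:
  fixes c :: "nat \<Rightarrow> complex"
  assumes "summable (\<lambda>k. norm (c k))"
  shows uniform_limit_cis_series: "uniform_limit UNIV (\<lambda>n t. \<Sum>k<n. c k * cis (of_nat k * t)) (\<lambda>t. \<Sum>k. c k * cis (of_nat k * t)) sequentially"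
    and summable_cis_series: "summable (\<lambda>k. c k * cis (of_nat k * t))"
    and continuous_on_cis_series: "continuous_on S (\<lambda>t. \<Sum>k. c k * cis (of_nat k * t))"
proof -
  show u: "uniform_limit UNIV (\<lambda>n t. \<Sum>k<n. c k * cis (of_nat k * t)) (\<lambda>t. \<Sum>k. c k * cis (of_nat k * t)) sequentially"
    by (rule Weierstrass_m_test[OF _ assms]) (simp add: norm_mult)
  show "summable (\<lambda>k. c k * cis (of_nat k * t))"
    by (rule summable_norm_cancel) (simp add: norm_mult assms)
  have "continuous_on UNIV (\<lambda>t. \<Sum>k. c k * cis (of_nat k * t))"
    by (rule uniform_limit_theorem[OF _ u]) (auto intro!: always_eventually continuous_intros)
  then show "continuous_on S (\<lambda>t. \<Sum>k. c k * cis (of_nat k * t))"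
    by (rule continuous_on_subset) auto
qed

lemma fourier_coeff_cis_sum:
  "fourier_coeff (\<lambda>t. \<Sum>j<n. c j * cis (of_nat j * t)) k = (if 0 \<le> k \<and> k < int n then c (nat k) else 0)"
proof -
  have "fourier_coeff (\<lambda>t. c j * cis (of_nat j * t)) k = (if int j = k then c j else 0)" for j
    using fourier_coeff_cis[of "int j" k] by (simp add: fourier_coeff_cmult)
  then have "fourier_coeff (\<lambda>t. \<Sum>j<n. c j * cis (of_nat j * t)) k = (\<Sum>j<n. if int j = k then c j else 0)"
    by (subst fourier_coeff_sum) (auto intro!: integrable_circle_continuous continuous_intros)
  also have "\<dots> = (\<Sum>j<n. if j = nat k then if 0 \<le> k then c (nat k) else 0 else 0)"
    by (intro sum.cong) auto
  also have "\<dots> = (if 0 \<le> k \<and> k < int n then c (nat k) else 0)" by (auto simp: nat_less_iff)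
  finally show ?thesis .
qed

lemma fourier_coeff_cis_series:
  fixes c :: "nat \<Rightarrow> complex"
  assumes "summable (\<lambda>k. norm (c k))"
  shows "fourier_coeff (\<lambda>t. \<Sum>k. c k * cis (of_nat k * t)) k = (if 0 \<le> k then c (nat k) else 0)"
proof -
  have "(\<lambda>n. fourier_coeff (\<lambda>t. \<Sum>j<n. c j * cis (of_nat j * t)) k) \<longlonglongrightarrow> fourier_coeff (\<lambda>t. \<Sum>k. c k * cis (of_nat k * t)) k"
    by (rule fourier_coeff_uniform_limit)
       (auto intro!: continuous_intros uniform_limit_on_subset[OF uniform_limit_cis_series[OF assms]])
  moreover have "(\<lambda>n. fourier_coeff (\<lambda>t. \<Sum>j<n. c j * cis (of_nat j * t)) k) \<longlonglongrightarrow> (if 0 \<le> k then c (nat k) else 0)"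
    unfolding fourier_coeff_cis_sum
    by (rule tendsto_eventually, rule eventually_sequentiallyI[of "nat k + 1"]) auto
  ultimately show ?thesis using LIMSEQ_unique by blast
qed

section \<open>Taylor coefficients as Fourier coefficients on smaller circles\<close>

definition taylor_coeff :: "(complex \<Rightarrow> complex) \<Rightarrow> nat \<Rightarrow> complex" where
  "taylor_coeff h k = (deriv ^^ k) h 0 / fact k"

lemma taylor_sums:
  assumes "h holomorphic_on ball 0 1" "norm z < 1"
  shows "(\<lambda>k. taylor_coeff h k * z ^ k) sums h z"
  using holomorphic_power_series[OF assms(1), of z] assms(2) by (simp add: taylor_coeff_def)

lemma summable_norm_taylor:
  assumes "h holomorphic_on ball 0 1" "0 \<le> r" "r < 1"
  shows "summable (\<lambda>k. norm (taylor_coeff h k * of_real r ^ k))"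
proof -
  obtain R where R: "r < R" "R < 1" using assms(3) dense by blast
  have "summable (\<lambda>k. taylor_coeff h k * of_real R ^ k)"
    by (rule sums_summable[OF taylor_sums[OF assms(1)]]) (use R assms(2) in auto)
  then show ?thesis
    by (rule powser_insidea) (use R assms(2) in auto)
qed

lemma holomorphic_circle_series:
  assumes "h holomorphic_on ball 0 1" "0 \<le> r" "r < 1"
  shows "h (of_real r * cis t) = (\<Sum>k. (taylor_coeff h k * of_real r ^ k) * cis (of_nat k * t))"
proof -
  have "(\<lambda>k. taylor_coeff h k * (of_real r * cis t) ^ k) sums h (of_real r * cis t)"
    by (rule taylor_sums) (use assms in \<open>auto simp: norm_mult\<close>)
  then show ?thesis
    by (simp add: sums_iff power_mult_distrib Complex.DeMoivre mult_ac)
qed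

text \<open>The radius enters only through \<open>r ^ k\<close>, so Taylor coefficients can be
  bounded and compared on any circle of positive radius below 1.\<close>

lemma fourier_coeff_holomorphic_circle:
  assumes "h holomorphic_on ball 0 1" "0 \<le> r" "r < 1"
  shows "fourier_coeff (\<lambda>t. h (of_real r * cis t)) k = (if 0 \<le> k then taylor_coeff h (nat k) * of_real r ^ nat k else 0)"
  using fourier_coeff_cis_series[OF summable_norm_taylor[OF assms]]
  by (simp add: holomorphic_circle_series[OF assms])

lemma continuous_on_holomorphic_circle:
  assumes "h holomorphic_on ball 0 1" "0 \<le> r" "r < 1"
  shows "continuous_on S (\<lambda>t. h (of_real r * cis t))"
  by (rule continuous_on_compose2[OF holomorphic_on_imp_continuous_on[OF assms(1)]])
     (use assms in \<open>auto intro!: continuous_intros simp: norm_mult\<close>)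

lemma holomorphic_mean_value:
  fixes h :: "complex \<Rightarrow> complex"
  assumes "h holomorphic_on ball 0 1" "0 \<le> r" "r < 1"
  shows "integral\<^sup>L circle_measure (\<lambda>t. h (of_real r * cis t)) = 2 * pi * h 0"
  using fourier_coeff_holomorphic_circle[OF assms, of 0]
  by (simp add: fourier_coeff_def taylor_coeff_def divide_simps mult.commute)

text \<open>The factor \<open>1 / (1 - w * cis (- s))\<close> is the Szego kernel: at
  \<open>w = r * cis t\<close> this is the Riesz projection of \<open>f\<close>, damped by
  \<open>r ^ k\<close> in the \<open>k\<close>-th coefficient. As an integral it makes sense for
  every integrable \<open>f\<close>, before the projection is known to exist in L^p.\<close>

definition cauchy_int :: "(real \<Rightarrow> complex) \<Rightarrow> complex \<Rightarrow> complex" where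
  "cauchy_int f w = 1/(2*pi) * integral\<^sup>L circle_measure (\<lambda>s. f s / (1 - w * cis (- s)))"

lemma one_minus_cis_nonzero: "norm w < 1 \<Longrightarrow> 1 - w * cis s \<noteq> 0"
  by (metis mult.right_neutral norm_cis norm_mult norm_one order_less_irrefl right_minus_eq)

lemma norm_one_minus_cis_ge: "norm w < 1 \<Longrightarrow> 1 - norm w \<le> norm (1 - w * cis s)"
  using norm_triangle_ineq2[of 1 "w * cis s"] by (simp add: norm_mult)

lemma cauchy_int_integrable:
  assumes "integrable circle_measure f" "norm w < 1"
  shows "integrable circle_measure (\<lambda>s. f s / (1 - w * cis (- s)))"
proof -
  have "(\<lambda>s. 1 / (1 - w * cis (- s))) \<in> borel_measurable circle_measure"
    by (intro continuous_measurable_circle continuous_intros ballI one_minus_cis_nonzero assms)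
  moreover have "norm (1 / (1 - w * cis (- s))) \<le> 1 / (1 - norm w)" for s
    using norm_one_minus_cis_ge[OF assms(2), of "-s"] assms(2) by (simp add: norm_divide frac_le)
  ultimately have "integrable circle_measure (\<lambda>s. 1 / (1 - w * cis (- s)) * f s)"
    by (intro integrable_mult_bounded[OF assms(1)]) auto
  then show ?thesis by simp
qed

text \<open>The geometric series of the kernel has partial sums bounded by
  \<open>1 / (1 - norm w)\<close>, so integration term by term is dominated convergence.\<close>

lemma cauchy_int_sums:
  assumes f: "integrable circle_measure f" and w: "norm w < 1"
  shows "(\<lambda>k. fourier_coeff f (int k) * w ^ k) sums cauchy_int f w"
proof -
  have [measurable]: "f \<in> borel_measurable circle_measure" using f by auto
  have [measurable]: "(\<lambda>s. cis (- s)) \<in> borel_measurable circle_measure"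
    by (intro continuous_measurable_circle continuous_intros)
  let ?h = "\<lambda>n s. f s * (\<Sum>k<n. (w * cis (- s)) ^ k)"
  have "(\<lambda>n. integral\<^sup>L circle_measure (?h n)) \<longlonglongrightarrow> integral\<^sup>L circle_measure (\<lambda>s. f s / (1 - w * cis (- s)))"
  proof (rule integral_dominated_convergence[where w="\<lambda>s. norm (f s) * (1 / (1 - norm w))"])
    show "AE s in circle_measure. (\<lambda>n. ?h n s) \<longlonglongrightarrow> f s / (1 - w * cis (- s))"
    proof (rule AE_I2)
      fix s
      have "(\<lambda>k. (w * cis (- s)) ^ k) sums (1 / (1 - w * cis (- s)))"
        by (rule geometric_sums) (simp add: norm_mult w)
      then have "(\<lambda>n. ?h n s) \<longlonglongrightarrow> f s * (1 / (1 - w * cis (- s)))"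
        unfolding sums_def by (intro tendsto_intros)
      then show "(\<lambda>n. ?h n s) \<longlonglongrightarrow> f s / (1 - w * cis (- s))" by simp
    qed
    show "AE s in circle_measure. norm (?h n s) \<le> norm (f s) * (1 / (1 - norm w))" for n
    proof (rule AE_I2)
      fix s
      have "norm (\<Sum>k<n. (w * cis (- s)) ^ k) \<le> (\<Sum>k<n. norm w ^ k)"
        by (rule order_trans[OF norm_sum]) (simp add: norm_mult norm_power)
      also have "\<dots> \<le> (\<Sum>k. norm w ^ k)"
        by (rule sum_le_suminf) (use w in \<open>auto intro!: summable_geometric\<close>)
      also have "\<dots> = 1 / (1 - norm w)" by (rule suminf_geometric) (simp add: w)
      finally show "norm (?h n s) \<le> norm (f s) * (1 / (1 - norm w))"
        unfolding norm_mult by (rule mult_left_mono) simp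
    qed
  qed (use f cauchy_int_integrable[OF f w] in auto)
  moreover have "integral\<^sup>L circle_measure (?h n) = 2 * pi * (\<Sum>k<n. fourier_coeff f (int k) * w ^ k)" for n
  proof -
    have "?h n s = (\<Sum>k<n. w ^ k * (f s * cis (- (of_int (int k)) * s)))" for s
      by (simp add: sum_distrib_left power_mult_distrib Complex.DeMoivre mult_ac)
    then have "integral\<^sup>L circle_measure (?h n) = (\<Sum>k<n. w ^ k * integral\<^sup>L circle_measure (\<lambda>s. f s * cis (- (of_int (int k)) * s)))"
      using integrable_mult_cis[OF f, of "- of_int (int k)" for k]
      by (simp only:) (subst Bochner_Integration.integral_sum; simp)
    also have "\<dots> = 2 * pi * (\<Sum>k<n. fourier_coeff f (int k) * w ^ k)"
      by (simp add: fourier_coeff_def sum_distrib_left mult_ac)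
    finally show ?thesis .
  qed
  ultimately have "(\<lambda>n. 1 / (2 * pi) * (2 * pi * (\<Sum>k<n. fourier_coeff f (int k) * w ^ k))) \<longlonglongrightarrow> 
     1 / (2 * pi) * integral\<^sup>L circle_measure (\<lambda>s. f s / (1 - w * cis (- s)))"
    by (intro tendsto_intros) simp
  then show ?thesis by (simp add: sums_def cauchy_int_def)
qed

lemma cauchy_int_holomorphic:
  assumes f: "integrable circle_measure f"
  shows "cauchy_int f holomorphic_on ball 0 1"
proof (rule power_series_holomorphic)
  fix w assume "w \<in> ball (0::complex) 1"
  then show "(\<lambda>k. fourier_coeff f (int k) * (w - 0) ^ k) sums cauchy_int f w"
    using cauchy_int_sums[OF f, of w] by simp
qed

lemma cauchy_int_0: "cauchy_int f 0 = fourier_coeff f 0"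
  by (simp add: cauchy_int_def fourier_coeff_def)

text \<open>As \<open>norm (1 - w * cis (- s)) = norm (cis s - w)\<close>, this is the usual Poisson
  kernel, normalised to have integral \<open>2 * pi\<close>.\<close>

definition poisson_kernel :: "complex \<Rightarrow> real \<Rightarrow> real" where
  "poisson_kernel w s = (1 - (norm w)\<^sup>2) / (norm (1 - w * cis (- s)))\<^sup>2"

text \<open>The kernel is the real part of \<open>(1 + z) / (1 - z)\<close> with
  \<open>z = w * cis (- s)\<close>; written as \<open>2 / (1 - z) - 1\<close> it expresses Poisson
  integrals through \<open>cauchy_int\<close>.\<close>

lemma poisson_kernel_Re:
  assumes "norm w < 1"
  shows "poisson_kernel w s = Re (2 / (1 - w * cis (- s)) - 1)"
proof -
  define z where "z = w * cis (- s)"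
  have z: "norm z < 1" "norm z = norm w" using assms by (auto simp: z_def norm_mult)
  have "1 - z \<noteq> 0" using z by auto
  then have "(norm (1 - z))\<^sup>2 \<noteq> 0" by simp
  then have *: "(1 - Re z)\<^sup>2 + (Im z)\<^sup>2 \<noteq> 0" by (simp add: cmod_power2)
  have "Re (2 / (1 - z) - 1) = 2 * (1 - Re z) / ((1 - Re z)\<^sup>2 + (Im z)\<^sup>2) - 1"
    by (simp add: Re_divide)
  also have "\<dots> = (1 - ((Re z)\<^sup>2 + (Im z)\<^sup>2)) / ((1 - Re z)\<^sup>2 + (Im z)\<^sup>2)"
    using * by (simp add: divide_simps) (simp add: power2_eq_square algebra_simps)
  also have "\<dots> = (1 - (norm z)\<^sup>2) / (norm (1 - z))\<^sup>2"
    by (simp add: cmod_power2)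
  finally show ?thesis using z by (simp add: poisson_kernel_def z_def)
qed

text \<open>The denominator is at most \<open>(1 + norm w)\<^sup>2\<close>. This is the lower half
  of Harnack's inequality and also yields strict positivity.\<close>

lemma poisson_kernel_ge:
  assumes "norm w < 1"
  shows "poisson_kernel w s \<ge> (1 - norm w) / (1 + norm w)"
proof -
  define r where "r = norm w"
  have r: "0 \<le> r" "r < 1" using assms by (auto simp: r_def)
  define x where "x = norm (1 - w * cis (- s))"
  have "x \<le> 1 + r" using norm_triangle_ineq4[of 1 "w * cis (- s)"] by (simp add: x_def r_def norm_mult)
  moreover have "x > 0" using one_minus_cis_nonzero[OF assms, of "-s"] by (simp add: x_def)
  ultimately have "x\<^sup>2 \<le> (1 + r)\<^sup>2" by (intro power_mono) auto
  then have "(1 - r\<^sup>2) / (1 + r)\<^sup>2 \<le> (1 - r\<^sup>2) / x\<^sup>2"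
    using r \<open>x > 0\<close> by (intro divide_left_mono) (auto simp: abs_square_le_1)
  moreover have "(1 - r\<^sup>2) / (1 + r)\<^sup>2 = (1 - r) / (1 + r)"
    using r by (simp add: divide_simps) (simp add: power2_eq_square algebra_simps)
  ultimately show ?thesis by (simp add: poisson_kernel_def r_def x_def)
qed

lemma poisson_kernel_pos: "norm w < 1 \<Longrightarrow> poisson_kernel w s > 0"
  by (rule less_le_trans[OF _ poisson_kernel_ge]) (auto intro!: divide_pos_pos add_pos_nonneg)

text \<open>Conjugation exchanges the two angles. Hence the kernel has integral
  \<open>2 * pi\<close> in \<open>t\<close> as well, which the contraction on L^p needs.\<close>

lemma poisson_kernel_sym:
  "poisson_kernel (of_real r * cis t) s = poisson_kernel (of_real r * cis s) t"
proof -
  have "norm (1 - of_real r * cis t * cis (- s)) = norm (cnj (1 - of_real r * cis t * cis (- s)))"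
    by (rule complex_mod_cnj[symmetric])
  also have "cnj (1 - of_real r * cis t * cis (- s)) = 1 - of_real r * cis s * cis (- t)"
    by (simp add: cis_cnj)
  finally show ?thesis by (simp add: poisson_kernel_def norm_mult)
qed

lemma continuous_on_poisson_kernel:
  assumes "norm w < 1"
  shows "continuous_on S (poisson_kernel w)"
proof -
  have "1 - w * cis (- s) \<noteq> 0" for s using one_minus_cis_nonzero[OF assms] .
  then show ?thesis unfolding poisson_kernel_def by (intro continuous_intros) auto
qed

lemma poisson_integral_Re:
  fixes f :: "real \<Rightarrow> real"
  assumes f: "integrable circle_measure f" and w: "norm w < 1"
  shows "1/(2*pi) * integral\<^sup>L circle_measure (\<lambda>s. poisson_kernel w s * f s) = 
    Re (2 * cauchy_int f w - cauchy_int f 0)"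
    and "integrable circle_measure (\<lambda>s. poisson_kernel w s * f s)"
proof -
  let ?f = "\<lambda>s. complex_of_real (f s)"
  have fi: "integrable circle_measure ?f" using f by simp
  have i: "integrable circle_measure (\<lambda>s. 2 * (?f s / (1 - w * cis (- s))) - ?f s)"
    using cauchy_int_integrable[OF fi w] fi by (intro Bochner_Integration.integrable_diff integrable_mult_right) auto
  have "poisson_kernel w s * f s = Re (2 * (?f s / (1 - w * cis (- s))) - ?f s)" for s
  proof -
    have "Re ((2 / (1 - w * cis (- s)) - 1) * ?f s) = Re (2 / (1 - w * cis (- s)) - 1) * f s"
      by (simp only: Re_complex_of_real times_complex.sel Im_complex_of_real mult_zero_right diff_zero)
    then show ?thesis unfolding poisson_kernel_Re[OF w] by (simp add: algebra_simps)
  qed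
  then have eq: "(\<lambda>s. poisson_kernel w s * f s) = (\<lambda>s. Re (2 * (?f s / (1 - w * cis (- s))) - ?f s))" by auto
  show "integrable circle_measure (\<lambda>s. poisson_kernel w s * f s)"
    unfolding eq using i by (rule integrable_Re)
  have "integral\<^sup>L circle_measure (\<lambda>s. poisson_kernel w s * f s) = Re (integral\<^sup>L circle_measure (\<lambda>s. 2 * (?f s / (1 - w * cis (- s))) - ?f s))"
    unfolding eq by (rule integral_Re[OF i])
  also have "integral\<^sup>L circle_measure (\<lambda>s. 2 * (?f s / (1 - w * cis (- s))) - ?f s) = 
     2 * integral\<^sup>L circle_measure (\<lambda>s. ?f s / (1 - w * cis (- s))) - integral\<^sup>L circle_measure ?f"
    by (subst Bochner_Integration.integral_diff[OF integrable_mult_right[OF cauchy_int_integrable[OF fi w]] fi])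
       (simp only: integral_mult_right_zero)
  also have "\<dots> = of_real (2*pi) * (2 * cauchy_int f w - cauchy_int f 0)"
    by (simp add: cauchy_int_def algebra_simps)
  also have "Re \<dots> = 2*pi * Re (2 * cauchy_int f w - cauchy_int f 0)"
    by (simp only: times_complex.sel Re_complex_of_real Im_complex_of_real mult_zero_left diff_zero)
  finally show "1/(2*pi) * integral\<^sup>L circle_measure (\<lambda>s. poisson_kernel w s * f s) = 
    Re (2 * cauchy_int f w - cauchy_int f 0)" by simp
qed

lemma cauchy_int_one:
  assumes "norm w < 1" shows "cauchy_int (\<lambda>s. 1) w = 1"
proof -
  have "fourier_coeff (\<lambda>s. 1) k = (if k = 0 then 1 else 0)" for k
    using fourier_coeff_cis[of 0 k] by auto
  then have "(\<lambda>k. (if k = 0 then 1 else 0) * w ^ k) sums cauchy_int (\<lambda>s. 1) w"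
    using cauchy_int_sums[of "\<lambda>s. 1" w] assms by simp
  moreover have "(\<lambda>k. (if k = 0 then 1 else 0) * w ^ k) sums 1"
    using sums_single[of 0 "\<lambda>k. w ^ k"] by (simp add: if_distrib if_distribR cong: if_cong)
  ultimately show ?thesis by (rule sums_unique2)
qed

lemma poisson_kernel_integral:
  assumes "norm w < 1"
  shows "integral\<^sup>L circle_measure (poisson_kernel w) = 2 * pi"
  using poisson_integral_Re(1)[OF _ assms, of "\<lambda>s. 1"] cauchy_int_one[OF assms] cauchy_int_one[of 0]
  by simp

text \<open>Every kernel integrated twice below is continuous, since the radius stays below 1; the
  interchange of iterated integrals of a continuous function on a square is then enough.\<close>

lemma circle_fubini:
  fixes k :: "real \<Rightarrow> real \<Rightarrow> 'a::euclidean_space"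
  assumes "continuous_on ({0..2*pi} \<times> {0..2*pi}) (\<lambda>(t, s). k t s)"
  shows "(LINT t|circle_measure. LINT s|circle_measure. k t s) = (LINT s|circle_measure. LINT t|circle_measure. k t s)"
    and "continuous_on {0..2*pi} (\<lambda>t. LINT s|circle_measure. k t s)"
proof -
  have *: "(LINT t|circle_measure. LINT s|circle_measure. h t s) = integral {0..2*pi} (\<lambda>t. integral {0..2*pi} (h t))
     \<and> continuous_on {0..2*pi} (\<lambda>t. LINT s|circle_measure. h t s)"
    if "continuous_on ({0..2*pi} \<times> {0..2*pi}) (\<lambda>(t, s). h t s)" for h :: "real \<Rightarrow> real \<Rightarrow> 'a"
  proof -
    have c: "continuous_on {0..2*pi} (h t)" if "t \<in> {0..2*pi}" for t
    proof -
      have "continuous_on {0..2*pi} (\<lambda>s. (t, s))" by (intro continuous_intros)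
      from continuous_on_compose2[OF \<open>continuous_on ({0..2*pi} \<times> {0..2*pi}) (\<lambda>(t, s). h t s)\<close> this] that
      show ?thesis by (simp add: image_subset_iff)
    qed
    then have eq: "(LINT s|circle_measure. h t s) = integral {0..2*pi} (h t)" if "t \<in> {0..2*pi}" for t
      using that by (intro integral_circle_eq)
    have c2: "continuous_on {0..2*pi} (\<lambda>t. integral {0..2*pi} (h t))"
      using integral_continuous_on_param[of "{0..2*pi}" 0 "2*pi" h] that by simp
    have "continuous_on {0..2*pi} (\<lambda>t. LINT s|circle_measure. h t s)"
      by (rule continuous_on_eq[OF c2]) (use eq in auto)
    moreover have "(LINT t|circle_measure. LINT s|circle_measure. h t s) = (LINT t|circle_measure. integral {0..2*pi} (h t))"
      by (intro Bochner_Integration.integral_cong) (auto simp: eq)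
    ultimately show ?thesis using integral_circle_eq[OF c2] by simp
  qed
  have "continuous_on ({0..2*pi} \<times> {0..2*pi}) (\<lambda>(s, t). k t s)"
  proof -
    have "continuous_on ({0..2*pi} \<times> {0..2*pi}) (\<lambda>x. (snd x, fst x) :: real \<times> real)"
      by (intro continuous_intros)
    moreover have "(\<lambda>x. (snd x, fst x) :: real \<times> real) ` ({0..2*pi} \<times> {0..2*pi}) \<subseteq> {0..2*pi} \<times> {0..2*pi}"
      by auto
    ultimately show ?thesis
      using continuous_on_compose2[OF assms] by (fastforce simp: case_prod_beta)
  qed
  from *[OF this] *[OF assms] integral_swap_continuous[of 0 0 "2*pi" "2*pi" k] assms
  show "(LINT t|circle_measure. LINT s|circle_measure. k t s) = (LINT s|circle_measure. LINT t|circle_measure. k t s)"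
    by (simp add: cbox_Pair_eq)
  show "continuous_on {0..2*pi} (\<lambda>t. LINT s|circle_measure. k t s)" using *[OF assms] by blast
qed

section \<open>The M. Riesz inequality\<close>

text \<open>The tangent at \<open>a\<close> of the convex function \<open>x powr p\<close> lies
  below its graph. It is Young's inequality for \<open>x\<close> and \<open>a powr (p - 1)\<close>,
  multiplied by \<open>p\<close>.\<close>

lemma powr_tangent_le:
  fixes a x p :: real
  assumes "0 \<le> a" "0 \<le> x" "1 < p"
  shows "a powr p + p * a powr (p - 1) * (x - a) \<le> x powr p"
proof (cases "a = 0")
  case False
  then have a: "a > 0" using assms by simp
  define q where "q = p / (p - 1)"
  have q: "1 < q" "1/p + 1/q = 1" "(p - 1) * q = p" using assms by (auto simp: q_def field_simps)
  have "x * a powr (p - 1) \<le> x powr p / p + (a powr (p - 1)) powr q / q"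
    by (rule Youngs_inequality) (use assms q in auto)
  also have "(a powr (p - 1)) powr q = a powr p" by (simp add: powr_powr q)
  also have "1/q = 1 - 1/p" using q by simp
  then have "a powr p / q = a powr p * (1 - 1/p)" by (metis divide_inverse inverse_eq_divide)
  finally have "p * (x * a powr (p - 1)) \<le> p * (x powr p / p + a powr p * (1 - 1/p))"
    using assms by (intro mult_left_mono) auto
  also have "\<dots> = x powr p + (p - 1) * a powr p" using assms by (simp add: field_simps)
  finally have "p * (x * a powr (p - 1)) \<le> x powr p + (p - 1) * a powr p" .
  moreover have "a powr (p - 1) * a = a powr p" using a by (simp add: powr_diff)
  ultimately show ?thesis by (simp add: algebra_simps)
qed (use assms in simp)

lemma poisson_kernel_continuous_pair:
  assumes "0 \<le> r" "r < 1"
  shows "continuous_on S (\<lambda>(t, s). poisson_kernel (of_real r * cis t) s)"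
proof -
  have "1 - of_real r * cis t * cis (- s) \<noteq> 0" for t s
    by (rule one_minus_cis_nonzero) (use assms in \<open>simp add: norm_mult\<close>)
  then show ?thesis
    unfolding poisson_kernel_def case_prod_beta
    by (intro continuous_intros) auto
qed

text \<open>Jensen's inequality for the probability kernel, followed by Tonelli.\<close>

lemma poisson_integral_contraction:
  fixes f :: "real \<Rightarrow> real"
  assumes p: "1 < p" and f: "continuous_on {0..2*pi} f" "\<And>s. s \<in> {0..2*pi} \<Longrightarrow> 0 \<le> f s"
    and r: "0 \<le> r" "r < 1"
  defines "u \<equiv> \<lambda>t. Re (2 * cauchy_int f (of_real r * cis t) - cauchy_int f 0)"
  shows "integral\<^sup>L circle_measure (\<lambda>t. u t powr p) \<le> integral\<^sup>L circle_measure (\<lambda>t. f t powr p)"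
    and "\<And>t. 0 \<le> u t"
proof -
  have w: "norm (of_real r * cis t) < 1" for t using r by (simp add: norm_mult)
  have fi: "integrable circle_measure f" by (rule integrable_circle_continuous[OF f(1)])
  note u_eq = poisson_integral_Re(1)[OF fi w]
  have fp: "continuous_on {0..2*pi} (\<lambda>s. f s powr p)"
    using f p by (intro continuous_on_powr' continuous_intros) auto
  show u0: "0 \<le> u t" for t
    unfolding u_def u_eq[symmetric]
    using f(2) poisson_kernel_pos[OF w]
    by (intro mult_nonneg_nonneg integral_nonneg_AE AE_I2) (auto intro: less_imp_le)
  have cu: "continuous_on {0..2*pi} u"
    unfolding u_def using r fi
    by (intro continuous_intros continuous_on_holomorphic_circle cauchy_int_holomorphic) auto
  have "2*pi * (u t powr p) \<le> (LINT s|circle_measure. poisson_kernel (of_real r * cis t) s * f s powr p)" for t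
  proof -
    let ?P = "poisson_kernel (of_real r * cis t)"
    have i1: "integrable circle_measure (\<lambda>s. ?P s * c)" for c
      by (intro integrable_circle_continuous continuous_intros continuous_on_poisson_kernel w)
    have i2: "integrable circle_measure (\<lambda>s. ?P s * f s)"
      by (intro integrable_circle_continuous continuous_intros continuous_on_poisson_kernel w f)
    \<comment> \<open>The tangent inequality at \<open>u t\<close>, weighted by the kernel. The left
      side is arranged as a multiple of \<open>?P s\<close> plus a multiple of
      \<open>?P s * f s\<close>, both of known integral, so that the linear terms cancel.\<close>
    have "(LINT s|circle_measure. ?P s * (u t powr p - p * u t powr (p - 1) * u t) + p * u t powr (p - 1) * (?P s * f s))
       \<le> (LINT s|circle_measure. ?P s * f s powr p)"
    proof (rule integral_mono)
      show "integrable circle_measure (\<lambda>s. ?P s * f s powr p)"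
        by (intro integrable_circle_continuous continuous_intros continuous_on_poisson_kernel w fp)
      show "integrable circle_measure (\<lambda>s. ?P s * (u t powr p - p * u t powr (p - 1) * u t) + p * u t powr (p - 1) * (?P s * f s))"
        by (intro Bochner_Integration.integrable_add integrable_mult_right i1 i2)
      fix s assume "s \<in> space circle_measure"
      then have "u t powr p + p * u t powr (p - 1) * (f s - u t) \<le> f s powr p"
        by (intro powr_tangent_le u0 f p) simp
      then have "?P s * (u t powr p + p * u t powr (p - 1) * (f s - u t)) \<le> ?P s * f s powr p"
        by (rule mult_left_mono) (simp add: less_imp_le poisson_kernel_pos w)
      then show "?P s * (u t powr p - p * u t powr (p - 1) * u t) + p * u t powr (p - 1) * (?P s * f s) \<le> ?P s * f s powr p"
        by (simp add: algebra_simps)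
    qed
    also have "(LINT s|circle_measure. ?P s * (u t powr p - p * u t powr (p - 1) * u t) + p * u t powr (p - 1) * (?P s * f s))
      = 2*pi * (u t powr p - p * u t powr (p - 1) * u t) + p * u t powr (p - 1) * (LINT s|circle_measure. ?P s * f s)"
      by (subst Bochner_Integration.integral_add[OF i1 integrable_mult_right[OF i2]]) (simp add: poisson_kernel_integral[OF w])
    also have "(LINT s|circle_measure. ?P s * f s) = 2*pi * u t"
      unfolding u_def u_eq[symmetric] by simp
    finally show ?thesis by (simp add: algebra_simps)
  qed
  note key = this
  have cP: "continuous_on ({0..2*pi} \<times> {0..2*pi}) (\<lambda>(t, s). poisson_kernel (of_real r * cis t) s * f s powr p)"
  proof -
    have "continuous_on ({0..2*pi} \<times> {0..2*pi}) (\<lambda>(t, s). f s powr p)"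
      unfolding case_prod_beta by (rule continuous_on_compose2[OF fp continuous_on_snd[OF continuous_on_id]]) auto
    from continuous_on_mult[OF poisson_kernel_continuous_pair[OF r] this] show ?thesis
      by (simp add: case_prod_beta)
  qed
  have up: "continuous_on {0..2*pi} (\<lambda>t. u t powr p)"
    using p u0 by (intro continuous_on_powr' continuous_intros cu) auto
  have "2*pi * (LINT t|circle_measure. u t powr p) = (LINT t|circle_measure. 2*pi * (u t powr p))" by simp
  also have "\<dots> \<le> (LINT t|circle_measure. LINT s|circle_measure. poisson_kernel (of_real r * cis t) s * f s powr p)"
    by (intro integral_mono integrable_circle_continuous continuous_on_mult[OF continuous_on_const up] circle_fubini(2)[OF cP] key)
  also have "\<dots> = (LINT s|circle_measure. LINT t|circle_measure. poisson_kernel (of_real r * cis t) s * f s powr p)"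
    by (rule circle_fubini(1)[OF cP])
  also have "\<dots> = (LINT s|circle_measure. 2*pi * f s powr p)"
  proof (intro Bochner_Integration.integral_cong refl)
    fix s
    have "(LINT t|circle_measure. poisson_kernel (of_real r * cis t) s) = 2*pi"
      unfolding poisson_kernel_sym[of r _ s] by (rule poisson_kernel_integral[OF w])
    then show "(LINT t|circle_measure. poisson_kernel (of_real r * cis t) s * f s powr p) = 2*pi * f s powr p"
      by simp
  qed
  also have "\<dots> = 2*pi * (LINT s|circle_measure. f s powr p)" by simp
  finally show "integral\<^sup>L circle_measure (\<lambda>t. u t powr p) \<le> integral\<^sup>L circle_measure (\<lambda>t. f t powr p)" by simp
qed

lemma Re_powr_polar:
  assumes "Re w > 0"
  shows "norm (Arg w) < pi/2" "Re w = norm w * cos (Arg w)" 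
    "Re (w powr of_real p) = norm w powr p * cos (p * Arg w)"
proof -
  have w: "w \<noteq> 0" using assms by auto
  show "norm (Arg w) < pi/2" using assms Re_Ln_pos_lt[OF w] Arg_eq_Im_Ln[OF w] by simp
  show "Re w = norm w * cos (Arg w)"
    using w by (simp add: cos_Arg)
  have "w powr of_real p = exp (of_real p * Ln w)" using w by (simp add: powr_def)
  also have "Ln w = of_real (ln (norm w)) + \<i> * of_real (Arg w)"
    using w by (simp add: complex_eq_iff Arg_eq_Im_Ln)
  finally have "Re (w powr of_real p) = exp (p * ln (norm w)) * cos (p * Arg w)"
    by (simp add: Re_exp)
  then show "Re (w powr of_real p) = norm w powr p * cos (p * Arg w)"
    using w by (simp add: powr_def)
qed

text \<open>The angle \<open>\<theta>\<close> is chosen with \<open>pi / 2 < p * \<theta>\<close>, so that \<open>cos (p * x) < 0\<close> where \<open>cos x\<close> is small;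
  this is where \<open>p \<le> 2\<close> is used.\<close>

lemma calderon_inequality:
  fixes p :: real
  assumes p: "1 < p" "p \<le> 2"
  obtains A B where "0 \<le> A" "0 \<le> B" 
    "\<And>w. 0 < Re w \<Longrightarrow> norm w powr p \<le> A * (Re w) powr p - B * Re (w powr of_real p)"
proof -
  \<comment> \<open>The midpoint of \<open>pi/(2*p)\<close> and \<open>pi/2\<close>; these differ
    because \<open>p > 1\<close>.\<close>
  define \<theta> where "\<theta> = (pi/(2*p) + pi/2) / 2"
  have pt: "p * \<theta> = pi/4 + p * pi/4" using p by (simp add: \<theta>_def field_simps)
  have ppi: "pi < p * pi" "p * pi \<le> 2 * pi" using p by auto
  have \<theta>: "0 < \<theta>" "\<theta> < pi/2" using p ppi by (auto simp: \<theta>_def field_simps intro!: add_pos_pos divide_pos_pos)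
  have ptr: "pi/2 < p * \<theta>" "p * \<theta> \<le> pi" unfolding pt using ppi pi_gt_zero by linarith+
  have ct: "0 < cos \<theta>" using \<theta> by (intro cos_gt_zero) auto
  have cpt: "cos (p * \<theta>) < 0"
    using cos_monotone_0_pi[of "pi/2" "p*\<theta>"] ptr by simp
  \<comment> \<open>\<open>B\<close> is normalised by \<open>B * cos (p * \<theta>) = -1\<close>, so
    for \<open>x \<ge> \<theta>\<close> the term \<open>- B * cos (p * x)\<close> alone reaches 1.
    For \<open>x < \<theta>\<close> that term may be as bad as \<open>- B\<close>, and
    \<open>A\<close> is chosen so that \<open>A * cos x powr p \<ge> 1 + B\<close>.\<close>
  define B where "B = - 1 / cos (p * \<theta>)"
  define A where "A = (1 + B) / cos \<theta> powr p"
  have B: "0 \<le> B" using cpt by (simp add: B_def divide_nonneg_neg)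
  have A: "0 \<le> A" using B by (simp add: A_def)
  have main: "1 \<le> A * cos x powr p - B * cos (p * x)" if x: "0 \<le> x" "x < pi/2" for x
  proof (cases "\<theta> \<le> x")
    case True
    have "p * x < p * (pi/2)" using x p by simp
    then have "p * x \<le> pi" using ppi by (simp only: times_divide_eq_right)
    moreover have "p * \<theta> \<le> p * x" using True p by simp
    ultimately have "cos (p * x) \<le> cos (p * \<theta>)"
      using p \<theta> by (intro cos_monotone_0_pi_le) auto
    then have "B * cos (p * x) \<le> B * cos (p * \<theta>)" using B by (rule mult_left_mono)
    also have "\<dots> = -1" using cpt by (simp add: B_def)
    finally have "B * cos (p * x) \<le> -1" .
    moreover have "0 \<le> A * cos x powr p" using A by simp
    ultimately show ?thesis by simp
  next
    case False
    have "cos \<theta> \<le> cos x" using False x \<theta> by (intro cos_monotone_0_pi_le) auto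
    then have "cos \<theta> powr p \<le> cos x powr p" using ct p by (intro powr_mono2) auto
    then have "A * cos \<theta> powr p \<le> A * cos x powr p" using A by (rule mult_left_mono)
    moreover have "A * cos \<theta> powr p = 1 + B" using ct by (simp add: A_def)
    moreover have "B * cos (p * x) \<le> B * 1" using B by (intro mult_left_mono) auto
    ultimately show ?thesis by simp
  qed
  show ?thesis
  proof (rule that[OF A B])
    fix w :: complex assume w: "0 < Re w"
    note W = Re_powr_polar[OF w]
    have c: "0 < cos (Arg w)" using W(1) by (intro cos_gt_zero_pi) auto
    have "cos (\<bar>Arg w\<bar>) = cos (Arg w)" "cos (p * \<bar>Arg w\<bar>) = cos (p * Arg w)"
      by (auto simp: abs_if)
    with main[of "\<bar>Arg w\<bar>"] W(1) have "1 \<le> A * cos (Arg w) powr p - B * cos (p * Arg w)" by simp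
    then have "norm w powr p * 1 \<le> norm w powr p * (A * cos (Arg w) powr p - B * cos (p * Arg w))"
      by (rule mult_left_mono) auto
    also have "\<dots> = A * (Re w) powr p - B * Re (w powr of_real p)"
      unfolding W(2,3) using c by (simp add: powr_mult algebra_simps)
    finally show "norm w powr p \<le> A * (Re w) powr p - B * Re (w powr of_real p)" by simp
  qed
qed

text \<open>The inequality is integrated for the holomorphic function \<open>F\<close> whose real part is the Poisson
  integral of \<open>f\<close>; the term \<open>\<integral> Re (F powr p) = 2 * pi * F 0 powr p \<ge> 0\<close> is dropped.\<close>

lemma cauchy_int_bound_nonneg:
  fixes p :: real
  assumes p: "1 < p" "p \<le> 2"
  obtains C where "0 \<le> C" "\<And>f r. continuous_on {0..2*pi} f \<Longrightarrow> (\<And>s. s \<in> {0..2*pi} \<Longrightarrow> 0 \<le> f s) \<Longrightarrow> 0 \<le> r \<Longrightarrow> r < 1 \<Longrightarrow>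
    p_int p (\<lambda>t. cauchy_int (\<lambda>s. complex_of_real (f s)) (of_real r * cis t)) \<le> C * p_int p (\<lambda>s. of_real (f s))"
proof -
  obtain A B where AB: "0 \<le> A" "0 \<le> B" 
    "\<And>w. 0 < Re w \<Longrightarrow> norm w powr p \<le> A * (Re w) powr p - B * Re (w powr of_real p)"
    using calderon_inequality[OF p] by blast
  show ?thesis
  proof (rule that[of "2 powr p * (A + 1)"])
    show "0 \<le> 2 powr p * (A + 1)" using AB by simp
    fix f :: "real \<Rightarrow> real" and r :: real
    assume f: "continuous_on {0..2*pi} f" "\<And>s. s \<in> {0..2*pi} \<Longrightarrow> 0 \<le> f s" and r: "0 \<le> r" "r < 1"
    let ?f = "\<lambda>s. complex_of_real (f s)"
    have fi: "integrable circle_measure ?f"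
      by (intro integrable_circle_continuous continuous_intros f)
    have If: "p_int p ?f = integral\<^sup>L circle_measure (\<lambda>t. f t powr p)"
      unfolding p_int_def by (intro Bochner_Integration.integral_cong) (use f in auto)
    define F where "F w = 2 * cauchy_int ?f w - cauchy_int ?f 0" for w
    have hF: "F holomorphic_on ball 0 1"
      unfolding F_def by (intro holomorphic_intros cauchy_int_holomorphic fi)
    define c where "c = 1/(2*pi) * integral\<^sup>L circle_measure f"
    have c0: "0 \<le> c" unfolding c_def
      by (intro mult_nonneg_nonneg integral_nonneg_AE AE_I2) (use f in auto)
    have cF: "cauchy_int ?f 0 = of_real c" "F 0 = of_real c"
      by (auto simp: F_def cauchy_int_def c_def integral_complex_of_real)
    have cpt: "continuous_on {0..2*pi} (\<lambda>t. F (of_real r * cis t))"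
      by (intro continuous_on_holomorphic_circle hF r)
    have bF: "p_int p (\<lambda>t. F (of_real r * cis t)) \<le> A * p_int p ?f"
    \<comment> \<open>Mean 0 forces all coefficients of the nonnegative \<open>f\<close>, hence
      \<open>F\<close>, to vanish. Otherwise the lower bound on the Poisson kernel makes
      \<open>Re F\<close> strictly positive, so that \<open>F powr p\<close> is holomorphic.\<close>
    proof (cases "c = 0")
      case True
      have "norm (fourier_coeff ?f k) \<le> c" for k
      proof -
        have "integral\<^sup>L circle_measure (\<lambda>t. norm (?f t)) = integral\<^sup>L circle_measure f"
          by (intro Bochner_Integration.integral_cong) (use f in auto)
        then show ?thesis using norm_fourier_coeff_le[OF fi, of k] by (simp add: c_def)
      qed
      then have "fourier_coeff ?f k = 0" for k using True by simp
      then have "cauchy_int ?f w = 0" if "norm w < 1" for w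
        using cauchy_int_sums[OF fi that] by (simp add: sums_iff)
      then have "F (of_real r * cis t) = 0" for t
        using r by (simp add: F_def norm_mult)
      then show ?thesis using AB by (simp add: p_int_def)
    next
      case False
      then have c: "c > 0" using c0 by simp
      have RF: "Re (F w) > 0" if w: "norm w < 1" for w
      proof -
        have fi': "integrable circle_measure f" by (rule integrable_circle_continuous[OF f(1)])
        have "(1 - norm w) / (1 + norm w) * (2 * pi * c) = (LINT s|circle_measure. (1 - norm w) / (1 + norm w) * f s)"
          by (simp add: c_def)
        also have "\<dots> \<le> (LINT s|circle_measure. poisson_kernel w s * f s)"
          by (intro integral_mono poisson_integral_Re(2) mult_right_mono poisson_kernel_ge w) (use f fi' in auto)
        finally have "(1 - norm w) / (1 + norm w) * (2 * pi * c) \<le> 2*pi * Re (F w)"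
          using poisson_integral_Re(1)[OF fi' w] by (simp add: F_def field_simps)
        moreover have "0 < (1 - norm w) / (1 + norm w) * (2 * pi * c)"
          using w c by (intro mult_pos_pos divide_pos_pos add_pos_nonneg) auto
        ultimately have "0 < 2 * pi * Re (F w)" by linarith
        then show ?thesis by (simp add: zero_less_mult_iff)
      qed
      have w: "norm (of_real r * cis t) < 1" for t using r by (simp add: norm_mult)
      have hp: "(\<lambda>w. F w powr of_real p) holomorphic_on ball 0 1"
        by (intro holomorphic_intros hF) (use RF in \<open>force simp: complex_nonpos_Reals_iff\<close>)
      have ihp: "integrable circle_measure (\<lambda>t. F (of_real r * cis t) powr of_real p)"
        by (intro integrable_circle_continuous continuous_on_holomorphic_circle[OF hp] r)
      have "integral\<^sup>L circle_measure (\<lambda>t. Re (F (of_real r * cis t) powr of_real p)) 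
         = Re (integral\<^sup>L circle_measure (\<lambda>t. F (of_real r * cis t) powr of_real p))"
        by (rule integral_Re[OF ihp])
      also have "\<dots> = Re (2 * pi * (F 0 powr of_real p))"
        using holomorphic_mean_value[OF hp r] by simp
      also have "\<dots> = 2 * pi * c powr p"
        using c0 by (simp add: cF powr_of_real)
      finally have M: "integral\<^sup>L circle_measure (\<lambda>t. Re (F (of_real r * cis t) powr of_real p)) = 2 * pi * c powr p" .
      have ip: "integrable circle_measure (\<lambda>t. Re (F (of_real r * cis t)) powr p)"
        using RF[OF w] p by (intro integrable_circle_continuous continuous_on_powr' continuous_intros cpt) (auto intro: less_imp_le)
      have ip2: "integrable circle_measure (\<lambda>t. norm (F (of_real r * cis t)) powr p)"
        using p by (intro integrable_circle_continuous continuous_on_powr' continuous_intros cpt) auto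
      have "p_int p (\<lambda>t. F (of_real r * cis t)) \<le> 
        (LINT t|circle_measure. A * (Re (F (of_real r * cis t))) powr p - B * Re (F (of_real r * cis t) powr of_real p))"
        unfolding p_int_def using ip ip2 integrable_Re[OF ihp] AB(3)[OF RF[OF w]]
        by (intro integral_mono) auto
      also have "\<dots> = A * (LINT t|circle_measure. (Re (F (of_real r * cis t))) powr p) - B * (2 * pi * c powr p)"
        using ip integrable_Re[OF ihp] M by simp
      also have "\<dots> \<le> A * (LINT t|circle_measure. (Re (F (of_real r * cis t))) powr p)"
        using AB by simp
      also have "\<dots> \<le> A * p_int p ?f"
        unfolding If F_def by (intro mult_left_mono poisson_integral_contraction(1) p f r AB)
      finally show ?thesis .
    qed
    \<comment> \<open>The constant \<open>c\<close> is the value of the Poisson integral at the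
      origin, so this is the contraction property at radius 0.\<close>
    have bc: "p_int p (\<lambda>t. of_real c) \<le> p_int p ?f"
    proof -
      have "p_int p (\<lambda>t. of_real c) = 2*pi * c powr p" using c0 by (simp add: p_int_def)
      then show ?thesis unfolding If
        using poisson_integral_contraction(1)[OF p(1) f, of 0] by (simp add: cF)
    qed
    \<comment> \<open>\<open>cauchy_int\<close> is recovered from \<open>F\<close> as
      \<open>(F + c) / 2\<close>; the factor 1/2 is estimated by 1.\<close>
    have "p_int p (\<lambda>t. cauchy_int ?f (of_real r * cis t)) = p_int p (\<lambda>t. (1/2) * (F (of_real r * cis t) + of_real c))"
      by (simp add: F_def cF)
    also have "\<dots> \<le> (1::real) powr p * p_int p (\<lambda>t. F (of_real r * cis t) + of_real c)"
      by (rule p_int_mult_bounded[OF Lp_continuous]) (use p cpt in \<open>auto intro!: continuous_intros\<close>)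
    also have "\<dots> \<le> 2 powr p * (p_int p (\<lambda>t. F (of_real r * cis t)) + p_int p (\<lambda>t. of_real c))"
      using p cpt by (simp) (intro p_int_add_le Lp_continuous; auto)
    also have "\<dots> \<le> 2 powr p * (A * p_int p ?f + p_int p ?f)"
      by (intro mult_left_mono add_mono bF bc) auto
    also have "\<dots> = 2 powr p * (A + 1) * p_int p ?f" by (simp add: algebra_simps)
    finally show "p_int p (\<lambda>t. cauchy_int ?f (of_real r * cis t)) \<le> 2 powr p * (A + 1) * p_int p ?f" .
  qed
qed

lemma cauchy_int_linear:
  assumes "integrable circle_measure f" "integrable circle_measure g" "norm w < 1"
  shows "cauchy_int (\<lambda>s. a * f s + b * g s) w = a * cauchy_int f w + b * cauchy_int g w"
proof -
  have eq: "(a * f s + b * g s) / (1 - w * cis (- s)) = a * (f s / (1 - w * cis (- s))) + b * (g s / (1 - w * cis (- s)))" for s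
    by (simp add: add_divide_distrib)
  have "(LINT s|circle_measure. a * (f s / (1 - w * cis (- s))) + b * (g s / (1 - w * cis (- s)))) =
    a * (LINT s|circle_measure. f s / (1 - w * cis (- s))) + b * (LINT s|circle_measure. g s / (1 - w * cis (- s)))"
    by (subst Bochner_Integration.integral_add
          [OF integrable_mult_right integrable_mult_right, OF cauchy_int_integrable cauchy_int_integrable])
       (simp_all only: assms integral_mult_right_zero)
  then show ?thesis
    unfolding cauchy_int_def eq by (simp only: distrib_left mult.left_commute)
qed

text \<open>Real and imaginary parts, and then positive and negative parts, are continuous and
  dominated by \<open>norm f\<close>, so linearity of \<open>cauchy_int\<close> reduces to
  nonnegative functions. The nested factors \<open>2 powr p\<close> record the two
  splittings.\<close>

lemma cauchy_int_bound_le_2: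
  fixes p :: real
  assumes p: "1 < p" "p \<le> 2"
  obtains C where "0 \<le> C" "\<And>f r. continuous_on {0..2*pi} f \<Longrightarrow> 0 \<le> r \<Longrightarrow> r < 1 \<Longrightarrow>
    p_int p (\<lambda>t. cauchy_int f (of_real r * cis t)) \<le> C * p_int p f"
proof -
  obtain C where C: "0 \<le> C" "\<And>f r. continuous_on {0..2*pi} f \<Longrightarrow> (\<And>s. s \<in> {0..2*pi} \<Longrightarrow> 0 \<le> f s) \<Longrightarrow> 0 \<le> r \<Longrightarrow> r < 1 \<Longrightarrow>
    p_int p (\<lambda>t. cauchy_int (\<lambda>s. complex_of_real (f s)) (of_real r * cis t)) \<le> C * p_int p (\<lambda>s. of_real (f s))"
    using cauchy_int_bound_nonneg[OF p] by blast
  show ?thesis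
  proof (rule that[of "2 powr p * (2 powr p * (2 * C) + 2 powr p * (2 * C))"])
    show "0 \<le> 2 powr p * (2 powr p * (2 * C) + 2 powr p * (2 * C))" using C by simp
    fix f :: "real \<Rightarrow> complex" and r :: real
    assume f: "continuous_on {0..2*pi} f" and r: "0 \<le> r" "r < 1"
    have w: "norm (of_real r * cis t) < 1" for t using r by (simp add: norm_mult)
    let ?S = "\<lambda>g t. cauchy_int g (of_real r * cis t)"
    have cS: "continuous_on {0..2*pi} (?S g)" if "continuous_on {0..2*pi} g" for g
      by (intro continuous_on_holomorphic_circle cauchy_int_holomorphic integrable_circle_continuous that r)
    have part: "p_int p (?S (\<lambda>s. of_real (h s))) \<le> 2 powr p * (2 * C) * p_int p f"
      if h: "continuous_on {0..2*pi} h" "\<And>s. \<bar>h s\<bar> \<le> norm (f s)" for h :: "real \<Rightarrow> real"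
    proof -
      define hp hm where "hp s = max (h s) 0" and "hm s = max (- h s) 0" for s
      have c: "continuous_on {0..2*pi} hp" "continuous_on {0..2*pi} hm"
        unfolding hp_def hm_def by (intro continuous_intros h)+
      have nn: "0 \<le> hp s" "0 \<le> hm s" for s by (auto simp: hp_def hm_def)
      have "p_int p (\<lambda>s. of_real (g s)) \<le> p_int p f" if "continuous_on {0..2*pi} g" "\<And>s. \<bar>g s\<bar> \<le> norm (f s)" for g :: "real \<Rightarrow> real"
        unfolding p_int_def using p that f
        by (intro integral_mono LpD(2) Lp_continuous powr_mono2 continuous_intros) auto
      then have le: "p_int p (\<lambda>s. of_real (hp s)) \<le> p_int p f" "p_int p (\<lambda>s. of_real (hm s)) \<le> p_int p f"
        using c h(2) by (force simp: hp_def hm_def max_def abs_le_iff)+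
      have i: "integrable circle_measure (\<lambda>s. complex_of_real (hp s))" "integrable circle_measure (\<lambda>s. complex_of_real (hm s))"
        by (intro integrable_circle_continuous continuous_intros c)+
      have "of_real (h s) = 1 * complex_of_real (hp s) + (-1) * of_real (hm s)" for s
        by (simp add: hp_def hm_def max_def)
      then have "?S (\<lambda>s. of_real (h s)) t = ?S (\<lambda>s. of_real (hp s)) t - ?S (\<lambda>s. of_real (hm s)) t" for t
        using cauchy_int_linear[OF i w, of 1 "-1" t] by simp
      then have "p_int p (?S (\<lambda>s. of_real (h s))) = p_int p (\<lambda>t. ?S (\<lambda>s. of_real (hp s)) t - ?S (\<lambda>s. of_real (hm s)) t)"
        by simp
      also have "\<dots> \<le> 2 powr p * (p_int p (?S (\<lambda>s. of_real (hp s))) + p_int p (?S (\<lambda>s. of_real (hm s))))"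
        using p c by (intro p_int_diff_le Lp_continuous cS continuous_intros) auto
      also have "\<dots> \<le> 2 powr p * (C * p_int p (\<lambda>s. of_real (hp s)) + C * p_int p (\<lambda>s. of_real (hm s)))"
        using C(2)[OF c(1) _ r] C(2)[OF c(2) _ r] nn by (intro mult_left_mono add_mono) auto
      also have "\<dots> \<le> 2 powr p * (C * p_int p f + C * p_int p f)"
        using C(1) by (intro mult_left_mono add_mono le) auto
      finally show ?thesis by (simp add: algebra_simps)
    qed
    have cRI: "continuous_on {0..2*pi} (\<lambda>s. Re (f s))" "continuous_on {0..2*pi} (\<lambda>s. Im (f s))"
      by (intro continuous_intros f)+
    have i: "integrable circle_measure (\<lambda>s. complex_of_real (Re (f s)))" "integrable circle_measure (\<lambda>s. complex_of_real (Im (f s)))"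
      by (intro integrable_circle_continuous continuous_intros f)+
    have "f s = 1 * of_real (Re (f s)) + \<i> * of_real (Im (f s))" for s
      using complex_eq[of "f s"] by simp
    then have "?S f t = ?S (\<lambda>s. of_real (Re (f s))) t + \<i> * ?S (\<lambda>s. of_real (Im (f s))) t" for t
      using cauchy_int_linear[OF i w, of 1 "\<i>" t] by simp
    then have "p_int p (?S f) = p_int p (\<lambda>t. ?S (\<lambda>s. of_real (Re (f s))) t + \<i> * ?S (\<lambda>s. of_real (Im (f s))) t)"
      by simp
    also have "\<dots> \<le> 2 powr p * (p_int p (?S (\<lambda>s. of_real (Re (f s)))) + p_int p (\<lambda>t. \<i> * ?S (\<lambda>s. of_real (Im (f s))) t))"
      using p by (intro p_int_add_le Lp_continuous cS continuous_intros f) auto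
    also have "p_int p (\<lambda>t. \<i> * ?S (\<lambda>s. of_real (Im (f s))) t) = p_int p (?S (\<lambda>s. of_real (Im (f s))))"
      by (simp add: p_int_def norm_mult)
    also have "2 powr p * (p_int p (?S (\<lambda>s. of_real (Re (f s)))) + p_int p (?S (\<lambda>s. of_real (Im (f s)))))
      \<le> 2 powr p * (2 powr p * (2 * C) * p_int p f + 2 powr p * (2 * C) * p_int p f)"
      by (intro mult_left_mono add_mono part cRI abs_Re_le_cmod abs_Im_le_cmod) auto
    finally show "p_int p (?S f) \<le> 2 powr p * (2 powr p * (2 * C) + 2 powr p * (2 * C)) * p_int p f"
      by (simp add: algebra_simps)
  qed
qed

text \<open>Exchanging \<open>t\<close> and \<open>s\<close> conjugates the Szego kernel, so the
  damped projection is symmetric for the pairing that integrates \<open>f * cnj u\<close>.\<close>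

lemma cauchy_int_adjoint:
  assumes f: "continuous_on {0..2*pi} f" and u: "continuous_on {0..2*pi} u" and r: "0 \<le> r" "r < 1"
  shows "integral\<^sup>L circle_measure (\<lambda>t. cauchy_int f (of_real r * cis t) * cnj (u t)) = 
    integral\<^sup>L circle_measure (\<lambda>s. f s * cnj (cauchy_int u (of_real r * cis s)))"
proof -
  let ?k = "\<lambda>t s. f s / (1 - of_real r * cis t * cis (- s)) * cnj (u t)"
  have nz: "1 - of_real r * cis t * cis (- s) \<noteq> 0" for t s
    by (rule one_minus_cis_nonzero) (use r in \<open>simp add: norm_mult\<close>)
  have *: "continuous_on ({0..2*pi} \<times> {0..2*pi}) (\<lambda>x. f (snd x))" "continuous_on ({0..2*pi} \<times> {0..2*pi}) (\<lambda>x. u (fst x))"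
    by (rule continuous_on_compose2[OF f] continuous_on_compose2[OF u], auto intro!: continuous_intros)+
  have c: "continuous_on ({0..2*pi} \<times> {0..2*pi}) (\<lambda>(t, s). ?k t s)"
    unfolding case_prod_beta by (intro continuous_intros *) (use nz in auto)
  have "integral\<^sup>L circle_measure (\<lambda>t. cauchy_int f (of_real r * cis t) * cnj (u t)) = 
    1/(2*pi) * (LINT t|circle_measure. LINT s|circle_measure. ?k t s)"
    unfolding cauchy_int_def by (simp only: mult.assoc integral_mult_left_zero integral_mult_right_zero)
  also have "(LINT t|circle_measure. LINT s|circle_measure. ?k t s) = (LINT s|circle_measure. LINT t|circle_measure. ?k t s)"
    by (rule circle_fubini(1)[OF c])
  also have "1/(2*pi) * \<dots> = (LINT s|circle_measure. 1/(2*pi) * (LINT t|circle_measure. ?k t s))" by simp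
  also have "\<dots> = integral\<^sup>L circle_measure (\<lambda>s. f s * cnj (cauchy_int u (of_real r * cis s)))"
  proof (intro Bochner_Integration.integral_cong refl)
    fix s
    have eq: "?k t s = f s * cnj (u t / (1 - of_real r * cis s * cis (- t)))" for t
      by (simp add: cis_cnj mult_ac)
    show "1/(2*pi) * (LINT t|circle_measure. ?k t s) = f s * cnj (cauchy_int u (of_real r * cis s))"
    proof -
      have "(LINT t|circle_measure. f s * cnj (h t)) = f s * cnj (LINT t|circle_measure. h t)" for h by simp
      note key = this
      show ?thesis unfolding eq key cauchy_int_def by simp
    qed
  qed
  finally show ?thesis .
qed

text \<open>Duality: if \<open>g\<close> is the Cauchy integral on the circle of radius
  \<open>r\<close>, then \<open>p_int p g\<close> is the pairing of \<open>g\<close> with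
  \<open>norm g powr (p - 2) * g\<close>. The adjoint moves the operator onto that function, where
  the bound for the conjugate exponent \<open>q \<le> 2\<close> applies.\<close>

lemma cauchy_int_bound_ge_2:
  fixes p :: real
  assumes p: "2 < p"
  obtains C where "0 \<le> C" "\<And>f r. continuous_on {0..2*pi} f \<Longrightarrow> 0 \<le> r \<Longrightarrow> r < 1 \<Longrightarrow>
    p_int p (\<lambda>t. cauchy_int f (of_real r * cis t)) \<le> C * p_int p f"
proof -
  define q where "q = p / (p - 1)"
  have q: "1 < q" "q \<le> 2" "1/p + 1/q = 1" "(p - 1) * q = p" using p by (auto simp: q_def field_simps)
  obtain D where D: "0 \<le> D" "\<And>f r. continuous_on {0..2*pi} f \<Longrightarrow> 0 \<le> r \<Longrightarrow> r < 1 \<Longrightarrow>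
    p_int q (\<lambda>t. cauchy_int f (of_real r * cis t)) \<le> D * p_int q f"
    using cauchy_int_bound_le_2[OF q(1,2)] by blast
  \<comment> \<open>A weight for Young's inequality: \<open>L powr q = 2 * (D + 1)\<close> makes the
    term with \<open>v\<close> at most \<open>p_int p g / 2\<close>, which is absorbed on the left
    and leaves the constant \<open>2 * L powr p\<close>.\<close>
  define L where "L = (2 * (D + 1)) powr (1/q)"
  have l: "L > 0" using D by (simp add: L_def)
  have lq: "L powr q = 2 * (D + 1)" using D q by (simp add: L_def powr_powr)
  show ?thesis
  proof (rule that[of "2 * L powr p"])
    fix f :: "real \<Rightarrow> complex" and r :: real
    assume f: "continuous_on {0..2*pi} f" and r: "0 \<le> r" "r < 1"
    define g where "g t = cauchy_int f (of_real r * cis t)" for t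
    define u where "u t = of_real (norm (g t) powr (p - 2)) * g t" for t
    define v where "v t = cauchy_int u (of_real r * cis t)" for t
    have cg: "continuous_on {0..2*pi} g" unfolding g_def
      by (intro continuous_on_holomorphic_circle cauchy_int_holomorphic integrable_circle_continuous f r)
    have cu: "continuous_on {0..2*pi} u" unfolding u_def
      using p by (intro continuous_intros continuous_on_powr' cg) auto
    have cv: "continuous_on {0..2*pi} v" unfolding v_def
      by (intro continuous_on_holomorphic_circle cauchy_int_holomorphic integrable_circle_continuous cu r)
    have nu: "norm (u t) = norm (g t) powr (p - 1)" for t
    proof (cases "g t = 0")
      case False
      then have "norm (g t) powr (p - 2) * norm (g t) powr 1 = norm (g t) powr (p - 1)" 
        by (subst powr_add[symmetric]) (simp add: algebra_simps)
      then show ?thesis by (simp add: u_def norm_mult)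
    qed (use p in \<open>simp add: u_def\<close>)
    have gu: "g t * cnj (u t) = of_real (norm (g t) powr p)" for t
    proof (cases "g t = 0")
      case False
      have "norm (g t) powr (p - 2) * norm (g t) powr 2 = norm (g t) powr p"
        using False by (subst powr_add[symmetric]) simp
      then have "norm (g t) powr (p - 2) * (norm (g t))\<^sup>2 = norm (g t) powr p" 
        using False by (simp add: powr_numeral)
      moreover have "g t * cnj (u t) = of_real (norm (g t) powr (p - 2) * (norm (g t))\<^sup>2)"
        using complex_norm_square[of "g t"] by (simp add: u_def mult_ac)
      ultimately show ?thesis by simp
    qed (use p in simp)
    have Ju: "p_int q u = p_int p g"
      unfolding p_int_def nu by (simp add: powr_powr q)
    have "of_real (p_int p g) = integral\<^sup>L circle_measure (\<lambda>t. g t * cnj (u t))"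
      unfolding gu p_int_def by (simp add: integral_complex_of_real)
    also have "\<dots> = integral\<^sup>L circle_measure (\<lambda>s. f s * cnj (v s))"
      unfolding g_def v_def by (rule cauchy_int_adjoint[OF f cu r])
    finally have "p_int p g = norm (integral\<^sup>L circle_measure (\<lambda>s. f s * cnj (v s)))"
      using p_int_nonneg[of p g] by (metis abs_of_nonneg norm_of_real)
    also have "\<dots> \<le> (LINT s|circle_measure. norm (f s * cnj (v s)))" by (rule integral_norm_bound)
    also have "\<dots> \<le> (LINT s|circle_measure. L powr p / p * norm (f s) powr p + norm (v s) powr q / (q * L powr q))"
    proof (rule integral_mono)
      show "integrable circle_measure (\<lambda>s. norm (f s * cnj (v s)))"
        by (intro integrable_circle_continuous continuous_intros f cv)
      show "integrable circle_measure (\<lambda>s. L powr p / p * norm (f s) powr p + norm (v s) powr q / (q * L powr q))"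
        using p q l by (intro integrable_circle_continuous continuous_intros continuous_on_powr' f cv) auto
      fix s
      have "norm (f s * cnj (v s)) = (L * norm (f s)) * (norm (v s) / L)" using l by (simp add: norm_mult)
      also have "\<dots> \<le> (L * norm (f s)) powr p / p + (norm (v s) / L) powr q / q"
        using p q l by (intro Youngs_inequality) auto
      also have "\<dots> = L powr p / p * norm (f s) powr p + norm (v s) powr q / (q * L powr q)"
        using l by (simp add: powr_mult powr_divide)
      finally show "norm (f s * cnj (v s)) \<le> L powr p / p * norm (f s) powr p + norm (v s) powr q / (q * L powr q)" .
    qed
    also have "\<dots> = L powr p / p * p_int p f + p_int q v / (q * L powr q)"
      using LpD(2)[OF Lp_continuous[OF f]] LpD(2)[OF Lp_continuous[OF cv]] p q
      by (simp add: p_int_def)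
    also have "\<dots> \<le> L powr p * p_int p f + p_int p g / 2"
    proof (rule add_mono)
      have "L powr p * 1 \<le> L powr p * p" using p by (intro mult_left_mono) auto
      then have "L powr p / p \<le> L powr p" using p by (simp add: field_simps)
      then show "L powr p / p * p_int p f \<le> L powr p * p_int p f" by (rule mult_right_mono) simp
      have "p_int q v \<le> D * p_int p g" using D(2)[OF cu r] by (simp add: Ju v_def[abs_def])
      then have "p_int q v / (q * L powr q) \<le> D * p_int p g / (1 * L powr q)"
        using q l D(1) by (intro frac_le mult_right_mono mult_nonneg_nonneg) auto
      also have "\<dots> \<le> p_int p g / 2" 
      proof -
        have "D * p_int p g * 2 \<le> p_int p g * (2 * (D + 1))" using p_int_nonneg[of p g] by (simp add: algebra_simps)
        then show ?thesis using D(1) by (simp add: lq divide_simps)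
      qed
      finally show "p_int q v / (q * L powr q) \<le> p_int p g / 2" .
    qed
    finally show "p_int p (\<lambda>t. cauchy_int f (of_real r * cis t)) \<le> 2 * L powr p * p_int p f"
      unfolding g_def by simp
  qed simp
qed

theorem cauchy_int_bound:
  fixes p :: real
  assumes p: "1 < p"
  obtains C where "0 \<le> C" "\<And>f r. continuous_on {0..2*pi} f \<Longrightarrow> 0 \<le> r \<Longrightarrow> r < 1 \<Longrightarrow>
    p_int p (\<lambda>t. cauchy_int f (of_real r * cis t)) \<le> C * p_int p f"
proof (cases "p \<le> 2")
  case True
  show ?thesis by (rule cauchy_int_bound_le_2[OF p True that])
next
  case False
  then have "2 < p" by simp
  show ?thesis by (rule cauchy_int_bound_ge_2[OF \<open>2 < p\<close> that])
qed

section \<open>The Riesz projection\<close>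

lemma HpD: assumes "f \<in> Hp p"
  shows Hp_Lp: "f \<in> Lp p" and Hp_fourier_coeff: "k < 0 \<Longrightarrow> fourier_coeff f k = 0"
  using assms by (auto simp: Hp_def)

lemma Hp_fourier_coeff_eq_imp_AE_eq:
  assumes "u \<in> Hp p" "v \<in> Hp p" "1 \<le> p" "\<And>k. 0 \<le> k \<Longrightarrow> fourier_coeff u k = fourier_coeff v k"
  shows "AE t in circle_measure. u t = v t"
proof (rule fourier_coeff_eq_imp_AE_eq)
  show "fourier_coeff u k = fourier_coeff v k" for k
    using assms HpD(2)[OF assms(1), of k] HpD(2)[OF assms(2), of k] by (cases "0 \<le> k") auto
qed (use assms in \<open>auto intro: Lp_integrable HpD\<close>)

lemma cauchy_int_trig:
  assumes q: "trig q" and S: "finite S" "\<And>k. k \<notin> S \<Longrightarrow> fourier_coeff q k = 0" and w: "norm w < 1"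
  shows "cauchy_int q w = (\<Sum>k\<in>{k\<in>S. 0 \<le> k}. fourier_coeff q k * w ^ nat k)"
proof -
  have "(\<lambda>k. fourier_coeff q (int k) * w ^ k) sums (\<Sum>k\<in>nat ` {k\<in>S. 0 \<le> k}. fourier_coeff q (int k) * w ^ k)"
  proof (rule sums_finite)
    fix k assume k: "k \<notin> nat ` {k\<in>S. 0 \<le> k}"
    have "int k \<notin> S"
    proof
      assume "int k \<in> S"
      then have "nat (int k) \<in> nat ` {k\<in>S. 0 \<le> k}" by (intro imageI) auto
      then show False using k by simp
    qed
    then show "fourier_coeff q (int k) * w ^ k = 0" using S by simp
  qed (use S in auto)
  moreover have "(\<Sum>k\<in>nat ` {k\<in>S. 0 \<le> k}. fourier_coeff q (int k) * w ^ k) = (\<Sum>k\<in>{k\<in>S. 0 \<le> k}. fourier_coeff q k * w ^ nat k)"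
    by (subst sum.reindex) (auto simp: inj_on_def)
  ultimately show ?thesis
    using cauchy_int_sums[OF integrable_trig[OF q] w] sums_unique2 by metis
qed

text \<open>Only finitely many frequencies occur, so the bound on circles of radius below 1 passes
  to the limit radius 1 under the uniform bound \<open>K\<close>, with the same constant
  \<open>C\<close>.\<close>

lemma riesz_trig:
  assumes p: "0 < p" and C: "\<And>f r. continuous_on {0..2*pi} f \<Longrightarrow> 0 \<le> r \<Longrightarrow> r < 1 \<Longrightarrow>
    p_int p (\<lambda>t. cauchy_int f (of_real r * cis t)) \<le> C * p_int p f" and q: "trig q"
  obtains g where "trig g" "\<And>k. fourier_coeff g k = (if 0 \<le> k then fourier_coeff q k else 0)"
    "p_int p g \<le> C * p_int p q"
proof -
  obtain S where S: "finite S" "\<And>k. k \<notin> S \<Longrightarrow> fourier_coeff q k = 0" 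
    using trig_fourier_expansion[OF q] by metis
  let ?S = "{k\<in>S. 0 \<le> k}"
  define g where "g t = (\<Sum>k\<in>?S. fourier_coeff q k * cis (of_int k * t))" for t
  have g: "trig g" unfolding g_def by (intro trig_sum trig_cis)
  have cg: "fourier_coeff g k = (if 0 \<le> k then fourier_coeff q k else 0)" for k
  proof -
    have "fourier_coeff g k = (\<Sum>j\<in>?S. fourier_coeff q j * (if j = k then 1 else 0))"
      unfolding g_def by (subst fourier_coeff_sum) 
         (auto intro!: integrable_trig trig_cis simp: fourier_coeff_cmult fourier_coeff_cis)
    also have "\<dots> = (\<Sum>j\<in>?S. if j = k then fourier_coeff q k else 0)"
      by (intro sum.cong) auto
    also have "\<dots> = (if 0 \<le> k then fourier_coeff q k else 0)" using S by auto
    finally show ?thesis .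
  qed
  define r where "r n = 1 - inverse (real (Suc n))" for n
  have r: "0 \<le> r n" "r n < 1" for n by (auto simp: r_def field_simps)
  have rlim: "r \<longlonglongrightarrow> 1"
    using tendsto_diff[OF tendsto_const LIMSEQ_inverse_real_of_nat, of 1] by (simp add: r_def[abs_def])
  define h where "h n t = cauchy_int q (of_real (r n) * cis t)" for n t
  have h_eq: "h n t = (\<Sum>k\<in>?S. fourier_coeff q k * (of_real (r n) ^ nat k * cis (of_int k * t)))" for n t
  proof -
    have "(of_real (r n) * cis t) ^ nat k = of_real (r n) ^ nat k * cis (of_int k * t)" if "0 \<le> k" for k
      using that by (simp add: power_mult_distrib Complex.DeMoivre)
    then show ?thesis
      unfolding h_def using r by (subst cauchy_int_trig[OF q S]) (auto simp: norm_mult intro!: sum.cong)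
  qed
  define K where "K = (\<Sum>k\<in>?S. norm (fourier_coeff q k))"
  have hK: "norm (h n t) \<le> K" for n t
    unfolding h_eq K_def
    by (rule order_trans[OF norm_sum]) (auto intro!: sum_mono mult_left_le power_le_one r simp: norm_mult norm_power abs_le_iff less_imp_le[OF r(2)] order_trans[OF _ r(1)])
  have ch: "continuous_on {0..2*pi} (h n)" for n
    unfolding h_def by (intro continuous_on_holomorphic_circle cauchy_int_holomorphic integrable_trig q r)
  have "(\<lambda>n. p_int p (h n)) \<longlonglongrightarrow> p_int p g"
    unfolding p_int_def
  proof (rule integral_dominated_convergence[where w="\<lambda>t. K powr p"])
    show "AE t in circle_measure. (\<lambda>n. norm (h n t) powr p) \<longlonglongrightarrow> norm (g t) powr p"
    proof (rule AE_I2)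
      fix t
      have "(\<lambda>n. h n t) \<longlonglongrightarrow> (\<Sum>k\<in>?S. fourier_coeff q k * (of_real 1 ^ nat k * cis (of_int k * t)))"
        unfolding h_eq by (intro tendsto_intros rlim)
      then have "(\<lambda>n. h n t) \<longlonglongrightarrow> g t" by (simp add: g_def)
      then show "(\<lambda>n. norm (h n t) powr p) \<longlonglongrightarrow> norm (g t) powr p" using p by (intro tendsto_norm_powr)
    qed
    show "AE t in circle_measure. norm (norm (h n t) powr p) \<le> K powr p" for n
      using p hK by (auto intro!: powr_mono2)
    show "(\<lambda>t. norm (g t) powr p) \<in> borel_measurable circle_measure"
      using LpD(1)[OF Lp_trig[OF g less_imp_le[OF p]]] by measurable
    show "(\<lambda>t. norm (h n t) powr p) \<in> borel_measurable circle_measure" for n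
      using continuous_measurable_circle[OF ch] by measurable
  qed auto
  then have "p_int p g \<le> C * p_int p q"
    by (rule LIMSEQ_le_const2) (auto simp: h_def[abs_def] intro!: C continuous_on_trig q r)
  with g cg show ?thesis using that by blast
qed

text \<open>The projection of trigonometric polynomials extends to L^p by density and completeness;
  Fourier coefficients are continuous for convergence in \<open>p_int\<close> and identify the
  limit.\<close>

theorem riesz_projection_exists:
  fixes p :: real
  assumes p: "1 < p"
  obtains C where "0 \<le> C" "\<And>v. v \<in> Lp p \<Longrightarrow> 
    \<exists>u\<in>Hp p. (\<forall>k\<ge>0. fourier_coeff u k = fourier_coeff v k) \<and> p_int p u \<le> C * p_int p v"
proof -
  obtain C where C0: "0 \<le> C" and C: "\<And>f r. continuous_on {0..2*pi} f \<Longrightarrow> 0 \<le> r \<Longrightarrow> r < 1 \<Longrightarrow>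
    p_int p (\<lambda>t. cauchy_int f (of_real r * cis t)) \<le> C * p_int p f"
    using cauchy_int_bound[OF p] by blast
  have p0: "0 < p" "0 \<le> p" "1 \<le> p" using p by auto
  show ?thesis
  proof (rule that[of "2 powr p * (C * 2 powr p)"])
    fix v assume v: "v \<in> Lp p"
    have "\<exists>q. trig q \<and> p_int p (\<lambda>t. v t - q t) < inverse (real (Suc n))" for n
      by (rule trig_dense_Lp[OF v p0(1), of "inverse (real (Suc n))"]) auto
    then obtain q where q: "\<And>n. trig (q n)" and qv: "\<And>n. p_int p (\<lambda>t. v t - q n t) < inverse (real (Suc n))" by metis
    have "\<exists>g. trig g \<and> (\<forall>k. fourier_coeff g k = (if 0 \<le> k then fourier_coeff (q n) k else 0)) \<and> p_int p g \<le> C * p_int p (q n)" for n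
      by (rule riesz_trig[OF p0(1) C q[of n]]) auto
    then obtain g where g: "\<And>n. trig (g n)" 
      and gc: "\<And>n k. fourier_coeff (g n) k = (if 0 \<le> k then fourier_coeff (q n) k else 0)" 
      and gb: "\<And>n. p_int p (g n) \<le> C * p_int p (q n)" by metis
    have gL: "g n \<in> Lp p" and qL: "q n \<in> Lp p" for n using g q p0 Lp_trig by auto
    have qlim: "(\<lambda>n. p_int p (\<lambda>t. q n t - v t)) \<longlonglongrightarrow> 0"
      by (rule tendsto_sandwich[OF _ _ tendsto_const LIMSEQ_inverse_real_of_nat])
         (use qv in \<open>auto simp: p_int_diff_commute[of p "q _"] intro!: less_imp_le always_eventually\<close>)
    \<comment> \<open>\<open>riesz_trig\<close> yields some projection of the difference; uniqueness
      of coefficients identifies it almost everywhere with the difference of the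
      projections.\<close>
    have gd: "p_int p (\<lambda>t. g m t - g n t) \<le> C * p_int p (\<lambda>t. q m t - q n t)" for m n
    proof -
      obtain d where d: "trig d" "\<And>k. fourier_coeff d k = (if 0 \<le> k then fourier_coeff (\<lambda>t. q m t - q n t) k else 0)" 
        "p_int p d \<le> C * p_int p (\<lambda>t. q m t - q n t)"
        by (rule riesz_trig[OF p0(1) C trig_diff[OF q[of m] q[of n]]]) auto
      have "AE t in circle_measure. d t = g m t - g n t"
        using d g q by (intro fourier_coeff_eq_imp_AE_eq integrable_trig trig_diff) 
           (auto simp: fourier_coeff_diff integrable_trig gc)
      then have "p_int p d = p_int p (\<lambda>t. g m t - g n t)"
        using LpD(1)[OF Lp_trig[OF d(1) p0(2)]] by (intro p_int_AE_cong)
      then show ?thesis using d(3) by simp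
    qed
    have cauchy: "\<exists>N. \<forall>m\<ge>N. \<forall>n\<ge>N. p_int p (\<lambda>t. g m t - g n t) < e" if e: "0 < e" for e
    proof -
      have "(\<lambda>n. C * (2 powr p * (2 * p_int p (\<lambda>t. q n t - v t)))) \<longlonglongrightarrow> C * (2 powr p * (2 * 0))"
        by (intro tendsto_intros qlim)
      then have "eventually (\<lambda>n. C * (2 powr p * (2 * p_int p (\<lambda>t. q n t - v t))) < e) sequentially"
        using e by (intro order_tendstoD) auto
      then obtain N where N: "\<And>n. n \<ge> N \<Longrightarrow> C * (2 powr p * (2 * p_int p (\<lambda>t. q n t - v t))) < e"
        by (auto simp: eventually_sequentially)
      have "p_int p (\<lambda>t. g m t - g n t) < e" if mn: "m \<ge> N" "n \<ge> N" for m n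
      proof -
        have "p_int p (\<lambda>t. g m t - g n t) \<le> C * (2 powr p * (p_int p (\<lambda>t. q m t - v t) + p_int p (\<lambda>t. v t - q n t)))"
          by (rule order_trans[OF gd mult_left_mono[OF p_int_triangle[OF qL v qL p0(2)] C0]])
        also have "\<dots> = C * (2 powr p * (2 * p_int p (\<lambda>t. q m t - v t))) / 2 + C * (2 powr p * (2 * p_int p (\<lambda>t. q n t - v t))) / 2"
          by (simp add: p_int_diff_commute[of p v] algebra_simps)
        also have "\<dots> < e" using N[OF mn(1)] N[OF mn(2)] by linarith
        finally show ?thesis .
      qed
      then show ?thesis by blast
    qed
    obtain u where u: "u \<in> Lp p" "(\<lambda>n. p_int p (\<lambda>t. g n t - u t)) \<longlonglongrightarrow> 0"
      by (rule Lp_complete[of p g, OF p0(3) gL cauchy])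
    have "fourier_coeff u k = (if 0 \<le> k then fourier_coeff v k else 0)" for k
    proof -
      have 1: "(\<lambda>n. fourier_coeff (g n) k) \<longlonglongrightarrow> fourier_coeff u k"
        by (rule fourier_coeff_tendsto_Lp[OF gL u(1) p0(3) u(2)])
      have 2: "(\<lambda>n. fourier_coeff (q n) k) \<longlonglongrightarrow> fourier_coeff v k"
        by (rule fourier_coeff_tendsto_Lp[OF qL v p0(3) qlim])
      have "(\<lambda>n. fourier_coeff (g n) k) \<longlonglongrightarrow> (if 0 \<le> k then fourier_coeff v k else 0)"
        using 2 by (simp add: gc)
      with 1 show ?thesis by (rule LIMSEQ_unique)
    qed
    then have "u \<in> Hp p" "\<forall>k\<ge>0. fourier_coeff u k = fourier_coeff v k" using u by (auto simp: Hp_def)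
    moreover have "p_int p u \<le> 2 powr p * (C * 2 powr p) * p_int p v"
    proof -
      have le: "p_int p u \<le> 2 powr p * (p_int p (\<lambda>t. g n t - u t) + C * (2 powr p * (p_int p (\<lambda>t. q n t - v t) + p_int p v)))" for n
      proof -
        have "p_int p (\<lambda>t. u t - 0) \<le> 2 powr p * (p_int p (\<lambda>t. u t - g n t) + p_int p (\<lambda>t. g n t - 0))"
          by (rule p_int_triangle) (use u gL p0 Lp_continuous[of "\<lambda>t. 0"] in auto)
        moreover have "p_int p (\<lambda>t. q n t - 0) \<le> 2 powr p * (p_int p (\<lambda>t. q n t - v t) + p_int p (\<lambda>t. v t - 0))"
          by (rule p_int_triangle) (use v qL p0 Lp_continuous[of "\<lambda>t. 0"] in auto)
        ultimately show ?thesis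
          using gb[of n] C0 by (simp add: p_int_diff_commute[of p u]) (smt (verit) mult_left_mono powr_ge_zero)
      qed
      have "(\<lambda>n. 2 powr p * (p_int p (\<lambda>t. g n t - u t) + C * (2 powr p * (p_int p (\<lambda>t. q n t - v t) + p_int p v))))
         \<longlonglongrightarrow> 2 powr p * (0 + C * (2 powr p * (0 + p_int p v)))"
        by (intro tendsto_intros u qlim)
      then have "p_int p u \<le> 2 powr p * (0 + C * (2 powr p * (0 + p_int p v)))"
        by (rule LIMSEQ_le_const) (intro exI allI impI le)
      then show ?thesis by (simp add: mult_ac)
    qed
    ultimately show "\<exists>u\<in>Hp p. (\<forall>k\<ge>0. fourier_coeff u k = fourier_coeff v k) \<and> p_int p u \<le> 2 powr p * (C * 2 powr p) * p_int p v"
      by blast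
  qed (use C0 in simp)
qed

text \<open>Existence of a projection is what makes the choice in \<open>riesz_proj\<close> satisfy
  its defining property.\<close>

lemma riesz_proj_Hp:
  assumes "1 < p" "v \<in> Lp p"
  shows "riesz_proj p v \<in> Hp p"
    and fourier_coeff_riesz_proj: "0 \<le> k \<Longrightarrow> fourier_coeff (riesz_proj p v) k = fourier_coeff v k"
proof -
  have "\<exists>u. u \<in> Hp p \<and> (\<forall>k\<ge>0. fourier_coeff u k = fourier_coeff v k)"
    by (rule riesz_projection_exists[OF assms(1)]) (use assms(2) in blast)
  from someI_ex[OF this] show "riesz_proj p v \<in> Hp p" 
    "0 \<le> k \<Longrightarrow> fourier_coeff (riesz_proj p v) k = fourier_coeff v k"
    by (auto simp: riesz_proj_def)
qed

text \<open>Stated for any \<open>u\<close> with the right coefficients: one such function is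
  bounded by \<open>riesz_projection_exists\<close>, and any two agree almost everywhere. In this
  form it applies to differences of chosen projections.\<close>

lemma riesz_bound:
  fixes p :: real
  assumes p: "1 < p"
  obtains C where "0 \<le> C" "\<And>u v. u \<in> Hp p \<Longrightarrow> v \<in> Lp p \<Longrightarrow> (\<And>k. 0 \<le> k \<Longrightarrow> fourier_coeff u k = fourier_coeff v k)
     \<Longrightarrow> p_int p u \<le> C * p_int p v"
proof -
  obtain C where C: "0 \<le> C" "\<And>v. v \<in> Lp p \<Longrightarrow> 
    \<exists>u\<in>Hp p. (\<forall>k\<ge>0. fourier_coeff u k = fourier_coeff v k) \<and> p_int p u \<le> C * p_int p v"
    using riesz_projection_exists[OF p] by blast
  show ?thesis
  proof (rule that[OF C(1)])
    fix u v assume uv: "u \<in> Hp p" "v \<in> Lp p" "\<And>k. 0 \<le> k \<Longrightarrow> fourier_coeff u k = fourier_coeff v k"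
    obtain u' where u': "u' \<in> Hp p" "\<forall>k\<ge>0. fourier_coeff u' k = fourier_coeff v k" "p_int p u' \<le> C * p_int p v"
      using C(2)[OF uv(2)] by blast
    have "AE t in circle_measure. u t = u' t"
      by (rule Hp_fourier_coeff_eq_imp_AE_eq[OF uv(1) u'(1)]) (use p uv u' in auto)
    then have "p_int p u = p_int p u'" 
      using LpD(1)[OF HpD(1)[OF uv(1)]] by (intro p_int_AE_cong)
    then show "p_int p u \<le> C * p_int p v" using u' by simp
  qed
qed

section \<open>Primitives of square summable Fourier series\<close>

lemma integral_mult_cnj_cis_sum:
  assumes f: "integrable circle_measure f" and I: "finite (I :: nat set)"
  shows "integral\<^sup>L circle_measure (\<lambda>t. f t * cnj (\<Sum>k\<in>I. c k * cis (of_nat k * t))) 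
     = 2 * pi * (\<Sum>k\<in>I. fourier_coeff f (int k) * cnj (c k))"
proof -
  have "f t * cnj (\<Sum>k\<in>I. c k * cis (of_nat k * t)) = (\<Sum>k\<in>I. cnj (c k) * (f t * cis (- (of_int (int k)) * t)))" for t
    by (simp add: sum_distrib_left cis_cnj mult_ac)
  then have "integral\<^sup>L circle_measure (\<lambda>t. f t * cnj (\<Sum>k\<in>I. c k * cis (of_nat k * t))) = 
     (\<Sum>k\<in>I. cnj (c k) * integral\<^sup>L circle_measure (\<lambda>t. f t * cis (- (of_int (int k)) * t)))"
    using integrable_mult_cis[OF f, of "- of_int (int k)" for k]
    by (simp only:) (subst Bochner_Integration.integral_sum; simp)
  then show ?thesis by (simp add: fourier_coeff_def sum_distrib_left mult_ac)
qed

lemma fourier_coeff_cis_sum':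
  assumes "finite (I :: nat set)"
  shows "fourier_coeff (\<lambda>t. \<Sum>j\<in>I. c j * cis (of_nat j * t)) (int k) = (if k \<in> I then c k else 0)"
proof -
  have "fourier_coeff (\<lambda>t. c j * cis (of_nat j * t)) (int k) = (if j = k then c j else 0)" for j
    using fourier_coeff_cis[of "int j" "int k"] by (simp add: fourier_coeff_cmult)
  then show ?thesis
    using assms by (subst fourier_coeff_sum) (auto intro!: integrable_circle_continuous continuous_intros)
qed

lemma p_int_2_cis_sum:
  assumes I: "finite (I :: nat set)"
  shows "p_int 2 (\<lambda>t. \<Sum>k\<in>I. c k * cis (of_nat k * t)) = 2 * pi * (\<Sum>k\<in>I. (norm (c k))\<^sup>2)"
proof -
  let ?S = "\<lambda>t. \<Sum>k\<in>I. c k * cis (of_nat k * t)"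
  have i: "integrable circle_measure ?S" by (intro integrable_circle_continuous continuous_intros)
  have z: "complex_of_real (norm z powr 2) = z * cnj z" for z
    using complex_norm_square[of z] by (simp add: powr_numeral)
  have "complex_of_real (p_int 2 ?S) = integral\<^sup>L circle_measure (\<lambda>t. ?S t * cnj (?S t))"
    unfolding p_int_def integral_complex_of_real[symmetric] z ..
  also have "\<dots> = 2 * pi * (\<Sum>k\<in>I. c k * cnj (c k))"
    by (subst integral_mult_cnj_cis_sum[OF i I]) (auto simp: fourier_coeff_cis_sum'[OF I])
  also have "\<dots> = complex_of_real (2 * pi * (\<Sum>k\<in>I. (norm (c k))\<^sup>2))"
    by (simp add: complex_norm_square del: of_real_power)
  finally show ?thesis by (simp only: of_real_eq_iff)
qed

text \<open>Subtracting the partial sum \<open>S\<close> leaves a function \<open>D\<close>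
  orthogonal to \<open>S\<close>. Continuous \<open>f\<close> suffice because the inequality is
  applied on circles of radius below 1.\<close>

lemma bessel:
  assumes f: "continuous_on {0..2*pi} f"
  shows "2 * pi * (\<Sum>k<n. (norm (fourier_coeff f (int k)))\<^sup>2) \<le> p_int 2 f"
proof -
  define c where "c k = fourier_coeff f (int k)" for k :: nat
  define S where "S t = (\<Sum>k<n. c k * cis (of_nat k * t))" for t
  define D where "D t = f t - S t" for t
  have cS: "continuous_on {0..2*pi} S" unfolding S_def by (intro continuous_intros)
  have cD: "continuous_on {0..2*pi} D" unfolding D_def by (intro continuous_intros f cS)
  note i = integrable_circle_continuous
  have "fourier_coeff D (int k) = 0" if "k < n" for k
  proof -
    have "fourier_coeff S (int k) = c k"
      unfolding S_def using that by (subst fourier_coeff_cis_sum') auto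
    then show ?thesis unfolding D_def by (subst fourier_coeff_diff[OF i[OF f] i[OF cS]]) (simp add: c_def)
  qed
  then have 0: "integral\<^sup>L circle_measure (\<lambda>t. D t * cnj (S t)) = 0"
    unfolding S_def by (subst integral_mult_cnj_cis_sum[OF i[OF cD]]) auto
  have iDS: "integrable circle_measure (\<lambda>t. D t * cnj (S t))"
    by (intro i continuous_intros cD cS)
  have n2: "(norm (x + y))\<^sup>2 = (norm x)\<^sup>2 + (norm y)\<^sup>2 + 2 * Re (x * cnj y)" for x y :: complex
    unfolding cmod_power2 by (simp add: power2_eq_square algebra_simps)
  have fDS: "f t = D t + S t" for t by (simp add: D_def)
  have L2: "integrable circle_measure (\<lambda>t. (norm (g t))\<^sup>2)" if "continuous_on {0..2*pi} g" for g :: "real \<Rightarrow> complex"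
    by (intro i continuous_intros that)
  have "p_int 2 f = (LINT t|circle_measure. (norm (D t))\<^sup>2 + (norm (S t))\<^sup>2 + 2 * Re (D t * cnj (S t)))"
    unfolding p_int_def fDS by (simp add: powr_numeral n2)
  also have "\<dots> = (LINT t|circle_measure. (norm (D t))\<^sup>2 + (norm (S t))\<^sup>2) + (LINT t|circle_measure. 2 * Re (D t * cnj (S t)))"
    by (intro Bochner_Integration.integral_add Bochner_Integration.integrable_add integrable_mult_right L2 cD cS integrable_Re[OF iDS])
  also have "(LINT t|circle_measure. 2 * Re (D t * cnj (S t))) = 0"
    unfolding integral_mult_right_zero integral_Re[OF iDS] 0 by simp
  also have "(LINT t|circle_measure. (norm (D t))\<^sup>2 + (norm (S t))\<^sup>2) = (LINT t|circle_measure. (norm (D t))\<^sup>2) + p_int 2 S"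
    using L2[OF cD] L2[OF cS] by (simp add: p_int_def powr_numeral)
  finally have "p_int 2 S \<le> p_int 2 f" by (simp add: integral_nonneg_AE)
  then show ?thesis unfolding S_def by (subst (asm) p_int_2_cis_sum) (auto simp: c_def)
qed

text \<open>Bessel's inequality on the circle of radius \<open>r\<close> bounds the damped sums by
  \<open>K\<^sup>2\<close>; for a fixed number of terms \<open>r\<close> then tends to 1.\<close>

lemma taylor_l2_bound:
  assumes b: "b holomorphic_on ball 0 1" and K: "\<And>z. z \<in> ball 0 1 \<Longrightarrow> norm (b z) \<le> K"
  shows "summable (\<lambda>k. (norm (taylor_coeff b k))\<^sup>2)"
proof (rule summableI_nonneg_bounded)
  fix n
  let ?a = "taylor_coeff b"
  define r where "r m = 1 - inverse (real (Suc m))" for m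
  have r: "0 \<le> r m" "r m < 1" for m by (auto simp: r_def field_simps)
  have rlim: "r \<longlonglongrightarrow> 1"
    using tendsto_diff[OF tendsto_const LIMSEQ_inverse_real_of_nat, of 1] by (simp add: r_def[abs_def])
  have lim: "(\<lambda>m. 2 * pi * (\<Sum>k<n. (norm (?a k * of_real (r m) ^ k))\<^sup>2)) \<longlonglongrightarrow> 2 * pi * (\<Sum>k<n. (norm (?a k * of_real 1 ^ k))\<^sup>2)"
    by (intro tendsto_intros rlim)
  have "2 * pi * (\<Sum>k<n. (norm (?a k * of_real (r m) ^ k))\<^sup>2) \<le> 2 * pi * K\<^sup>2" for m
  proof -
    let ?f = "\<lambda>t. b (of_real (r m) * cis t)"
    have c: "continuous_on {0..2*pi} ?f" by (rule continuous_on_holomorphic_circle[OF b r])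
    have "p_int 2 ?f \<le> (LINT t|circle_measure. K\<^sup>2)"
      unfolding p_int_def
    proof (rule integral_mono)
      show "integrable circle_measure (\<lambda>t. norm (?f t) powr 2)" by (rule LpD(2)[OF Lp_continuous[OF c]]) simp
      show "norm (?f t) powr 2 \<le> K\<^sup>2" for t
        using K[of "of_real (r m) * cis t"] r[of m] by (auto simp: norm_mult powr_numeral intro!: power_mono)
    qed auto
    then have 1: "p_int 2 ?f \<le> 2 * pi * K\<^sup>2" by simp
    have "2 * pi * (\<Sum>k<n. (norm (?a k * of_real (r m) ^ k))\<^sup>2) \<le> p_int 2 ?f"
      using bessel[OF c, of n] fourier_coeff_holomorphic_circle[OF b r] by simp
    from this 1 show ?thesis by (rule order_trans)
  qed
  then have "2 * pi * (\<Sum>k<n. (norm (?a k * of_real 1 ^ k))\<^sup>2) \<le> 2 * pi * K\<^sup>2"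
    by (intro LIMSEQ_le_const2[OF lim] exI allI impI)
  then show "(\<Sum>k<n. (norm (?a k))\<^sup>2) \<le> K\<^sup>2" by simp
qed auto

lemma l2_boundary_function:
  fixes a :: "nat \<Rightarrow> complex"
  assumes a: "summable (\<lambda>k. (norm (a k))\<^sup>2)"
  obtains F where "F \<in> Lp 2" "\<And>k. fourier_coeff F k = (if 0 \<le> k then a (nat k) else 0)"
    "(\<lambda>n. p_int 2 (\<lambda>t. (\<Sum>k<n. a k * cis (of_nat k * t)) - F t)) \<longlonglongrightarrow> 0"
proof -
  let ?S = "\<lambda>n t. \<Sum>k<n. a k * cis (of_nat k * t)"
  have SL: "?S n \<in> Lp 2" for n by (intro Lp_continuous continuous_intros) auto
  have dist: "p_int 2 (\<lambda>t. ?S n t - ?S m t) = 2 * pi * (\<Sum>k=m..<n. (norm (a k))\<^sup>2)" if "m \<le> n" for m n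
  proof -
    have "?S n t - ?S m t = (\<Sum>k=m..<n. a k * cis (of_nat k * t))" for t
      using sum_diff_nat_ivl[of 0 m n "\<lambda>k. a k * cis (of_nat k * t)"] that by (simp add: atLeast0LessThan)
    then show ?thesis by (simp only: p_int_2_cis_sum finite_atLeastLessThan)
  qed
  have cauchy: "\<exists>N. \<forall>m\<ge>N. \<forall>n\<ge>N. p_int 2 (\<lambda>t. ?S m t - ?S n t) < e" if e: "0 < e" for e
  proof -
    obtain N where N: "\<And>m n. m \<ge> N \<Longrightarrow> norm (\<Sum>k=m..<n. (norm (a k))\<^sup>2) < e / (2*pi)"
      using a e unfolding summable_Cauchy by (meson divide_pos_pos pi_gt_zero zero_less_numeral mult_pos_pos)
    have *: "p_int 2 (\<lambda>t. ?S n t - ?S m t) < e" if "m \<ge> N" "m \<le> n" for m n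
      using N[OF that(1), of n] dist[OF that(2)] by (simp add: field_simps sum_nonneg)
    have "p_int 2 (\<lambda>t. ?S m t - ?S n t) < e" if "m \<ge> N" "n \<ge> N" for m n
      using *[of m n] *[of n m] that p_int_diff_commute[of 2 "?S m" "?S n"] by (cases "m \<le> n") auto
    then show ?thesis by blast
  qed
  obtain F where F: "F \<in> Lp 2" "(\<lambda>n. p_int 2 (\<lambda>t. ?S n t - F t)) \<longlonglongrightarrow> 0"
    by (rule Lp_complete[of 2 ?S, OF _ SL cauchy]) auto
  have "fourier_coeff F k = (if 0 \<le> k then a (nat k) else 0)" for k
  proof -
    have "(\<lambda>n. fourier_coeff (?S n) k) \<longlonglongrightarrow> fourier_coeff F k"
      by (rule fourier_coeff_tendsto_Lp[OF SL F(1) _ F(2)]) simp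
    moreover have "(\<lambda>n. fourier_coeff (?S n) k) \<longlonglongrightarrow> (if 0 \<le> k then a (nat k) else 0)"
      unfolding fourier_coeff_cis_sum
      by (rule tendsto_eventually, rule eventually_sequentiallyI[of "nat k + 1"]) auto
    ultimately show ?thesis by (rule LIMSEQ_unique)
  qed
  with F show ?thesis using that by blast
qed

text \<open>Coefficient of the antiderivative of \<open>a k * cis (k * t)\<close>. At
  \<open>k = 0\<close> division by zero gives 0; \<open>a 0 = 0\<close> is assumed wherever the
  primitive is related back to \<open>a\<close>.\<close>

definition primitive_coeff :: "(nat \<Rightarrow> complex) \<Rightarrow> nat \<Rightarrow> complex" where
  "primitive_coeff a k = a k / (\<i> * of_nat k)"

text \<open>From \<open>norm (a k) / k \<le> (norm (a k))\<^sup>2 + 1 / k\<^sup>2\<close>. Square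
  summability becomes absolute summability, so the primitive is a continuous function although the
  series of \<open>a\<close> itself need not converge pointwise.\<close>

lemma summable_primitive_coeff:
  assumes "summable (\<lambda>k. (norm (a k))\<^sup>2)"
  shows "summable (\<lambda>k. norm (primitive_coeff a k))"
proof (rule summable_comparison_test')
  show "summable (\<lambda>k. (norm (a k))\<^sup>2 + 1 / (real k)\<^sup>2)"
    using inverse_power_summable[of 2, where 'a=real] by (intro summable_add assms) (simp add: inverse_eq_divide)
  fix k
  have "2 * (norm (a k) * (1 / real k)) \<le> (norm (a k))\<^sup>2 + (1 / real k)\<^sup>2"
    using sum_squares_bound[of "norm (a k)" "1 / real k"] by (simp add: mult.assoc)
  moreover have "0 \<le> norm (a k) * (1 / real k)" by simp
  ultimately have "norm (a k) * (1 / real k) \<le> (norm (a k))\<^sup>2 + (1 / real k)\<^sup>2" by linarith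
  then show "norm (norm (primitive_coeff a k)) \<le> (norm (a k))\<^sup>2 + 1 / (real k)\<^sup>2"
    by (simp add: primitive_coeff_def norm_divide norm_mult power_divide)
qed

definition circle_primitive :: "(nat \<Rightarrow> complex) \<Rightarrow> real \<Rightarrow> complex" where
  "circle_primitive a t = (\<Sum>k. primitive_coeff a k * cis (of_nat k * t))"

lemma has_integral_cis_sum:
  assumes "a 0 = 0" "x \<le> y"
  shows "((\<lambda>t. \<Sum>k<n. a k * cis (of_nat k * t)) has_integral 
     ((\<Sum>k<n. primitive_coeff a k * cis (of_nat k * y)) - (\<Sum>k<n. primitive_coeff a k * cis (of_nat k * x)))) {x..y}"
proof (rule fundamental_theorem_of_calculus[OF assms(2)])
  fix t
  have "((\<lambda>t. primitive_coeff a k * cis (of_nat k * t)) has_vector_derivative a k * cis (of_nat k * t)) (at t within {x..y})" for k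
  proof (cases "k = 0")
    case False
    have "((\<lambda>t. primitive_coeff a k * exp (\<i> * of_nat k * of_real t)) has_vector_derivative 
      a k * exp (\<i> * of_nat k * of_real t)) (at t within {x..y})"
      by (rule derivative_eq_intros has_vector_derivative_real_field refl | simp add: False primitive_coeff_def)+
    then show ?thesis by (simp add: cis_conv_exp mult_ac)
  qed (simp add: assms primitive_coeff_def)
  then show "((\<lambda>y. \<Sum>k<n. primitive_coeff a k * cis (of_nat k * y)) has_vector_derivative (\<Sum>k<n. a k * cis (of_nat k * t))) (at t within {x..y})"
    by (intro has_vector_derivative_sum)
qed

lemma circle_integrable_HK:
  fixes F :: "real \<Rightarrow> complex"
  assumes "integrable circle_measure F"
  shows "F integrable_on {0..2*pi}" "(\<lambda>t. norm (F t)) integrable_on {0..2*pi}"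
    "(LINT t|circle_measure. norm (F t)) = integral {0..2*pi} (\<lambda>t. norm (F t))"
  using assms integrable_on_lebesgue_on[of "{0..2*pi}" F] integrable_on_lebesgue_on[of "{0..2*pi}" "\<lambda>t. norm (F t)"]
    lebesgue_integral_eq_integral[of "{0..2*pi}" "\<lambda>t. norm (F t)"]
  by (auto simp: circle_measure_def)

text \<open>Partial sums integrate exactly over \<open>{x..y}\<close>; their L^2 convergence implies
  L^1 convergence, which controls integrals over every subinterval.\<close>

lemma circle_primitive_diff:
  assumes a: "summable (\<lambda>k. (norm (a k))\<^sup>2)" "a 0 = 0"
    and F: "F \<in> Lp 2" "(\<lambda>n. p_int 2 (\<lambda>t. (\<Sum>k<n. a k * cis (of_nat k * t)) - F t)) \<longlonglongrightarrow> 0"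
    and xy: "0 \<le> x" "x \<le> y" "y \<le> 2*pi"
  shows "integral {x..y} F = circle_primitive a y - circle_primitive a x"
proof -
  let ?S = "\<lambda>n t. \<Sum>k<n. a k * cis (of_nat k * t)"
  let ?G = "\<lambda>n t. \<Sum>k<n. primitive_coeff a k * cis (of_nat k * t)"
  have Fi: "integrable circle_measure F" using Lp_integrable[OF F(1)] by simp
  have Si: "integrable circle_measure (?S n)" for n by (intro integrable_circle_continuous continuous_intros)
  have sub: "{x..y} \<subseteq> {0..2*pi}" using xy by auto
  have Fxy: "F integrable_on {x..y}"
    using circle_integrable_HK(1)[OF Fi] sub by (rule integrable_on_subinterval)
  have L1: "(\<lambda>n. LINT t|circle_measure. norm (?S n t - F t)) \<longlonglongrightarrow> 0"
    by (rule p_int_tendsto_0_imp_L1[where p=2 and f="\<lambda>n t. ?S n t - F t"]) 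
       (auto intro!: F Lp_diff(1)[OF Lp_continuous F(1)] continuous_intros)
  have "norm ((?G n y - ?G n x) - integral {x..y} F) \<le> (LINT t|circle_measure. norm (?S n t - F t))" for n
  proof -
    note S = has_integral_cis_sum[of a x y n, OF a(2) xy(2)]
    have di: "integrable circle_measure (\<lambda>t. ?S n t - F t)" using Si Fi by simp
    have d: "((\<lambda>t. ?S n t - F t) has_integral ((?G n y - ?G n x) - integral {x..y} F)) {x..y}"
      by (intro has_integral_diff S integrable_integral Fxy)
    have "norm ((?G n y - ?G n x) - integral {x..y} F) = norm (integral {x..y} (\<lambda>t. ?S n t - F t))"
      using d by (simp only: integral_unique)
    also have "\<dots> \<le> integral {x..y} (\<lambda>t. norm (?S n t - F t))"
      using d integrable_on_subinterval[OF circle_integrable_HK(2)[OF di] sub]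
      by (intro Henstock_Kurzweil_Integration.integral_norm_bound_integral) auto
    also have "\<dots> \<le> integral {0..2*pi} (\<lambda>t. norm (?S n t - F t))"
      using sub integrable_on_subinterval[OF circle_integrable_HK(2)[OF di] sub] circle_integrable_HK(2)[OF di]
      by (intro integral_subset_le) auto
    also have "\<dots> = (LINT t|circle_measure. norm (?S n t - F t))"
      using circle_integrable_HK(3)[OF di] by simp
    finally show ?thesis .
  qed
  then have "(\<lambda>n. (?G n y - ?G n x) - integral {x..y} F) \<longlonglongrightarrow> 0"
    by (intro Lim_null_comparison[OF always_eventually L1]) auto
  then have 1: "(\<lambda>n. ?G n y - ?G n x) \<longlonglongrightarrow> integral {x..y} F" by (rule LIM_zero_cancel)
  have "(\<lambda>n. ?G n y - ?G n x) \<longlonglongrightarrow> circle_primitive a y - circle_primitive a x"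
    unfolding circle_primitive_def
    by (intro tendsto_diff summable_LIMSEQ summable_cis_series summable_primitive_coeff a)
  with 1 show ?thesis by (rule LIMSEQ_unique)
qed

lemma AE_circle_negligible:
  assumes "negligible N"
  shows "AE t in circle_measure. t \<notin> N"
proof -
  have "AE t in lebesgue. t \<notin> N"
    using assms by (intro AE_not_in) (simp only: negligible_iff_null_sets)
  then show ?thesis
    unfolding circle_measure_def by (subst AE_restrict_space_iff) auto
qed

text \<open>Lebesgue differentiation over intervals to the right of a point is applied to the
  function and to its reflection, which gives a two-sided derivative. The increments are written
  \<open>t - h\<close> to match the convolution in Fatou's argument.\<close>

lemma circle_primitive_differentiable_AE:
  assumes a: "summable (\<lambda>k. (norm (a k))\<^sup>2)" "a 0 = 0"
    and F: "F \<in> Lp 2" "(\<lambda>n. p_int 2 (\<lambda>t. (\<Sum>k<n. a k * cis (of_nat k * t)) - F t)) \<longlonglongrightarrow> 0"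
  shows "AE t in circle_measure. \<forall>e>0. \<exists>d>0. \<forall>h. \<bar>h\<bar> < d \<longrightarrow> 
    norm (circle_primitive a (t - h) - circle_primitive a t + of_real h * F t) \<le> e * \<bar>h\<bar>"
proof -
  define F' where "F' t = (if t \<in> {0..2*pi} then F t else 0)" for t
  let ?G = "circle_primitive a"
  have "F' integrable_on UNIV"
    unfolding F'_def Henstock_Kurzweil_Integration.integrable_restrict_UNIV
    by (rule circle_integrable_HK(1)[OF Lp_integrable(1)[OF F(1)]]) simp
  then have F'i: "F' integrable_on cbox x y" for x y by (rule integrable_on_subcbox) auto
  then have F'r: "(\<lambda>t. F' (- t)) integrable_on cbox x y" for x y
    using integrable_reflect[of F' "-x" "-y"] F'i[of "-y" "-x"] by simp
  obtain N1 where N1: "negligible N1" "\<And>x e. \<lbrakk>x \<notin> N1; 0 < e\<rbrakk> \<Longrightarrow> \<exists>d>0. \<forall>h. 0 < h \<and> h < d \<longrightarrow>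
       norm (integral (cbox x (x + h *\<^sub>R One)) F' /\<^sub>R h ^ DIM(real) - F' x) < e"
    using integrable_ccontinuous_explicit[of F', OF F'i] by blast
  obtain N2 where N2: "negligible N2" "\<And>x e. \<lbrakk>x \<notin> N2; 0 < e\<rbrakk> \<Longrightarrow> \<exists>d>0. \<forall>h. 0 < h \<and> h < d \<longrightarrow>
       norm (integral (cbox x (x + h *\<^sub>R One)) (\<lambda>t. F' (- t)) /\<^sub>R h ^ DIM(real) - F' (- x)) < e"
    using integrable_ccontinuous_explicit[of "\<lambda>t. F' (- t)", OF F'r] by blast
  have key: "\<exists>d>0. \<forall>h. \<bar>h\<bar> < d \<longrightarrow> norm (?G (t - h) - ?G t + of_real h * F t) \<le> e * \<bar>h\<bar>"
    if t: "t \<notin> N1" "- t \<notin> N2" "0 < t" "t < 2*pi" and e: "0 < e" for t e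
  proof -
    have F't: "F' t = F t" using t by (simp add: F'_def)
    obtain d1 where d1: "d1 > 0" "\<And>h. 0 < h \<Longrightarrow> h < d1 \<Longrightarrow> norm (integral {t..t + h} F' /\<^sub>R h - F t) < e"
      using N1(2)[OF t(1) e] F't by (auto simp: One_nat_def)
    obtain d2 where d2: "d2 > 0" "\<And>h. 0 < h \<Longrightarrow> h < d2 \<Longrightarrow> norm (integral {-t..-t + h} (\<lambda>t. F' (- t)) /\<^sub>R h - F t) < e"
      using N2(2)[OF t(2) e] F't by auto
    \<comment> \<open>Below the distance of \<open>t\<close> to both end points the interval stays
      inside \<open>{0..2*pi}\<close>, where \<open>F'\<close> is \<open>F\<close> and the increment
      of the primitive is its integral.\<close>
    define d where "d = min (min d1 d2) (min t (2*pi - t))"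
    have "d > 0" using d1 d2 t by (simp add: d_def)
    have GF: "integral {x..y} F' = ?G y - ?G x" if "0 \<le> x" "x \<le> y" "y \<le> 2*pi" for x y
    proof -
      have "integral {x..y} F' = integral {x..y} F"
        by (intro Henstock_Kurzweil_Integration.integral_cong) (use that in \<open>auto simp: F'_def\<close>)
      then show ?thesis using circle_primitive_diff[OF a F that] by simp
    qed
    have scal: "norm (X - of_real h * F t) \<le> e * h" if "norm (X /\<^sub>R h - F t) < e" "0 < h" for X h
    proof -
      have "X - of_real h * F t = h *\<^sub>R (X /\<^sub>R h - F t)" using that by (simp add: scaleR_conv_of_real field_simps)
      then have "norm (X - of_real h * F t) = h * norm (X /\<^sub>R h - F t)" using that by simp
      also have "\<dots> \<le> h * e" using that by (intro mult_left_mono) auto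
      finally show ?thesis by (simp add: mult.commute)
    qed
    have "norm (?G (t - h) - ?G t + of_real h * F t) \<le> e * \<bar>h\<bar>" if h: "\<bar>h\<bar> < d" for h
    proof -
      consider "h = 0" | "h > 0" | "h < 0" by linarith
      then show ?thesis
      proof cases
        case 2
        have "integral {-t..-t + h} (\<lambda>t. F' (- t)) = integral {t - h..t} F'"
          using Henstock_Kurzweil_Integration.integral_reflect_real[of t "t - h" F'] by (simp add: algebra_simps)
        also have "\<dots> = ?G t - ?G (t - h)" by (rule GF) (use 2 h t in \<open>auto simp: d_def\<close>)
        finally have "norm ((?G t - ?G (t - h)) - of_real h * F t) \<le> e * h"
          using d2(2)[of h] 2 h by (intro scal) (auto simp: d_def)
        also have "norm ((?G t - ?G (t - h)) - of_real h * F t) = norm (?G (t - h) - ?G t + of_real h * F t)"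
          by (subst norm_minus_cancel[symmetric]) (simp add: algebra_simps)
        finally show ?thesis using 2 by simp
      next
        case 3
        have "integral {t..t - h} F' = ?G (t - h) - ?G t" by (rule GF) (use 3 h t in \<open>auto simp: d_def\<close>)
        then have "norm ((?G (t - h) - ?G t) - of_real (-h) * F t) \<le> e * (-h)"
          using d1(2)[of "-h"] 3 h by (intro scal) (auto simp: d_def)
        then show ?thesis using 3 by simp
      qed simp
    qed
    then show ?thesis using \<open>d > 0\<close> by blast
  qed
  have "negligible (N1 \<union> uminus ` N2 \<union> {0, 2*pi})"
  proof (intro negligible_Un N1(1))
    show "negligible (uminus ` N2)"
      by (rule negligible_differentiable_image_negligible[OF order_refl N2(1)])
         (auto intro!: differentiable_on_minus differentiable_on_ident)
  qed (simp add: negligible_finite)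
  from AE_circle_negligible[OF this] AE_space show ?thesis
  proof eventually_elim
    case (elim t)
    then have "- t \<notin> N2" by (metis UnCI image_eqI minus_minus)
    then show ?case using elim key[of t] by (auto simp: less_le)
  qed
qed

section \<open>Fatou's theorem at a point\<close>

text \<open>The angular derivative of the Poisson kernel, whose Fourier coefficients are
  \<open>i k r^|k|\<close>.\<close>

definition conj_kernel :: "real \<Rightarrow> real \<Rightarrow> real" where
  "conj_kernel r s = - 2 * Im (of_real r * cis s / (1 - of_real r * cis s)\<^sup>2)"

text \<open>The closed form shows that the kernel times \<open>sin s\<close> is never positive and
  that the kernel is of order \<open>1 - r\<^sup>2\<close> away from \<open>s = 0\<close>, the two
  facts that drive Fatou's argument.\<close>

lemma conj_kernel_eq:
  assumes "0 \<le> r" "r < 1"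
  shows "conj_kernel r s = - 2 * (1 - r\<^sup>2) * r * sin s / (norm (1 - of_real r * cis s))^4"
proof -
  define w where "w = of_real r * cis s"
  have nw: "norm w = r" using assms by (simp add: w_def norm_mult)
  have "1 - w \<noteq> 0" using nw assms by auto
  have "Im (w / (1 - w)\<^sup>2) = Im (w * cnj ((1 - w)\<^sup>2)) / (norm ((1 - w)\<^sup>2))\<^sup>2"
    by (subst complex_div_cnj) (simp add: Im_divide_of_real flip: of_real_power)
  also have "(norm ((1 - w)\<^sup>2))\<^sup>2 = (norm (1 - w))^4" by (simp add: norm_power flip: power_mult)
  also have "w * cnj ((1 - w)\<^sup>2) = w - 2 * (w * cnj w) + (w * cnj w) * cnj w"
    by (simp add: power2_eq_square algebra_simps)
  also have "w * cnj w = of_real (r\<^sup>2)" using complex_norm_square[of w] nw by simp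
  also have "Im (w - 2 * of_real (r\<^sup>2) + of_real (r\<^sup>2) * cnj w) = (1 - r\<^sup>2) * r * sin s"
    by (simp add: w_def algebra_simps)
  finally have "Im (w / (1 - w)\<^sup>2) = (1 - r\<^sup>2) * r * sin s / (norm (1 - w))^4" .
  then show ?thesis by (simp only: conj_kernel_def w_def mult.assoc times_divide_eq_right)
qed

lemma continuous_on_conj_kernel:
  assumes "0 \<le> r" "r < 1"
  shows "continuous_on S (conj_kernel r)"
  unfolding conj_kernel_def
  by (intro continuous_intros) (use one_minus_cis_nonzero[of "of_real r"] assms in auto)

text \<open>\<open>Z\<close> is the series of \<open>k * r ^ k * cis (k * s)\<close>, and the kernel
  is \<open>\<i> * Z - \<i> * cnj Z\<close>; the conjugate part contributes nothing at nonnegative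
  frequencies.\<close>

lemma fourier_coeff_conj_kernel:
  assumes r: "0 \<le> r" "r < 1"
  shows "fourier_coeff (\<lambda>s. of_real (conj_kernel r s)) (int k) = \<i> * of_nat k * of_real r ^ k"
proof -
  define Z where "Z s = of_real r * cis s / (1 - of_real r * cis s)\<^sup>2" for s
  let ?c = "\<lambda>k. of_nat k * of_real r ^ k :: complex"
  have w: "norm (of_real r * cis s) < 1" for s using r by (simp add: norm_mult)
  have ser: "(\<lambda>n. of_nat n * z ^ n) sums (z / (1 - z)\<^sup>2)" if "norm z < 1" for z :: complex
  proof -
    have "(\<lambda>n. z * (of_nat (Suc n) * z ^ n)) sums (z * (1 / (1 - z)\<^sup>2))"
      by (intro sums_mult geometric_deriv_sums that)
    then have "(\<lambda>n. of_nat (Suc n) * z ^ Suc n) sums (z / (1 - z)\<^sup>2)" by (simp add: algebra_simps)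
    then show ?thesis using sums_Suc_iff[of "\<lambda>n. of_nat n * z ^ n" "z / (1 - z)\<^sup>2"] by simp
  qed
  have sm: "summable (\<lambda>k. norm (?c k))"
  proof -
    have "(\<lambda>n. of_nat n * r ^ n) sums (r / (1 - r)\<^sup>2)"
    proof -
      have "(\<lambda>n. r * (of_nat (Suc n) * r ^ n)) sums (r * (1 / (1 - r)\<^sup>2))"
        by (intro sums_mult geometric_deriv_sums) (use r in auto)
      then have "(\<lambda>n. of_nat (Suc n) * r ^ Suc n) sums (r / (1 - r)\<^sup>2)" by (simp add: algebra_simps)
      then show ?thesis using sums_Suc_iff[of "\<lambda>n. of_nat n * r ^ n" "r / (1 - r)\<^sup>2"] by simp
    qed
    then show ?thesis using r by (simp add: norm_mult norm_power sums_iff)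
  qed
  have Zs: "Z = (\<lambda>s. \<Sum>k. ?c k * cis (of_nat k * s))"
  proof
    fix s
    show "Z s = (\<Sum>k. ?c k * cis (of_nat k * s))"
      using ser[OF w[of s]] by (simp add: Z_def sums_iff power_mult_distrib Complex.DeMoivre mult_ac)
  qed
  have cZ: "continuous_on {0..2*pi} Z" unfolding Zs by (rule continuous_on_cis_series[OF sm])
  have iZ: "integrable circle_measure Z" "integrable circle_measure (\<lambda>s. cnj (Z s))"
    by (intro integrable_circle_continuous continuous_intros cZ)+
  have Zc: "fourier_coeff Z j = (if 0 \<le> j then ?c (nat j) else 0)" for j
    unfolding Zs by (rule fourier_coeff_cis_series[OF sm])
  have "fourier_coeff (\<lambda>s. cnj (Z s)) (int k) = cnj (fourier_coeff Z (- int k))"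
  proof -
    have "(LINT s|circle_measure. cnj (Z s) * cis (- of_int (int k) * s)) = (LINT s|circle_measure. cnj (Z s * cis (- of_int (- int k) * s)))"
      by (simp add: cis_cnj)
    also have "\<dots> = cnj (LINT s|circle_measure. Z s * cis (- of_int (- int k) * s))" by (rule Bochner_Integration.integral_cnj)
    finally show ?thesis by (simp only: fourier_coeff_def complex_cnj_mult complex_cnj_complex_of_real)
  qed
  also have "\<dots> = 0" by (cases "k = 0") (auto simp: Zc)
  finally have cZc: "fourier_coeff (\<lambda>s. cnj (Z s)) (int k) = 0" .
  have "of_real (- 2 * Im z) = \<i> * z - \<i> * cnj z" for z
    by (simp add: complex_eq_iff)
  then have "of_real (conj_kernel r s) = \<i> * Z s - \<i> * cnj (Z s)" for s
    unfolding conj_kernel_def Z_def .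
  then have "fourier_coeff (\<lambda>s. of_real (conj_kernel r s)) (int k) = fourier_coeff (\<lambda>s. \<i> * Z s - \<i> * cnj (Z s)) (int k)"
    by simp
  also have "\<dots> = \<i> * fourier_coeff Z (int k) - \<i> * fourier_coeff (\<lambda>s. cnj (Z s)) (int k)"
    using iZ by (subst fourier_coeff_diff) (auto simp: fourier_coeff_cmult)
  finally show ?thesis by (simp add: cZc Zc)
qed

text \<open>Convolution multiplies the \<open>k\<close>-th coefficient by
  \<open>\<i> * k * r ^ k\<close>. Applied to the primitive it undoes the division by
  \<open>\<i> * k\<close> and returns the original series at radius \<open>r\<close>.\<close>

lemma conj_kernel_convolution:
  fixes c :: "nat \<Rightarrow> complex"
  assumes r: "0 \<le> r" "r < 1" and c: "summable (\<lambda>k. norm (c k))"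
  shows "(LINT s|circle_measure. of_real (conj_kernel r s) * (\<Sum>k. c k * cis (of_nat k * (t - s))))
     = 2 * pi * (\<Sum>k. \<i> * of_nat k * c k * of_real r ^ k * cis (of_nat k * t))"
proof -
  let ?K = "\<lambda>s. complex_of_real (conj_kernel r s)"
  have cK: "continuous_on {0..2*pi} ?K" by (intro continuous_intros continuous_on_conj_kernel r)
  have iK: "integrable circle_measure ?K" by (rule integrable_circle_continuous[OF cK])
  have mK[measurable]: "?K \<in> borel_measurable circle_measure" using iK by auto
  have cc: "continuous_on {0..2*pi} (\<lambda>s. \<Sum>k. c k * cis (of_nat k * (t - s)))"
    by (rule continuous_on_compose2[OF continuous_on_cis_series[OF c, of UNIV]]) (auto intro!: continuous_intros)
  have "(\<lambda>n. LINT s|circle_measure. ?K s * (\<Sum>k<n. c k * cis (of_nat k * (t - s)))) \<longlonglongrightarrow> 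
    (LINT s|circle_measure. ?K s * (\<Sum>k. c k * cis (of_nat k * (t - s))))"
  proof (rule integral_dominated_convergence[where w="\<lambda>s. norm (?K s) * (\<Sum>k. norm (c k))"])
    show "(\<lambda>s. ?K s * (\<Sum>k. c k * cis (of_nat k * (t - s)))) \<in> borel_measurable circle_measure"
      by (intro continuous_measurable_circle continuous_intros cK cc)
    show "(\<lambda>s. ?K s * (\<Sum>k<n. c k * cis (of_nat k * (t - s)))) \<in> borel_measurable circle_measure" for n
      by (intro continuous_measurable_circle continuous_intros cK)
    show "integrable circle_measure (\<lambda>s. norm (?K s) * (\<Sum>k. norm (c k)))" using iK by (intro integrable_mult_left integrable_norm)
    show "AE s in circle_measure. (\<lambda>n. ?K s * (\<Sum>k<n. c k * cis (of_nat k * (t - s)))) \<longlonglongrightarrow> ?K s * (\<Sum>k. c k * cis (of_nat k * (t - s)))"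
      by (intro AE_I2 tendsto_mult tendsto_const summable_LIMSEQ summable_cis_series c)
    show "AE s in circle_measure. norm (?K s * (\<Sum>k<n. c k * cis (of_nat k * (t - s)))) \<le> norm (?K s) * (\<Sum>k. norm (c k))" for n
    proof (rule AE_I2)
      fix s
      have "norm (\<Sum>k<n. c k * cis (of_nat k * (t - s))) \<le> (\<Sum>k<n. norm (c k))"
        by (rule order_trans[OF norm_sum]) (simp add: norm_mult)
      also have "\<dots> \<le> (\<Sum>k. norm (c k))" by (rule sum_le_suminf[OF c]) auto
      finally show "norm (?K s * (\<Sum>k<n. c k * cis (of_nat k * (t - s)))) \<le> norm (?K s) * (\<Sum>k. norm (c k))"
        unfolding norm_mult by (rule mult_left_mono) simp
    qed
  qed
  moreover have "(LINT s|circle_measure. ?K s * (\<Sum>k<n. c k * cis (of_nat k * (t - s)))) = 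
     2 * pi * (\<Sum>k<n. \<i> * of_nat k * c k * of_real r ^ k * cis (of_nat k * t))" for n
  proof -
    have "?K s * (\<Sum>k<n. c k * cis (of_nat k * (t - s))) = (\<Sum>k<n. (c k * cis (of_nat k * t)) * (?K s * cis (- of_int (int k) * s)))" for s
    proof -
      have "cis (of_nat k * (t - s)) = cis (of_nat k * t) * cis (- of_int (int k) * s)" for k
        by (simp add: cis_mult algebra_simps)
      then show ?thesis by (simp add: sum_distrib_left mult_ac)
    qed
    then have "(LINT s|circle_measure. ?K s * (\<Sum>k<n. c k * cis (of_nat k * (t - s)))) = 
       (\<Sum>k<n. (c k * cis (of_nat k * t)) * (LINT s|circle_measure. ?K s * cis (- of_int (int k) * s)))"
      using integrable_mult_cis[OF iK, of "- of_int (int k)" for k]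
      by (simp only:) (subst Bochner_Integration.integral_sum; simp)
    moreover have "(LINT s|circle_measure. ?K s * cis (- of_int (int k) * s)) = 2 * pi * (\<i> * of_nat k * of_real r ^ k)" for k
      using fourier_coeff_conj_kernel[OF r, of k] by (simp add: fourier_coeff_def field_simps)
    ultimately show ?thesis by (simp only: sum_distrib_left mult_ac)
  qed
  ultimately have 1: "(\<lambda>n. 2 * pi * (\<Sum>k<n. \<i> * of_nat k * c k * of_real r ^ k * cis (of_nat k * t))) \<longlonglongrightarrow> 
    (LINT s|circle_measure. ?K s * (\<Sum>k. c k * cis (of_nat k * (t - s))))" by simp
  have "(\<lambda>n. 1 / (2 * pi) * (2 * pi * (\<Sum>k<n. \<i> * of_nat k * c k * of_real r ^ k * cis (of_nat k * t)))) \<longlonglongrightarrow> 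
    1 / (2 * pi) * (LINT s|circle_measure. ?K s * (\<Sum>k. c k * cis (of_nat k * (t - s))))"
    by (intro tendsto_mult 1 tendsto_const)
  then have "(\<lambda>k. \<i> * of_nat k * c k * of_real r ^ k * cis (of_nat k * t)) sums 
     (1 / (2 * pi) * (LINT s|circle_measure. ?K s * (\<Sum>k. c k * cis (of_nat k * (t - s)))))"
    by (simp add: sums_def)
  then show ?thesis by (simp add: sums_iff)
qed

text \<open>Read off from the coefficients at 0 and 1. The kernel kills constants; its integral
  against \<open>sin\<close> both produces the term \<open>r * L\<close> and gives the total mass of
  the absolute value of kernel times sine.\<close>

lemma conj_kernel_integrals:
  assumes r: "0 \<le> r" "r < 1"
  shows "(LINT s|circle_measure. of_real (conj_kernel r s)) = (0::complex)"
    and "(LINT s|circle_measure. conj_kernel r s * sin s) = - 2 * pi * r"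
proof -
  show "(LINT s|circle_measure. of_real (conj_kernel r s)) = (0::complex)"
    using fourier_coeff_conj_kernel[OF r, of 0] by (simp add: fourier_coeff_def)
  have i: "integrable circle_measure (\<lambda>s. complex_of_real (conj_kernel r s) * cis (- s))"
    by (intro integrable_circle_continuous continuous_intros continuous_on_conj_kernel r)
  have "(LINT s|circle_measure. of_real (conj_kernel r s) * cis (- s)) = 2 * pi * (\<i> * r)"
    using fourier_coeff_conj_kernel[OF r, of 1] by (simp add: fourier_coeff_def field_simps)
  then have "Im (LINT s|circle_measure. of_real (conj_kernel r s) * cis (- s)) = 2 * pi * r" by simp
  then have "(LINT s|circle_measure. - (conj_kernel r s * sin s)) = 2 * pi * r"
    using integral_Im[OF i] by simp
  then show "(LINT s|circle_measure. conj_kernel r s * sin s) = - 2 * pi * r" by simp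
qed

lemma sin_approx:
  assumes "0 < (e::real)"
  obtains d where "0 < d" "\<And>h. \<bar>h\<bar> < d \<Longrightarrow> \<bar>sin h - h\<bar> \<le> e * \<bar>h\<bar>"
proof -
  have "(sin has_derivative (\<lambda>h. 1 * h)) (at (0::real))"
    using DERIV_sin[of 0] unfolding has_field_derivative_def cos_zero .
  then have "(sin has_derivative (\<lambda>h. h)) (at (0::real))" by (simp only: mult_1_left)
  then obtain d where "0 < d" "\<And>h. \<bar>h\<bar> < d \<Longrightarrow> \<bar>sin h - h\<bar> \<le> e * \<bar>h\<bar>"
    unfolding has_derivative_at_alt using assms by fastforce
  then show ?thesis using that by blast
qed

lemma circle_primitive_periodic: "circle_primitive a (t + 2*pi) = circle_primitive a t"
proof -
  have "cis (of_nat k * (t + 2*pi)) = cis (of_nat k * t)" for k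
  proof -
    have "cis (of_nat k * (t + 2*pi)) = cis (of_nat k * t) * cis (2*pi) ^ k"
      by (simp add: Complex.DeMoivre cis_mult algebra_simps)
    then show ?thesis by simp
  qed
  then show ?thesis by (simp add: circle_primitive_def)
qed

text \<open>Fatou's argument: differentiate the Poisson integral of the primitive and compare the
  primitive with its tangent, the linear function being replaced by the periodic \<open>sin\<close>.\<close>

lemma fatou_at_point:
  fixes a :: "nat \<Rightarrow> complex"
  assumes a: "summable (\<lambda>k. (norm (a k))\<^sup>2)" "a 0 = 0"
    and L: "\<And>e. 0 < e \<Longrightarrow> \<exists>d>0. \<forall>h. \<bar>h\<bar> < d \<longrightarrow> 
    norm (circle_primitive a (t - h) - circle_primitive a t + of_real h * L) \<le> e * \<bar>h\<bar>"
  shows "((\<lambda>r. \<Sum>k. a k * of_real r ^ k * cis (of_nat k * t)) \<longlongrightarrow> L) (at_left 1)"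
proof -
  let ?G = "circle_primitive a"
  let ?f = "\<lambda>r. \<Sum>k. a k * of_real r ^ k * cis (of_nat k * t)"
  define E where "E s = ?G (t - s) - ?G t + of_real (sin s) * L" for s
  have sc: "summable (\<lambda>k. norm (primitive_coeff a k))" by (rule summable_primitive_coeff[OF a(1)])
  have cG: "continuous_on S ?G" for S
    unfolding circle_primitive_def[abs_def] by (rule continuous_on_cis_series[OF sc])
  have cE: "continuous_on S E" for S
    unfolding E_def by (intro continuous_intros continuous_on_compose2[OF cG[of UNIV]]) auto
  define M0 where "M0 = (\<Sum>k. norm (primitive_coeff a k))"
  have GM: "norm (?G s) \<le> M0" for s
  proof -
    have "norm (?G s) \<le> (\<Sum>k. norm (primitive_coeff a k * cis (of_nat k * s)))"
      unfolding circle_primitive_def by (rule summable_norm) (simp add: norm_mult sc)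
    then show ?thesis by (simp add: norm_mult M0_def)
  qed
  define M where "M = 2 * M0 + norm L"
  have EM: "norm (E s) \<le> M" for s
  proof -
    have "norm (E s) \<le> norm (?G (t - s)) + norm (?G t) + norm (of_real (sin s) * L)"
      unfolding E_def by (intro norm_triangle_le norm_triangle_ineq4 add_mono order_refl)
    also have "norm (of_real (sin s) * L) \<le> norm L"
      by (simp add: norm_mult mult_left_le_one_le)
    finally show ?thesis using GM[of "t - s"] GM[of t] by (simp add: M_def)
  qed
  have M0: "0 \<le> M" using EM[of 0] norm_ge_zero order_trans by blast
  \<comment> \<open>Periodicity lets angles near \<open>2*pi\<close> be treated like angles near
    0.\<close>
  have Eper: "E s = E (s - 2*pi)" for s
  proof -
    have "sin (s - 2*pi) = sin s" using sin_periodic[of "s - 2*pi"] by simp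
    then show ?thesis using circle_primitive_periodic[of a "t - s"] by (simp add: E_def algebra_simps)
  qed
  have rep: "2 * pi * (?f r - of_real r * L) = (LINT s|circle_measure. of_real (conj_kernel r s) * E s)" if r: "0 \<le> r" "r < 1" for r
  proof -
    let ?K = "conj_kernel r"
    have i1: "integrable circle_measure (\<lambda>s. of_real (?K s) * ?G (t - s))"
      by (intro integrable_circle_continuous continuous_intros continuous_on_conj_kernel r continuous_on_compose2[OF cG[of UNIV]]) auto
    have i2: "integrable circle_measure (\<lambda>s. complex_of_real (?K s))" 
         "integrable circle_measure (\<lambda>s. complex_of_real (?K s * sin s))"
      by (intro integrable_circle_continuous continuous_intros continuous_on_conj_kernel r)+
    have "(LINT s|circle_measure. of_real (?K s) * E s) = 
      (LINT s|circle_measure. (of_real (?K s) * ?G (t - s) - of_real (?K s) * ?G t) + of_real (?K s * sin s) * L)"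
      by (simp add: E_def algebra_simps)
    also have "\<dots> = (LINT s|circle_measure. of_real (?K s) * ?G (t - s)) - (LINT s|circle_measure. of_real (?K s)) * ?G t
       + (LINT s|circle_measure. of_real (?K s * sin s)) * L"
      using i1 i2 by (simp del: of_real_mult)
    also have "(LINT s|circle_measure. of_real (?K s * sin s)) = complex_of_real (- 2 * pi * r)"
      using conj_kernel_integrals(2)[OF r] by (simp only: integral_complex_of_real)
    also have "(LINT s|circle_measure. of_real (?K s)) = (0::complex)" by (rule conj_kernel_integrals(1)[OF r])
    also have "(LINT s|circle_measure. of_real (?K s) * ?G (t - s)) = 2 * pi * (\<Sum>k. \<i> * of_nat k * primitive_coeff a k * of_real r ^ k * cis (of_nat k * t))"
      unfolding circle_primitive_def by (rule conj_kernel_convolution[OF r sc])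
    also have "(\<lambda>k. \<i> * of_nat k * primitive_coeff a k * of_real r ^ k * cis (of_nat k * t)) = (\<lambda>k. a k * of_real r ^ k * cis (of_nat k * t))"
    proof
      fix k show "\<i> * of_nat k * primitive_coeff a k * of_real r ^ k * cis (of_nat k * t) = a k * of_real r ^ k * cis (of_nat k * t)"
        using a(2) by (cases "k = 0") (auto simp: primitive_coeff_def)
    qed
    finally show ?thesis by (simp add: algebra_simps)
  qed
  have main: "eventually (\<lambda>r. norm (?f r - of_real r * L) < e) (at_left 1)" if e: "0 < e" for e :: real
  proof -
    \<comment> \<open>Replacing \<open>h\<close> by \<open>sin h\<close> costs at most
      \<open>e1 * norm L * \<bar>h\<bar> \<le> (e/8) * \<bar>h\<bar>\<close>. With the derivative
      error the total is \<open>(e/4) * \<bar>h\<bar>\<close>, and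
      \<open>\<bar>h\<bar> \<le> 2 * \<bar>sin h\<bar>\<close> turns this into
      \<open>(e/2) * \<bar>sin h\<bar>\<close>. The summand 1 covers \<open>L = 0\<close>.\<close>
    define e1 where "e1 = (e / 8) / (norm L + 1)"
    have Lp: "norm L + 1 > 0" by (simp add: add_nonneg_pos)
    have e1: "e1 > 0" unfolding e1_def using e Lp by (intro divide_pos_pos) auto
    have e1L: "e1 * (norm L + 1) = e / 8"
      using nonzero_eq_divide_eq[of "norm L + 1" e1 "e / 8"] Lp e1_def by linarith
    obtain d1 where d1: "d1 > 0" "\<And>h. \<bar>h\<bar> < d1 \<Longrightarrow> norm (?G (t - h) - ?G t + of_real h * L) \<le> (e/8) * \<bar>h\<bar>"
      using L[of "e/8"] e by auto
    obtain d2 where d2: "d2 > 0" "\<And>h. \<bar>h\<bar> < d2 \<Longrightarrow> \<bar>sin h - h\<bar> \<le> e1 * \<bar>h\<bar>" using sin_approx[OF e1] by blast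
    have half: "(0::real) < 1/2" by simp
    obtain d3 where d3: "d3 > 0" "\<And>h::real. \<bar>h\<bar> < d3 \<Longrightarrow> \<bar>sin h - h\<bar> \<le> (1/2) * \<bar>h\<bar>" 
      using sin_approx[OF half] by blast
    define d where "d = min (min d1 d2) (min d3 1)"
    have d: "0 < d" "d \<le> 1" using d1 d2 d3 by (auto simp: d_def)
    have small: "norm (E h) \<le> (e/2) * \<bar>sin h\<bar>" if h: "\<bar>h\<bar> < d" for h
    proof -
      have "E h = (?G (t - h) - ?G t + of_real h * L) + of_real (sin h - h) * L"
        by (simp add: E_def algebra_simps)
      then have "norm (E h) \<le> norm (?G (t - h) - ?G t + of_real h * L) + norm (of_real (sin h - h) * L)"
        by (metis norm_triangle_ineq)
      also have "\<dots> \<le> (e/8) * \<bar>h\<bar> + (e1 * \<bar>h\<bar>) * norm L"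
        unfolding norm_mult norm_of_real using h by (intro add_mono d1 mult_right_mono d2) (auto simp: d_def)
      also have "(e1 * \<bar>h\<bar>) * norm L \<le> (e/8) * \<bar>h\<bar>"
      proof -
        have "e1 * norm L \<le> e1 * (norm L + 1)" using e1 by (intro mult_left_mono) auto
        also have "\<dots> = e/8" by (rule e1L)
        finally have "(e1 * norm L) * \<bar>h\<bar> \<le> (e/8) * \<bar>h\<bar>" by (rule mult_right_mono) simp
        then show ?thesis by (simp add: mult_ac)
      qed
      finally have 1: "norm (E h) \<le> (e/4) * \<bar>h\<bar>" by simp
      have "\<bar>h\<bar> \<le> 2 * \<bar>sin h\<bar>" using d3(2)[of h] h by (auto simp: d_def abs_if split: if_splits)
      then have "(e/4) * \<bar>h\<bar> \<le> (e/4) * (2 * \<bar>sin h\<bar>)" using e by (intro mult_left_mono) auto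
      with 1 show ?thesis by simp
    qed
    have cd: "cos d < 1" using d cos_monotone_0_pi[of 0 d] pi_gt3 by simp
    \<comment> \<open>Off the \<open>d\<close>-neighbourhoods of 0 and \<open>2*pi\<close> and for
      \<open>r > 1/2\<close>, the square of \<open>norm (1 - r * cis s)\<close> is at least
      \<open>2 * r * (1 - cos s) \<ge> 1 - cos d\<close>; with \<open>norm (E s) \<le> M\<close> the
      integrand there is at most \<open>Q * (1 - r\<^sup>2)\<close>.\<close>
    define Q where "Q = M * (2 / (1 - cos d)\<^sup>2)"
    have "((\<lambda>r. e/2 + Q * (1 - r\<^sup>2)) \<longlongrightarrow> e/2 + Q * (1 - 1\<^sup>2)) (at_left 1)"
      by (intro tendsto_intros)
    from order_tendstoD(2)[OF this, of e] have ev1: "eventually (\<lambda>r. e/2 + Q * (1 - r\<^sup>2) < e) (at_left 1)"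
      using e by simp
    have ev2: "eventually (\<lambda>r::real. r \<in> {1/2<..<1}) (at_left 1)"
      by (rule eventually_at_leftI[of "1/2"]) auto
    show ?thesis using ev1 ev2
    proof eventually_elim
      case (elim r)
      then have r: "0 \<le> r" "r < 1" "1/2 < r" by auto
      let ?K = "conj_kernel r"
      have K_sin: "\<bar>?K s * sin s\<bar> = - (?K s * sin s)" for s
      proof -
        have "?K s * sin s = - (2 * (1 - r\<^sup>2) * r * (sin s)\<^sup>2 / (norm (1 - of_real r * cis s))^4)"
          unfolding conj_kernel_eq[OF r(1,2)] power2_eq_square[of "sin s"] divide_inverse by (simp add: algebra_simps)
        moreover have "0 \<le> 2 * (1 - r\<^sup>2) * r * (sin s)\<^sup>2 / (norm (1 - of_real r * cis s))^4"
          using r by (intro divide_nonneg_nonneg mult_nonneg_nonneg) (auto simp: abs_square_le_1)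
        ultimately show ?thesis by linarith
      qed
      have bound: "norm (of_real (?K s) * E s) \<le> (e/2) * (- (?K s * sin s)) + Q * (1 - r\<^sup>2)" if s: "0 \<le> s" "s \<le> 2*pi" for s
      proof -
        have Q0: "0 \<le> Q * (1 - r\<^sup>2)" using M0 r by (auto simp: Q_def abs_square_le_1)
        have S0: "0 \<le> (e/2) * (- (?K s * sin s))" using K_sin[of s] e abs_ge_zero[of "?K s * sin s"] by (intro mult_nonneg_nonneg) auto
        have near: "norm (of_real (?K s) * E s) \<le> (e/2) * (- (?K s * sin s))" if "norm (E s) \<le> (e/2) * \<bar>sin s\<bar>"
        proof -
          have "norm (of_real (?K s) * E s) = \<bar>?K s\<bar> * norm (E s)" by (simp add: norm_mult)
          also have "\<dots> \<le> \<bar>?K s\<bar> * ((e/2) * \<bar>sin s\<bar>)" using that by (rule mult_left_mono) simp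
          also have "\<dots> = (e/2) * \<bar>?K s * sin s\<bar>" by (simp add: abs_mult)
          finally show ?thesis by (simp only: K_sin)
        qed
        consider "s < d" | "2*pi - s < d" | "d \<le> s" "s \<le> 2*pi - d" by linarith
        then show ?thesis
        proof cases
          case 1
          then show ?thesis using near[OF small[of s]] s Q0 by simp
        next
          case 2
          have "norm (E s) \<le> (e/2) * \<bar>sin s\<bar>"
            using small[of "s - 2*pi"] 2 s sin_periodic[of "s - 2*pi"] by (simp add: Eper[of s])
          from near[OF this] Q0 show ?thesis by simp
        next
          case 3
          have cs: "cos s \<le> cos d"
          proof (cases "s \<le> pi")
            case True then show ?thesis using 3 d by (intro cos_monotone_0_pi_le) auto
          next
            case False
            have "cos s = cos (2*pi - s)" by (simp add: cos_diff)
            also have "\<dots> \<le> cos d" using 3 d False by (intro cos_monotone_0_pi_le) auto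
            finally show ?thesis .
          qed
          have nsq: "(norm (1 - of_real r * cis s))\<^sup>2 = (1 - r)\<^sup>2 + 2 * r * (1 - cos s)"
          proof -
            have "(norm (1 - of_real r * cis s))\<^sup>2 = (1 - r * cos s)\<^sup>2 + (r * sin s)\<^sup>2"
              by (simp add: cmod_power2)
            also have "\<dots> = 1 - 2 * r * cos s + r\<^sup>2 * ((sin s)\<^sup>2 + (cos s)\<^sup>2)"
              by algebra
            also have "(sin s)\<^sup>2 + (cos s)\<^sup>2 = 1" by (rule sin_cos_squared_add)
            finally show ?thesis by (simp add: power2_eq_square algebra_simps)
          qed
          have "1 * (1 - cos d) \<le> 2 * r * (1 - cos s)" using r cs cd by (intro mult_mono) auto
          from add_mono[OF zero_le_power2[of "1 - r"] this] have "1 - cos d \<le> (norm (1 - of_real r * cis s))\<^sup>2"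
            unfolding nsq by simp
          then have "(1 - cos d)\<^sup>2 \<le> ((norm (1 - of_real r * cis s))\<^sup>2)\<^sup>2" using cd by (intro power_mono) auto
          then have n4: "(1 - cos d)\<^sup>2 \<le> (norm (1 - of_real r * cis s))^4" by (simp flip: power_mult)
          have "\<bar>?K s\<bar> = \<bar>2 * (1 - r\<^sup>2) * r * sin s\<bar> / (norm (1 - of_real r * cis s))^4"
            by (simp add: conj_kernel_eq[OF r(1,2)] abs_mult abs_minus_commute)
          also have "\<dots> \<le> (2 * (1 - r\<^sup>2)) / (1 - cos d)\<^sup>2"
          proof (rule frac_le)
            have "0 \<le> 1 - r\<^sup>2" using r by (simp add: abs_square_le_1)
            moreover have "r * \<bar>sin s\<bar> \<le> 1" using r by (intro mult_le_one) auto
            ultimately have "2 * (1 - r\<^sup>2) * (r * \<bar>sin s\<bar>) \<le> 2 * (1 - r\<^sup>2) * 1" by (intro mult_left_mono) auto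
            then show "\<bar>2 * (1 - r\<^sup>2) * r * sin s\<bar> \<le> 2 * (1 - r\<^sup>2)"
              using \<open>0 \<le> 1 - r\<^sup>2\<close> r by (simp add: abs_mult mult.assoc)
            show "0 \<le> 2 * (1 - r\<^sup>2)" using \<open>0 \<le> 1 - r\<^sup>2\<close> by simp
          qed (use n4 cd in auto)
          finally have "\<bar>?K s\<bar> * norm (E s) \<le> (2 * (1 - r\<^sup>2)) / (1 - cos d)\<^sup>2 * M"
            using EM r by (intro mult_mono) (auto simp: abs_square_le_1)
          then have "norm (of_real (?K s) * E s) \<le> Q * (1 - r\<^sup>2)" by (simp add: norm_mult Q_def mult_ac)
          then show ?thesis using S0 by linarith
        qed
      qed
      have iS: "integrable circle_measure (\<lambda>s. ?K s * sin s)"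
        by (intro integrable_circle_continuous continuous_intros continuous_on_conj_kernel r)
      have iKE: "integrable circle_measure (\<lambda>s. of_real (?K s) * E s)"
        by (intro integrable_circle_continuous continuous_intros continuous_on_conj_kernel r cE)
      have "2 * pi * norm (?f r - of_real r * L) = norm (2 * pi * (?f r - of_real r * L))" by (simp add: norm_mult)
      also have "\<dots> = norm (LINT s|circle_measure. of_real (?K s) * E s)" using rep[OF r(1,2)] by simp
      also have "\<dots> \<le> (LINT s|circle_measure. (e/2) * (- (?K s * sin s)) + Q * (1 - r\<^sup>2))"
        by (rule Bochner_Integration.integral_norm_bound_integral[OF iKE])
           (use iS bound in \<open>auto intro!: Bochner_Integration.integrable_add integrable_mult_right Bochner_Integration.integrable_minus\<close>)
      also have "\<dots> = (e/2) * (- (LINT s|circle_measure. ?K s * sin s)) + 2 * pi * (Q * (1 - r\<^sup>2))"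
        using iS by (subst Bochner_Integration.integral_add) (auto intro!: integrable_mult_right Bochner_Integration.integrable_minus)
      \<comment> \<open>The near part is weighted by a function of exact mass
        \<open>2 * pi * r\<close>, so after division by \<open>2 * pi\<close> it contributes at most
        \<open>e/2\<close>, uniformly in \<open>r\<close>.\<close>
      also have "\<dots> = 2 * pi * ((e/2) * r + Q * (1 - r\<^sup>2))"
        unfolding conj_kernel_integrals(2)[OF r(1,2)] by (simp add: algebra_simps)
      finally have "norm (?f r - of_real r * L) \<le> (e/2) * r + Q * (1 - r\<^sup>2)" by simp
      also have "\<dots> \<le> e/2 + Q * (1 - r\<^sup>2)" using r e by (simp add: mult_left_le)
      also have "\<dots> < e" using elim by simp
      finally show ?case .
    qed
  qed
  have "((\<lambda>r. ?f r - of_real r * L) \<longlongrightarrow> 0) (at_left 1)"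
    unfolding tendsto_iff dist_norm using main by simp
  moreover have "((\<lambda>r. of_real r * L) \<longlongrightarrow> of_real 1 * L) (at_left 1)" by (intro tendsto_intros)
  ultimately have "((\<lambda>r. (?f r - of_real r * L) + of_real r * L) \<longlongrightarrow> 0 + of_real 1 * L) (at_left 1)"
    by (rule tendsto_add)
  then show ?thesis by simp
qed

section \<open>Boundary functions and Toeplitz operators\<close>

lemma HinfD:
  assumes "b \<in> Hinf"
  shows Hinf_holomorphic: "b holomorphic_on ball 0 1" 
    and Hinf_bounded: "\<exists>K. \<forall>z\<in>ball 0 1. norm (b z) \<le> K"
  using assms by (auto simp: Hinf_def bounded_iff)

text \<open>Square summable Taylor coefficients define an L^2 function \<open>F\<close> whose
  primitive has derivative \<open>F\<close> almost everywhere, and \<open>fatou_at_point\<close>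
  makes the radial limits equal to \<open>F\<close> plus the constant term. Measurability and
  coefficients then transfer from that sum to \<open>boundary_fn\<close>.\<close>

theorem fatou:
  assumes b: "b \<in> Hinf"
  shows "AE t in circle_measure. ((\<lambda>r. b (of_real r * cis t)) \<longlongrightarrow> boundary_fn b t) (at_left 1)"
    and boundary_fn_measurable: "boundary_fn b \<in> borel_measurable circle_measure"
    and fourier_coeff_boundary_fn: "fourier_coeff (boundary_fn b) k = (if 0 \<le> k then taylor_coeff b (nat k) else 0)"
proof -
  note hb = HinfD(1)[OF b]
  obtain K where K: "\<And>z. z \<in> ball 0 1 \<Longrightarrow> norm (b z) \<le> K" using HinfD(2)[OF b] by blast
  define c where "c = taylor_coeff b 0"
  \<comment> \<open>The constant term is split off because its primitive would not be
    periodic.\<close>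
  define a where "a = (taylor_coeff b)(0 := 0)"
  have "summable (\<lambda>k. (norm (taylor_coeff b k))\<^sup>2)"
    by (rule taylor_l2_bound[OF hb]) (rule K)
  then have "summable (\<lambda>k. (norm (taylor_coeff b (Suc k)))\<^sup>2)"
    by (rule iffD2[OF summable_Suc_iff])
  then have "summable (\<lambda>k. (norm (a (Suc k)))\<^sup>2)" by (simp add: a_def)
  then have a: "summable (\<lambda>k. (norm (a k))\<^sup>2)" "a 0 = 0"
    by (rule iffD1[OF summable_Suc_iff]) (simp add: a_def)
  obtain F where F: "F \<in> Lp 2" "\<And>k. fourier_coeff F k = (if 0 \<le> k then a (nat k) else 0)"
    "(\<lambda>n. p_int 2 (\<lambda>t. (\<Sum>k<n. a k * cis (of_nat k * t)) - F t)) \<longlonglongrightarrow> 0"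
    using l2_boundary_function[OF a(1)] by blast
  have Fi: "integrable circle_measure F" using Lp_integrable(1)[OF F(1)] by simp
  have lim: "AE t in circle_measure. ((\<lambda>r. b (of_real r * cis t)) \<longlongrightarrow> F t + c) (at_left 1)"
    using circle_primitive_differentiable_AE[OF a F(1,3)]
  proof eventually_elim
    case (elim t)
    have "((\<lambda>r. \<Sum>k. a k * of_real r ^ k * cis (of_nat k * t)) \<longlongrightarrow> F t) (at_left 1)"
      using elim by (intro fatou_at_point a) auto
    then have "((\<lambda>r. (\<Sum>k. a k * of_real r ^ k * cis (of_nat k * t)) + c) \<longlongrightarrow> F t + c) (at_left 1)"
      by (intro tendsto_intros)
    moreover have "eventually (\<lambda>r::real. r \<in> {0<..<1}) (at_left 1)"
      by (rule eventually_at_leftI[of 0]) auto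
    then have "eventually (\<lambda>r. (\<Sum>k. a k * of_real r ^ k * cis (of_nat k * t)) + c = b (of_real r * cis t)) (at_left 1)"
    proof eventually_elim
      case (elim r)
      let ?s = "\<lambda>k. (taylor_coeff b k * of_real r ^ k) * cis (of_nat k * t)"
      have r: "0 \<le> r" "r < 1" using elim by auto
      have sm: "summable ?s" by (rule summable_cis_series[OF summable_norm_taylor[OF hb r]])
      have "b (of_real r * cis t) = (\<Sum>k. ?s k)" by (rule holomorphic_circle_series[OF hb r])
      also have "\<dots> = (\<Sum>k. ?s (Suc k)) + ?s 0" by (subst suminf_split_head[OF sm]) simp
      finally have 1: "b (of_real r * cis t) = (\<Sum>k. ?s (Suc k)) + c" by (simp add: c_def)
      have "summable (\<lambda>k. a (Suc k) * of_real r ^ Suc k * cis (of_nat (Suc k) * t))"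
        using sm by (subst (asm) summable_Suc_iff[symmetric]) (simp add: a_def)
      then have sm': "summable (\<lambda>k. a k * of_real r ^ k * cis (of_nat k * t))"
        by (subst (asm) summable_Suc_iff)
      have "(\<Sum>k. a k * of_real r ^ k * cis (of_nat k * t)) = (\<Sum>k. ?s (Suc k))"
        using suminf_split_head[OF sm'] by (simp add: a_def)
      then show ?case using 1 by simp
    qed
    ultimately show ?case by (rule Lim_transform_eventually)
  qed
  have eq: "AE t in circle_measure. F t + c = boundary_fn b t"
    using lim
  proof eventually_elim
    case (elim t)
    then have "Lim (at_left 1) (\<lambda>r. b (of_real r * cis t)) = F t + c"
      by (intro tendsto_Lim) simp_all
    then show ?case by (simp add: boundary_fn_def)
  qed
  show "AE t in circle_measure. ((\<lambda>r. b (of_real r * cis t)) \<longlongrightarrow> boundary_fn b t) (at_left 1)"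
    using lim eq by eventually_elim simp
  have mF: "(\<lambda>t. F t + c) \<in> borel_measurable circle_measure" using Fi by auto
  show "boundary_fn b \<in> borel_measurable circle_measure" by (rule circle_measurable_AE[OF mF eq])
  have "fourier_coeff (boundary_fn b) k = fourier_coeff (\<lambda>t. F t + c) k"
    by (rule fourier_coeff_AE_cong[OF mF eq, symmetric])
  also have "\<dots> = fourier_coeff F k + fourier_coeff (\<lambda>t. c * cis (of_int 0 * t)) k"
    using Fi by (subst fourier_coeff_add) auto
  also have "\<dots> = (if 0 \<le> k then taylor_coeff b (nat k) else 0)"
    unfolding fourier_coeff_cmult fourier_coeff_cis F(2) by (auto simp: a_def c_def)
  finally show "fourier_coeff (boundary_fn b) k = (if 0 \<le> k then taylor_coeff b (nat k) else 0)" .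
qed

lemma eventually_radius: "eventually (\<lambda>r::real. of_real r * cis t \<in> ball (0::complex) 1) (at_left 1)"
  by (rule eventually_at_leftI[of 0]) (auto simp: norm_mult)

lemma boundary_fn_bound:
  assumes b: "b \<in> Hinf" and K: "\<And>z. z \<in> ball 0 1 \<Longrightarrow> norm (b z) \<le> K"
  shows "AE t in circle_measure. norm (boundary_fn b t) \<le> K"
  using fatou(1)[OF b]
proof eventually_elim
  case (elim t)
  have "eventually (\<lambda>r. norm (b (of_real r * cis t)) \<le> K) (at_left 1)"
    using eventually_radius[of t] by eventually_elim (rule K)
  then show ?case using tendsto_norm[OF elim] by (intro tendsto_upperbound) auto
qed

lemma boundary_fn_bounded:
  assumes "b \<in> Hinf"
  obtains K where "AE t in circle_measure. norm (boundary_fn b t) \<le> K"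
  using boundary_fn_bound[OF assms] HinfD(2)[OF assms] by blast

lemma boundary_fn_const [simp]: "boundary_fn (\<lambda>z. c) t = c"
  by (simp add: boundary_fn_def tendsto_Lim)

lemma Hinf_mult:
  assumes "b \<in> Hinf" "c \<in> Hinf" shows "(\<lambda>z. b z * c z) \<in> Hinf"
proof -
  obtain K L where K: "\<forall>z\<in>ball 0 1. norm (b z) \<le> K" and L: "\<forall>z\<in>ball 0 1. norm (c z) \<le> L"
    using HinfD(2)[OF assms(1)] HinfD(2)[OF assms(2)] by blast
  have "norm (b z * c z) \<le> K * L" if "z \<in> ball 0 1" for z
  proof -
    have "0 \<le> K" using K that norm_ge_zero[of "b z"] order_trans by blast
    then show ?thesis unfolding norm_mult using K L that by (intro mult_mono) auto
  qed
  then show ?thesis using HinfD(1)[OF assms(1)] HinfD(1)[OF assms(2)]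
    by (auto simp: Hinf_def bounded_iff intro!: holomorphic_intros exI[of _ "K * L"])
qed

lemma Hinf_prod:
  assumes "\<And>i. i \<in> I \<Longrightarrow> b i \<in> Hinf" shows "(\<lambda>z. \<Prod>i\<in>I. b i z) \<in> Hinf"
  using assms
proof (induction I rule: infinite_finite_induct)
  case (insert i I)
  then show ?case using Hinf_mult[of "b i" "\<lambda>z. \<Prod>i\<in>I. b i z"] by simp
qed (auto simp: Hinf_def bounded_iff)

lemma boundary_fn_mult:
  assumes "b \<in> Hinf" "c \<in> Hinf"
  shows "AE t in circle_measure. boundary_fn (\<lambda>z. b z * c z) t = boundary_fn b t * boundary_fn c t"
  using fatou(1)[OF assms(1)] fatou(1)[OF assms(2)]
proof eventually_elim
  case (elim t)
  then have "((\<lambda>r. b (of_real r * cis t) * c (of_real r * cis t)) \<longlongrightarrow> boundary_fn b t * boundary_fn c t) (at_left 1)"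
    by (rule tendsto_mult)
  then show ?case unfolding boundary_fn_def[of "\<lambda>z. b z * c z"] by (intro tendsto_Lim) auto
qed

lemma boundary_fn_mult_integrable:
  assumes "b \<in> Hinf" "integrable circle_measure h"
  shows "integrable circle_measure (\<lambda>t. boundary_fn b t * h t)"
proof -
  obtain K where "AE t in circle_measure. norm (boundary_fn b t) \<le> K" by (rule boundary_fn_bounded[OF assms(1)])
  then show ?thesis by (rule integrable_mult_bounded[OF assms(2) boundary_fn_measurable[OF assms(1)]])
qed

lemma measurable_cnj_boundary_fn:
  assumes "b \<in> Hinf"
  shows "(\<lambda>t. cnj (boundary_fn b t)) \<in> borel_measurable circle_measure"
proof -
  have "cnj \<in> borel_measurable borel" by (intro borel_measurable_continuous_onI continuous_intros)
  from measurable_compose[OF boundary_fn_measurable[OF assms] this] show ?thesis .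
qed

lemma boundary_fn_Lp:
  assumes "b \<in> Hinf" "f \<in> Lp p" "0 \<le> p"
  shows "(\<lambda>t. boundary_fn b t * f t) \<in> Lp p" "(\<lambda>t. cnj (boundary_fn b t) * f t) \<in> Lp p"
proof -
  obtain K where K: "AE t in circle_measure. norm (boundary_fn b t) \<le> K" by (rule boundary_fn_bounded[OF assms(1)])
  then show "(\<lambda>t. boundary_fn b t * f t) \<in> Lp p" 
    by (intro Lp_mult_bounded(1)[where K=K] assms boundary_fn_measurable)
  show "(\<lambda>t. cnj (boundary_fn b t) * f t) \<in> Lp p" 
    by (intro Lp_mult_bounded(1)[where K=K] assms measurable_cnj_boundary_fn) (use K in simp)
qed

section \<open>Multiplication by boundary functions in terms of frequencies\<close>

lemma fourier_coeff_cnj: "fourier_coeff (\<lambda>t. cnj (f t)) k = cnj (fourier_coeff f (- k))"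
proof -
  have "(LINT s|circle_measure. cnj (f s) * cis (- of_int k * s)) = (LINT s|circle_measure. cnj (f s * cis (- of_int (- k) * s)))"
    by (simp add: cis_cnj)
  also have "\<dots> = cnj (LINT s|circle_measure. f s * cis (- of_int (- k) * s))" by (rule Bochner_Integration.integral_cnj)
  finally show ?thesis by (simp only: fourier_coeff_def complex_cnj_mult complex_cnj_complex_of_real)
qed

lemma fourier_coeff_shift: "fourier_coeff (\<lambda>t. cis (of_int j * t) * f t) k = fourier_coeff f (k - j)"
proof -
  have "cis (of_int j * t) * f t * cis (- (of_int k) * t) = f t * cis (- (of_int (k - j)) * t)" for t
  proof -
    have "cis (of_int j * t) * f t * cis (- (of_int k) * t) = f t * (cis (of_int j * t) * cis (- (of_int k) * t))" by simp
    also have "cis (of_int j * t) * cis (- (of_int k) * t) = cis (- (of_int (k - j)) * t)"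
      by (simp add: cis_mult algebra_simps)
    finally show ?thesis .
  qed
  then show ?thesis by (simp only: fourier_coeff_def)
qed

text \<open>Multiplication by an analytic function only moves frequencies up, so coefficient
  \<open>k\<close> of the product sees only coefficients of \<open>h\<close> at or below
  \<open>k\<close>. At radius \<open>r < 1\<close> the series of \<open>b\<close> converges
  absolutely; radial limits and dominated convergence do the rest.\<close>

lemma fourier_coeff_boundary_mult_zero:
  assumes b: "b \<in> Hinf" and h: "integrable circle_measure h" and 0: "\<And>j::nat. fourier_coeff h (k - int j) = 0"
  shows "fourier_coeff (\<lambda>t. boundary_fn b t * h t) k = 0"
proof -
  note hb = HinfD(1)[OF b]
  obtain K where K: "\<And>z. z \<in> ball 0 1 \<Longrightarrow> norm (b z) \<le> K" using HinfD(2)[OF b] by blast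
  note [measurable] = borel_measurable_integrable[OF h]
  have c0: "fourier_coeff (\<lambda>t. b (of_real r * cis t) * h t) k = 0" if r: "0 \<le> r" "r < 1" for r
  proof -
    define c where "c j = taylor_coeff b j * of_real r ^ j" for j
    have sc: "summable (\<lambda>j. norm (c j))" unfolding c_def by (rule summable_norm_taylor[OF hb r])
    have b_eq: "b (of_real r * cis t) = (\<Sum>j. c j * cis (of_nat j * t))" for t
      unfolding c_def by (rule holomorphic_circle_series[OF hb r])
    have i: "integrable circle_measure (\<lambda>t. c j * (cis (of_int (int j) * t) * h t))" for j
      using integrable_mult_cis[OF h, of "of_int (int j)"] by (simp add: mult.commute)
    have "fourier_coeff (\<lambda>t. (\<Sum>j<n. c j * cis (of_nat j * t)) * h t) k = 0" for n
    proof -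
      have "(\<Sum>j<n. c j * cis (of_nat j * t)) * h t = (\<Sum>j<n. c j * (cis (of_int (int j) * t) * h t))" for t
        by (simp add: sum_distrib_right mult.assoc)
      then have "fourier_coeff (\<lambda>t. (\<Sum>j<n. c j * cis (of_nat j * t)) * h t) k = (\<Sum>j<n. fourier_coeff (\<lambda>t. c j * (cis (of_int (int j) * t) * h t)) k)"
        using i by (simp only:) (rule fourier_coeff_sum)
      also have "\<dots> = 0" using 0 by (simp only: fourier_coeff_cmult fourier_coeff_shift) simp
      finally show ?thesis .
    qed
    moreover have "(\<lambda>n. fourier_coeff (\<lambda>t. (\<Sum>j<n. c j * cis (of_nat j * t)) * h t) k) \<longlonglongrightarrow> fourier_coeff (\<lambda>t. b (of_real r * cis t) * h t) k"
      unfolding fourier_coeff_def b_eq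
    proof (intro tendsto_mult tendsto_const integral_dominated_convergence[where w="\<lambda>t. (\<Sum>j. norm (c j)) * norm (h t)"])
      have m[measurable]: "(\<lambda>t. \<Sum>j. c j * cis (of_nat j * t)) \<in> borel_measurable circle_measure"
        by (intro continuous_measurable_circle continuous_on_cis_series sc)
      have m2[measurable]: "(\<lambda>t. cis (- of_int k * t)) \<in> borel_measurable circle_measure" by (rule measurable_cis)
      have m3[measurable]: "(\<lambda>t. \<Sum>j<n. c j * cis (of_nat j * t)) \<in> borel_measurable circle_measure" for n
        by (intro continuous_measurable_circle continuous_intros)
      show "(\<lambda>t. (\<Sum>j. c j * cis (of_nat j * t)) * h t * cis (- of_int k * t)) \<in> borel_measurable circle_measure"
        by (intro borel_measurable_times m m2) measurable
      show "(\<lambda>t. (\<Sum>j<n. c j * cis (of_nat j * t)) * h t * cis (- of_int k * t)) \<in> borel_measurable circle_measure" for n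
        by (intro borel_measurable_times m3 m2) measurable
      show "integrable circle_measure (\<lambda>t. (\<Sum>j. norm (c j)) * norm (h t))" using h by simp
      show "AE t in circle_measure. (\<lambda>n. (\<Sum>j<n. c j * cis (of_nat j * t)) * h t * cis (- of_int k * t)) \<longlonglongrightarrow> (\<Sum>j. c j * cis (of_nat j * t)) * h t * cis (- of_int k * t)"
        by (intro AE_I2 tendsto_mult tendsto_const summable_LIMSEQ summable_cis_series sc)
      show "AE t in circle_measure. norm ((\<Sum>j<n. c j * cis (of_nat j * t)) * h t * cis (- of_int k * t)) \<le> (\<Sum>j. norm (c j)) * norm (h t)" for n
      proof (rule AE_I2)
        fix t
        have "norm (\<Sum>j<n. c j * cis (of_nat j * t)) \<le> (\<Sum>j<n. norm (c j))"
          by (rule order_trans[OF norm_sum]) (simp add: norm_mult)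
        also have "\<dots> \<le> (\<Sum>j. norm (c j))" by (rule sum_le_suminf[OF sc]) auto
        finally show "norm ((\<Sum>j<n. c j * cis (of_nat j * t)) * h t * cis (- of_int k * t)) \<le> (\<Sum>j. norm (c j)) * norm (h t)"
          unfolding norm_mult norm_cis mult_1_right by (rule mult_right_mono) simp
      qed
    qed
    ultimately show ?thesis by (simp add: LIMSEQ_const_iff)
  qed
  define r where "r m = 1 - inverse (real (Suc m))" for m
  have r: "0 \<le> r m" "r m < 1" for m by (auto simp: r_def field_simps)
  have "r \<longlonglongrightarrow> 1"
    using tendsto_diff[OF tendsto_const LIMSEQ_inverse_real_of_nat, of 1] by (simp add: r_def[abs_def])
  then have rlim: "filterlim r (at_left 1) sequentially"
    using r by (intro filterlim_atI[THEN filterlim_mono[OF _ order_refl order_refl]] filterlim_at_withinI) (auto simp: eventually_sequentially)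
  have "(\<lambda>m. fourier_coeff (\<lambda>t. b (of_real (r m) * cis t) * h t) k) \<longlonglongrightarrow> fourier_coeff (\<lambda>t. boundary_fn b t * h t) k"
    unfolding fourier_coeff_def
  proof (intro tendsto_mult tendsto_const integral_dominated_convergence[where w="\<lambda>t. K * norm (h t)"])
    have m2[measurable]: "(\<lambda>t. cis (- of_int k * t)) \<in> borel_measurable circle_measure" by (rule measurable_cis)
    have m3[measurable]: "(\<lambda>t. b (of_real (r m) * cis t)) \<in> borel_measurable circle_measure" for m
      by (intro continuous_measurable_circle continuous_on_holomorphic_circle hb r)
    show "(\<lambda>t. boundary_fn b t * h t * cis (- of_int k * t)) \<in> borel_measurable circle_measure"
      by (intro borel_measurable_times boundary_fn_measurable b m2) measurable
    show "(\<lambda>t. b (of_real (r m) * cis t) * h t * cis (- of_int k * t)) \<in> borel_measurable circle_measure" for m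
      by (intro borel_measurable_times m3 m2) measurable
    show "integrable circle_measure (\<lambda>t. K * norm (h t))" using h by simp
    show "AE t in circle_measure. (\<lambda>m. b (of_real (r m) * cis t) * h t * cis (- of_int k * t)) \<longlonglongrightarrow> boundary_fn b t * h t * cis (- of_int k * t)"
      using fatou(1)[OF b]
      by eventually_elim (intro tendsto_mult tendsto_const, rule filterlim_compose[OF _ rlim])
    show "AE t in circle_measure. norm (b (of_real (r m) * cis t) * h t * cis (- of_int k * t)) \<le> K * norm (h t)" for m
    proof (rule AE_I2)
      fix t
      have "norm (b (of_real (r m) * cis t)) \<le> K" using r[of m] by (intro K) (simp add: norm_mult)
      then show "norm (b (of_real (r m) * cis t) * h t * cis (- of_int k * t)) \<le> K * norm (h t)"
        unfolding norm_mult norm_cis mult_1_right by (rule mult_right_mono) simp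
    qed
  qed
  then show ?thesis using c0[OF r] by (simp add: LIMSEQ_const_iff)
qed

lemma fourier_coeff_cnj_boundary_mult_zero:
  assumes b: "b \<in> Hinf" and h: "integrable circle_measure h" and 0: "\<And>j::nat. fourier_coeff h (k + int j) = 0"
  shows "fourier_coeff (\<lambda>t. cnj (boundary_fn b t) * h t) k = 0"
proof -
  have "fourier_coeff (\<lambda>t. boundary_fn b t * cnj (h t)) (- k) = 0"
    using h 0 by (intro fourier_coeff_boundary_mult_zero[OF b]) (auto simp: fourier_coeff_cnj add.commute[of _ k])
  then have "fourier_coeff (\<lambda>t. cnj (boundary_fn b t * cnj (h t))) k = 0"
    by (simp only: fourier_coeff_cnj) simp
  then show ?thesis by simp
qed

text \<open>The choice in \<open>riesz_proj\<close> sees its argument only through the nonnegative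
  coefficients, so this is an equality of functions, not merely almost everywhere. Compositions of
  co-analytic operators can thus be rewritten without tracking null sets.\<close>

lemma riesz_proj_cong:
  assumes "\<And>k. 0 \<le> k \<Longrightarrow> fourier_coeff u k = fourier_coeff v k"
  shows "riesz_proj p u = riesz_proj p v"
  using assms by (simp add: riesz_proj_def cong: conj_cong)

text \<open>The product already lies in \<open>Hp p\<close>, so the projection changes it at most on
  a null set.\<close>

lemma toeplitz_boundary_Hp:
  assumes b: "b \<in> Hinf" and h: "h \<in> Hp p" and p: "1 < p"
  shows "AE t in circle_measure. toeplitz p (boundary_fn b) h t = boundary_fn b t * h t"
proof -
  have hi: "integrable circle_measure h" using Lp_integrable(1)[OF HpD(1)[OF h]] p by simp
  have bh: "(\<lambda>t. boundary_fn b t * h t) \<in> Lp p" using boundary_fn_Lp(1)[OF b HpD(1)[OF h]] p by simp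
  have H: "(\<lambda>t. boundary_fn b t * h t) \<in> Hp p"
    unfolding Hp_def using bh HpD(2)[OF h] by (auto intro!: fourier_coeff_boundary_mult_zero[OF b hi])
  show ?thesis
    unfolding toeplitz_def
    by (rule Hp_fourier_coeff_eq_imp_AE_eq[OF riesz_proj_Hp(1)[OF p bh] H]) 
       (use p fourier_coeff_riesz_proj[OF p bh] in auto)
qed

text \<open>The part removed by the inner projection has only negative frequencies, and a conjugate
  analytic symbol moves them further down, so the outer projection never sees it.\<close>

lemma toeplitz_cnj_mult:
  assumes b: "b \<in> Hinf" and c: "c \<in> Hinf" and f: "f \<in> Lp p" and p: "1 < p"
  shows "toeplitz p (\<lambda>t. cnj (boundary_fn b t)) (toeplitz p (\<lambda>t. cnj (boundary_fn c t)) f) =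
    toeplitz p (\<lambda>t. cnj (boundary_fn (\<lambda>z. c z * b z) t)) f"
proof -
  have p0: "0 \<le> p" "1 \<le> p" using p by auto
  define v where "v t = cnj (boundary_fn c t) * f t" for t
  have v: "v \<in> Lp p" unfolding v_def by (rule boundary_fn_Lp(2)[OF c f p0(1)])
  define g where "g = riesz_proj p v"
  have g: "g \<in> Hp p" "\<And>k. 0 \<le> k \<Longrightarrow> fourier_coeff g k = fourier_coeff v k"
    using riesz_proj_Hp[OF p v] fourier_coeff_riesz_proj[OF p v] by (auto simp: g_def)
  have i: "integrable circle_measure g" "integrable circle_measure v"
    using Lp_integrable(1) g(1) v p0 HpD by blast+
  have bg: "integrable circle_measure (\<lambda>t. cnj (boundary_fn b t) * g t)" "integrable circle_measure (\<lambda>t. cnj (boundary_fn b t) * v t)"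
    using boundary_fn_Lp(2)[OF b _ p0(1)] HpD(1)[OF g(1)] v Lp_integrable(1) p0 by blast+
  have "fourier_coeff (\<lambda>t. cnj (boundary_fn b t) * g t) k = fourier_coeff (\<lambda>t. cnj (boundary_fn (\<lambda>z. c z * b z) t) * f t) k" if k: "0 \<le> k" for k
  proof -
    have "fourier_coeff (\<lambda>t. cnj (boundary_fn b t) * (g t - v t)) k = 0"
      by (rule fourier_coeff_cnj_boundary_mult_zero[OF b]) (use i g k in \<open>auto simp: fourier_coeff_diff\<close>)
    then have "fourier_coeff (\<lambda>t. cnj (boundary_fn b t) * g t) k = fourier_coeff (\<lambda>t. cnj (boundary_fn b t) * v t) k"
      unfolding right_diff_distrib by (subst (asm) fourier_coeff_diff[OF bg]) simp
    also have "\<dots> = fourier_coeff (\<lambda>t. cnj (boundary_fn (\<lambda>z. c z * b z) t) * f t) k"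
    proof (rule fourier_coeff_AE_cong)
      show "(\<lambda>t. cnj (boundary_fn b t) * v t) \<in> borel_measurable circle_measure" using bg(2) by auto
      show "AE t in circle_measure. cnj (boundary_fn b t) * v t = cnj (boundary_fn (\<lambda>z. c z * b z) t) * f t"
        using boundary_fn_mult[OF c b] by eventually_elim (simp add: v_def)
    qed
    finally show ?thesis .
  qed
  then show ?thesis
    unfolding toeplitz_def v_def[symmetric] g_def[symmetric] by (rule riesz_proj_cong)
qed

section \<open>Strong limits and Harnack's inequality\<close>

lemma Hp_polynomial_bound:
  assumes w: "w \<in> Hp p" and p: "1 \<le> p" and m: "\<And>k. int m < k \<Longrightarrow> fourier_coeff w k = 0"
  shows "p_int p w \<le> 2 * pi * (\<Sum>k<Suc m. norm (fourier_coeff w (int k))) powr p"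
proof -
  let ?q = "\<lambda>t. \<Sum>k<Suc m. fourier_coeff w (int k) * cis (of_nat k * t)"
  have cq: "continuous_on {0..2*pi} ?q" by (intro continuous_intros)
  have "AE t in circle_measure. w t = ?q t"
  proof (rule fourier_coeff_eq_imp_AE_eq)
    show "integrable circle_measure w" using Lp_integrable(1)[OF HpD(1)[OF w] p] .
    show "integrable circle_measure ?q" by (rule integrable_circle_continuous[OF cq])
    show "fourier_coeff w k = fourier_coeff ?q k" for k
      unfolding fourier_coeff_cis_sum using HpD(2)[OF w, of k] m[of k] by auto
  qed
  then have "p_int p w = p_int p ?q"
    by (rule p_int_AE_cong[OF LpD(1)[OF HpD(1)[OF w]]])
  also have "\<dots> \<le> (LINT t|circle_measure. (\<Sum>k<Suc m. norm (fourier_coeff w (int k))) powr p)"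
    unfolding p_int_def
  proof (rule integral_mono)
    show "integrable circle_measure (\<lambda>t. norm (?q t) powr p)" by (rule LpD(2)[OF Lp_continuous[OF cq]]) (use p in simp)
    show "norm (?q t) powr p \<le> (\<Sum>k<Suc m. norm (fourier_coeff w (int k))) powr p" for t
      using p by (intro powr_mono2 order_trans[OF norm_sum] sum_mono) (auto simp: norm_mult)
  qed auto
  finally show ?thesis by simp
qed

text \<open>The coefficients are Fourier coefficients on the circle of radius 1/2, up to the fixed
  factor \<open>2 ^ k\<close>.\<close>

lemma taylor_coeff_tendsto:
  assumes C: "\<And>n. C n holomorphic_on ball 0 1" and B: "B holomorphic_on ball 0 1"
    and lim: "\<And>K. compact K \<Longrightarrow> K \<subseteq> ball 0 1 \<Longrightarrow> uniform_limit K C B sequentially"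
  shows "(\<lambda>n. taylor_coeff (C n) k) \<longlonglongrightarrow> taylor_coeff B k"
proof -
  have r: "(0::real) \<le> 1/2" "(1/2::real) < 1" by auto
  have "uniform_limit (cball 0 (1/2)) C B sequentially" by (rule lim) auto
  then have "uniform_limit {0..2*pi} (\<lambda>n t. C n (of_real (1/2) * cis t)) (\<lambda>t. B (of_real (1/2) * cis t)) sequentially"
    unfolding uniform_limit_iff
  proof (intro allI impI)
    fix e :: real
    assume *: "\<forall>e>0. \<forall>\<^sub>F n in sequentially. \<forall>x\<in>cball 0 (1/2). dist (C n x) (B x) < e" and "0 < e"
    then have "\<forall>\<^sub>F n in sequentially. \<forall>x\<in>cball 0 (1/2). dist (C n x) (B x) < e" by blast
    then show "\<forall>\<^sub>F n in sequentially. \<forall>t\<in>{0..2*pi}. dist (C n (of_real (1/2) * cis t)) (B (of_real (1/2) * cis t)) < e"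
      by eventually_elim (simp add: norm_mult)
  qed
  then have "(\<lambda>n. fourier_coeff (\<lambda>t. C n (of_real (1/2) * cis t)) (int k)) \<longlonglongrightarrow> fourier_coeff (\<lambda>t. B (of_real (1/2) * cis t)) (int k)"
    by (intro fourier_coeff_uniform_limit continuous_on_holomorphic_circle C r)
  then have "(\<lambda>n. taylor_coeff (C n) k * of_real (1/2) ^ k) \<longlonglongrightarrow> taylor_coeff B k * of_real (1/2) ^ k"
    by (simp only: fourier_coeff_holomorphic_circle[OF C r] fourier_coeff_holomorphic_circle[OF B r]) simp
  from tendsto_mult[OF this tendsto_const[of "2 ^ k"]] show ?thesis
    by (simp add: power_divide)
qed

text \<open>Each \<open>D n\<close> has no positive frequencies and \<open>q\<close> none above
  \<open>m\<close>, so the projected products have frequencies in \<open>0..m\<close> only. Weak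
  convergence of the \<open>D n\<close> thus becomes convergence of boundedly many
  coefficients.\<close>

lemma riesz_proj_tendsto_trig:
  assumes D: "\<And>n. D n \<in> borel_measurable circle_measure" "\<And>n. AE t in circle_measure. norm (D n t) \<le> K"
    and neg: "\<And>n k. 0 < k \<Longrightarrow> fourier_coeff (D n) k = 0"
    and lim: "\<And>k. (\<lambda>n. fourier_coeff (D n) k) \<longlonglongrightarrow> 0"
    and q: "trig q" and p: "1 < p"
  shows "(\<lambda>n. p_int p (riesz_proj p (\<lambda>t. D n t * q t))) \<longlonglongrightarrow> 0"
proof -
  have p0: "0 < p" "0 \<le> p" "1 \<le> p" using p by auto
  obtain S where S: "finite S" "\<And>k. k \<notin> S \<Longrightarrow> fourier_coeff q k = 0"
    and q_eq: "q = (\<lambda>t. \<Sum>k\<in>S. fourier_coeff q k * cis (of_int k * t))"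
    using trig_fourier_expansion[OF q] by blast
  obtain m :: nat where m: "\<And>k. k \<in> S \<Longrightarrow> k \<le> int m"
  proof -
    obtain M where "\<And>k. k \<in> S \<Longrightarrow> k \<le> M" using bdd_above_finite[OF S(1)] by (auto simp: bdd_above_def)
    then show ?thesis using that[of "nat M"] by force
  qed
  have Di: "integrable circle_measure (D n)" for n by (rule integrable_circle_bounded[OF D])
  have coeff: "fourier_coeff (\<lambda>t. D n t * q t) k = (\<Sum>j\<in>S. fourier_coeff q j * fourier_coeff (D n) (k - j))" for n k
  proof -
    have "D n t * q t = (\<Sum>j\<in>S. fourier_coeff q j * (cis (of_int j * t) * D n t))" for t
      by (subst q_eq) (simp add: sum_distrib_left mult_ac)
    then have "fourier_coeff (\<lambda>t. D n t * q t) k = fourier_coeff (\<lambda>t. \<Sum>j\<in>S. fourier_coeff q j * (cis (of_int j * t) * D n t)) k"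
      by simp
    also have "\<dots> = (\<Sum>j\<in>S. fourier_coeff (\<lambda>t. fourier_coeff q j * (cis (of_int j * t) * D n t)) k)"
      by (intro fourier_coeff_sum integrable_mult_right, subst mult.commute, rule integrable_mult_cis[OF Di])
    finally show ?thesis by (simp only: fourier_coeff_cmult fourier_coeff_shift)
  qed
  have L: "(\<lambda>t. D n t * q t) \<in> Lp p" for n
    by (rule Lp_mult_bounded(1)[OF Lp_trig[OF q p0(2)] D p0(2)])
  define w where "w n = riesz_proj p (\<lambda>t. D n t * q t)" for n
  have w: "w n \<in> Hp p" and wc: "\<And>k. 0 \<le> k \<Longrightarrow> fourier_coeff (w n) k = (\<Sum>j\<in>S. fourier_coeff q j * fourier_coeff (D n) (k - j))" for n
    unfolding w_def using riesz_proj_Hp[OF p L] coeff by auto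
  have le: "p_int p (w n) \<le> 2 * pi * (\<Sum>k<Suc m. norm (fourier_coeff (w n) (int k))) powr p" for n
  proof (rule Hp_polynomial_bound[OF w p0(3)])
    fix k assume "int m < k"
    then show "fourier_coeff (w n) k = 0"
      using m by (subst wc) (auto intro!: sum.neutral neg dest!: m)
  qed
  have bound_lim: "(\<lambda>n. 2 * pi * (\<Sum>k<Suc m. norm (fourier_coeff (w n) (int k))) powr p) \<longlonglongrightarrow> 0"
  proof -
    have "(\<lambda>n. fourier_coeff (w n) (int k)) \<longlonglongrightarrow> 0" for k
    proof -
      have "(\<lambda>n. \<Sum>j\<in>S. fourier_coeff q j * fourier_coeff (D n) (int k - j)) \<longlonglongrightarrow> (\<Sum>j\<in>S. fourier_coeff q j * 0)"
        by (intro tendsto_intros lim)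
      then show ?thesis by (simp add: wc)
    qed
    then have "(\<lambda>n. \<Sum>k<Suc m. norm (fourier_coeff (w n) (int k))) \<longlonglongrightarrow> (\<Sum>k<Suc m. norm (0::complex))"
      by (intro tendsto_intros)
    then have "(\<lambda>n. \<Sum>k<Suc m. norm (fourier_coeff (w n) (int k))) \<longlonglongrightarrow> 0" by (simp del: sum.lessThan_Suc)
    then have "(\<lambda>n. (\<Sum>k<Suc m. norm (fourier_coeff (w n) (int k))) powr p) \<longlonglongrightarrow> 0"
      using p0 by (intro tendsto_zero_powrI[OF _ tendsto_const]) (auto intro!: always_eventually sum_nonneg simp del: sum.lessThan_Suc)
    from tendsto_mult[OF tendsto_const[of "2*pi"] this] show ?thesis by (simp del: sum.lessThan_Suc)
  qed
  have "(\<lambda>n. p_int p (w n)) \<longlonglongrightarrow> 0"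
    by (rule tendsto_sandwich[OF _ _ tendsto_const bound_lim]; intro always_eventually allI le p_int_nonneg)
  then show ?thesis by (simp add: w_def)
qed

text \<open>Moves the base point of the estimate from \<open>w\<close> to the origin.\<close>

lemma harnack:
  assumes u: "integrable circle_measure u" "AE t in circle_measure. 0 \<le> Re (u t)" 
    "\<And>k. k < 0 \<Longrightarrow> fourier_coeff u k = 0" and w: "norm w < 1"
  shows "(1 - norm w) / (1 + norm w) * Re (fourier_coeff u 0) \<le> Re (cauchy_int u w)"
proof -
  let ?f = "\<lambda>s. Re (u s)"
  have fi: "integrable circle_measure ?f" using u(1) by (rule integrable_Re)
  have ucnj: "integrable circle_measure (\<lambda>s. cnj (u s))" using u(1) by simp
  \<comment> \<open>Among the nonnegative frequencies of \<open>cnj u\<close> only the constant one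
    survives, so its Cauchy integral is constant. Hence the Poisson integral of \<open>Re u\<close>
    is the real part of \<open>cauchy_int u\<close>.\<close>
  have cnj: "cauchy_int (\<lambda>s. cnj (u s)) z = cnj (fourier_coeff u 0)" if "norm z < 1" for z
  proof -
    have "fourier_coeff (\<lambda>s. cnj (u s)) (int k) * z ^ k = (if k = 0 then cnj (fourier_coeff u 0) else 0)" for k
      using u(3)[of "- int k"] by (auto simp: fourier_coeff_cnj)
    then have "(\<lambda>k. if k = 0 then cnj (fourier_coeff u 0) else 0) sums cauchy_int (\<lambda>s. cnj (u s)) z"
      using cauchy_int_sums[OF ucnj that] by simp
    then show ?thesis using sums_single[of 0 "\<lambda>_. cnj (fourier_coeff u 0)"] sums_unique2 by fastforce
  qed
  have f_eq: "complex_of_real (?f s) = (1/2) * u s + (1/2) * cnj (u s)" for s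
    by (simp add: complex_eq_iff)
  have ci: "cauchy_int (\<lambda>s. complex_of_real (?f s)) z = (1/2) * cauchy_int u z + (1/2) * cnj (fourier_coeff u 0)" if "norm z < 1" for z
    unfolding f_eq cauchy_int_linear[OF u(1) ucnj that] cnj[OF that] ..
  have "(1 - norm w) / (1 + norm w) * (LINT s|circle_measure. ?f s) = (LINT s|circle_measure. (1 - norm w) / (1 + norm w) * ?f s)"
    by simp
  also have "\<dots> \<le> (LINT s|circle_measure. poisson_kernel w s * ?f s)"
  proof (rule integral_mono_AE)
    show "AE s in circle_measure. (1 - norm w) / (1 + norm w) * ?f s \<le> poisson_kernel w s * ?f s"
      using u(2) by eventually_elim (intro mult_right_mono poisson_kernel_ge w)
  qed (use fi poisson_integral_Re(2)[OF fi w] in auto)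
  also have "\<dots> = 2 * pi * Re (2 * cauchy_int (\<lambda>s. complex_of_real (?f s)) w - cauchy_int (\<lambda>s. complex_of_real (?f s)) 0)"
    using poisson_integral_Re(1)[OF fi w] by (simp add: field_simps)
  also have "2 * cauchy_int (\<lambda>s. complex_of_real (?f s)) w - cauchy_int (\<lambda>s. complex_of_real (?f s)) 0 = 
    cauchy_int u w + (cnj (fourier_coeff u 0) - fourier_coeff u 0) / 2"
    using w by (simp add: ci cauchy_int_0[of u] field_simps)
  also have "Re \<dots> = Re (cauchy_int u w)" by simp
  finally have 1: "(1 - norm w) / (1 + norm w) * (LINT s|circle_measure. ?f s) \<le> 2 * pi * Re (cauchy_int u w)" .
  have "2 * pi * Re (fourier_coeff u 0) = (LINT s|circle_measure. ?f s)"
    using integral_Re[OF u(1)] by (simp add: fourier_coeff_def)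
  then have "2 * pi * ((1 - norm w) / (1 + norm w) * Re (fourier_coeff u 0)) \<le> 2 * pi * Re (cauchy_int u w)"
    using 1 by (simp only: mult.left_commute[of "2 * pi"])
  then show ?thesis by (rule mult_left_le_imp_le) simp
qed

text \<open>Turns closeness to 1 at one interior point into closeness on the circle: Harnack's
  inequality compares the mean of \<open>Re (1 - D)\<close> with its value at \<open>w\<close>, and
  \<open>4 * pi\<close> is twice the total mass of the circle.\<close>

lemma boundary_fn_distance_1:
  assumes D: "D \<in> Hinf" "\<And>z. z \<in> ball 0 1 \<Longrightarrow> norm (D z) \<le> 1" and w: "norm w < 1"
  shows "p_int 2 (\<lambda>t. 1 - boundary_fn D t) \<le> 4 * pi * ((1 + norm w) / (1 - norm w)) * norm (1 - D w)"
proof -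
  have bd: "AE t in circle_measure. norm (boundary_fn D t) \<le> 1"
    by (rule boundary_fn_bound[OF D(1)]) (rule D(2))
  define u where "u t = 1 - boundary_fn D t" for t
  have iD: "integrable circle_measure (boundary_fn D)"
    by (rule integrable_circle_bounded[OF boundary_fn_measurable[OF D(1)] bd])
  have ui: "integrable circle_measure u" unfolding u_def using iD by simp
  have uc: "fourier_coeff u k = (if k = 0 then 1 else 0) - fourier_coeff (boundary_fn D) k" for k
    unfolding u_def using iD fourier_coeff_cis[of 0 k] by (subst fourier_coeff_diff) auto
  have uL: "u \<in> Lp 2"
  proof (rule Lp_bounded)
    show "AE t in circle_measure. norm (u t) \<le> 2"
      using bd
    proof eventually_elim
      case (elim t)
      then show ?case using norm_triangle_ineq4[of 1 "boundary_fn D t"] by (simp add: u_def)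
    qed
  qed (use ui in auto)
  have Re0: "AE t in circle_measure. 0 \<le> Re (u t)"
    using bd
  proof eventually_elim
    case (elim t)
    then show ?case using complex_Re_le_cmod[of "boundary_fn D t"] by (simp add: u_def)
  qed
  have "p_int 2 u \<le> (LINT t|circle_measure. 2 * Re (u t))"
    unfolding p_int_def
  proof (rule integral_mono_AE)
    show "AE t in circle_measure. norm (u t) powr 2 \<le> 2 * Re (u t)"
      using bd
    proof eventually_elim
      case (elim t)
      let ?d = "boundary_fn D t"
      have "(norm (u t))\<^sup>2 = 1 - 2 * Re ?d + (norm ?d)\<^sup>2"
        unfolding u_def cmod_power2 by (simp add: power2_eq_square algebra_simps)
      moreover have "(norm ?d)\<^sup>2 \<le> 1" using elim by (simp add: power_le_one)
      ultimately show ?case by (simp add: powr_numeral u_def)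
    qed
  qed (use ui uL in \<open>auto dest: LpD\<close>)
  also have "\<dots> = 2 * (2 * pi * Re (fourier_coeff u 0))"
    using integral_Re[OF ui] ui by (simp add: fourier_coeff_def)
  finally have 1: "p_int 2 u \<le> 4 * pi * Re (fourier_coeff u 0)" by simp
  have "(1 - norm w) / (1 + norm w) * Re (fourier_coeff u 0) \<le> Re (cauchy_int u w)"
    by (rule harnack[OF ui Re0 _ w]) (simp add: uc fourier_coeff_boundary_fn[OF D(1)])
  also have "cauchy_int u w = 1 - D w"
  proof -
    have "(\<lambda>k. fourier_coeff u (int k) * w ^ k) sums cauchy_int u w" by (rule cauchy_int_sums[OF ui w])
    moreover have "(\<lambda>k. fourier_coeff u (int k) * w ^ k) = (\<lambda>k. (if k = 0 then 1 else 0) - taylor_coeff D k * w ^ k)"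
      by (auto simp: uc fourier_coeff_boundary_fn[OF D(1)] fun_eq_iff)
    moreover have "(\<lambda>k. (if k = 0 then 1 else 0) - taylor_coeff D k * w ^ k) sums (1 - D w)"
      using sums_single[of 0 "\<lambda>_. 1::complex"] by (intro sums_diff taylor_sums[OF HinfD(1)[OF D(1)] w]) simp
    ultimately show ?thesis using sums_unique2 by metis
  qed
  also have "Re (1 - D w) \<le> norm (1 - D w)" by (rule complex_Re_le_cmod)
  finally have "(1 - norm w) / (1 + norm w) * Re (fourier_coeff u 0) \<le> norm (1 - D w)" .
  then have "((1 + norm w) / (1 - norm w)) * ((1 - norm w) / (1 + norm w) * Re (fourier_coeff u 0)) \<le> ((1 + norm w) / (1 - norm w)) * norm (1 - D w)"
    by (rule mult_left_mono) (use w in auto)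
  moreover have "((1 + norm w) / (1 - norm w)) * ((1 - norm w) / (1 + norm w)) = 1"
  proof -
    have "1 - norm w \<noteq> 0" "1 + norm w \<noteq> 0" using w norm_ge_zero[of w] by linarith+
    then show ?thesis by simp
  qed
  ultimately have "Re (fourier_coeff u 0) \<le> ((1 + norm w) / (1 - norm w)) * norm (1 - D w)"
    by (simp only: mult.assoc[symmetric] mult_1_left)
  then have "4 * pi * Re (fourier_coeff u 0) \<le> 4 * pi * (((1 + norm w) / (1 - norm w)) * norm (1 - D w))"
    by (rule mult_left_mono) simp
  with 1 show ?thesis unfolding u_def by (simp add: mult.assoc)
qed

section \<open>The expansion\<close>

text \<open>The form in which density arguments end: a part proportional to \<open>e\<close>, with
  \<open>c\<close> fixed beforehand, and a part that vanishes in the limit for each fixed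
  \<open>e\<close>.\<close>

lemma LIMSEQ_0_by_approx:
  fixes x :: "nat \<Rightarrow> real"
  assumes "\<And>n. 0 \<le> x n" "0 \<le> c"
    and "\<And>e. 0 < e \<Longrightarrow> \<exists>y. y \<longlonglongrightarrow> 0 \<and> (\<forall>n. x n \<le> c * e + y n)"
  shows "x \<longlonglongrightarrow> 0"
proof (rule LIMSEQ_I)
  fix e :: real assume e: "0 < e"
  define d where "d = e / (2 * (c + 1))"
  have d: "0 < d" using e assms(2) by (simp add: d_def)
  have "c * d \<le> (c + 1) * d" using d by (intro mult_right_mono) auto
  also have "(c + 1) * d = e / 2" using assms(2) by (simp add: d_def divide_simps)
  finally have cd: "c * d \<le> e / 2" .
  obtain y where y: "y \<longlonglongrightarrow> 0" "\<And>n. x n \<le> c * d + y n" using assms(3)[OF d] by blast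
  have "eventually (\<lambda>n. y n < e / 2) sequentially" using order_tendstoD(2)[OF y(1), of "e/2"] e by simp
  then obtain N where N: "\<And>n. n \<ge> N \<Longrightarrow> y n < e / 2" by (auto simp: eventually_sequentially)
  show "\<exists>N. \<forall>n\<ge>N. norm (x n - 0) < e"
  proof (intro exI allI impI)
    fix n assume "N \<le> n"
    then show "norm (x n - 0) < e" using N[of n] y(2)[of n] cd assms(1)[of n] by simp
  qed
qed

lemma toeplitz_cnj_tendsto:
  fixes C :: "nat \<Rightarrow> complex \<Rightarrow> complex"
  assumes p: "1 < p" and f: "f \<in> Lp p"
    and C: "\<And>n. C n \<in> Hinf" "\<And>n z. z \<in> ball 0 1 \<Longrightarrow> norm (C n z) \<le> 1"
    and B: "B \<in> Hinf" "\<And>z. z \<in> ball 0 1 \<Longrightarrow> norm (B z) \<le> 1"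
    and lim: "\<And>K. compact K \<Longrightarrow> K \<subseteq> ball 0 1 \<Longrightarrow> uniform_limit K C B sequentially"
  shows "(\<lambda>n. p_int p (\<lambda>t. toeplitz p (\<lambda>s. cnj (boundary_fn (C n) s)) f t - toeplitz p (\<lambda>s. cnj (boundary_fn B s)) f t)) \<longlonglongrightarrow> 0"
proof -
  have p0: "0 < p" "0 \<le> p" "1 \<le> p" using p by auto
  \<comment> \<open>The conjugate difference of the symbols has no positive frequencies, and its
    other coefficients are conjugate differences of Taylor coefficients, so they tend to 0.\<close>
  define D where "D n t = cnj (boundary_fn (C n) t - boundary_fn B t)" for n t
  have mC: "(\<lambda>t. cnj (boundary_fn (C n) t)) \<in> borel_measurable circle_measure" for n
    by (rule measurable_cnj_boundary_fn[OF C(1)])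
  have mB: "(\<lambda>t. cnj (boundary_fn B t)) \<in> borel_measurable circle_measure"
    by (rule measurable_cnj_boundary_fn[OF B(1)])
  have bC: "AE t in circle_measure. norm (cnj (boundary_fn (C n) t)) \<le> 1" for n
    unfolding complex_mod_cnj by (rule boundary_fn_bound[OF C(1)]) (rule C(2))
  have bB: "AE t in circle_measure. norm (cnj (boundary_fn B t)) \<le> 1"
    unfolding complex_mod_cnj by (rule boundary_fn_bound[OF B(1)]) (rule B(2))
  have mD: "D n \<in> borel_measurable circle_measure" for n
    unfolding D_def complex_cnj_diff by (intro borel_measurable_diff mC mB)
  have bD: "AE t in circle_measure. norm (D n t) \<le> 2" for n
    using bC[of n] bB
  proof eventually_elim
    case (elim t)
    then show ?case using norm_triangle_ineq4[of "boundary_fn (C n) t" "boundary_fn B t"] by (simp add: D_def del: complex_cnj_diff)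
  qed
  have iCB: "integrable circle_measure (\<lambda>t. cnj (boundary_fn (C n) t))" "integrable circle_measure (\<lambda>t. cnj (boundary_fn B t))" for n
    by (rule integrable_circle_bounded[OF mC bC] integrable_circle_bounded[OF mB bB])+
  have Dc: "fourier_coeff (D n) k = cnj (fourier_coeff (boundary_fn (C n)) (- k)) - cnj (fourier_coeff (boundary_fn B) (- k))" for n k
    unfolding D_def complex_cnj_diff fourier_coeff_diff[OF iCB] fourier_coeff_cnj ..
  have Dneg: "fourier_coeff (D n) k = 0" if "0 < k" for n k
    using that by (simp add: Dc fourier_coeff_boundary_fn C B)
  have Dlim: "(\<lambda>n. fourier_coeff (D n) k) \<longlonglongrightarrow> 0" for k
  proof (cases "0 \<le> - k")
    case True
    have "(\<lambda>n. cnj (taylor_coeff (C n) (nat (- k))) - cnj (taylor_coeff B (nat (- k)))) \<longlonglongrightarrow> 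
       cnj (taylor_coeff B (nat (- k))) - cnj (taylor_coeff B (nat (- k)))"
      by (intro tendsto_intros taylor_coeff_tendsto HinfD(1) C(1) B(1) lim)
    then show ?thesis using True by (simp add: Dc fourier_coeff_boundary_fn C B)
  qed (simp add: Dneg)
  \<comment> \<open>Only the coefficients of \<open>T n\<close> are identified with those of
    \<open>D n * f\<close>; \<open>riesz_bound\<close> then treats it as a projection of that
    product.\<close>
  define T where "T n t = toeplitz p (\<lambda>s. cnj (boundary_fn (C n) s)) f t - toeplitz p (\<lambda>s. cnj (boundary_fn B s)) f t" for n t
  have LC: "(\<lambda>t. cnj (boundary_fn (C n) t) * f t) \<in> Lp p" for n by (rule boundary_fn_Lp(2)[OF C(1) f p0(2)])
  have LB: "(\<lambda>t. cnj (boundary_fn B t) * f t) \<in> Lp p" by (rule boundary_fn_Lp(2)[OF B(1) f p0(2)])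
  have T: "T n \<in> Hp p" and Tc: "\<And>k. 0 \<le> k \<Longrightarrow> fourier_coeff (T n) k = fourier_coeff (\<lambda>t. D n t * f t) k" for n
  proof -
    let ?x = "riesz_proj p (\<lambda>t. cnj (boundary_fn (C n) t) * f t)" and ?y = "riesz_proj p (\<lambda>t. cnj (boundary_fn B t) * f t)"
    have x: "?x \<in> Hp p" and y: "?y \<in> Hp p" using riesz_proj_Hp(1)[OF p] LC LB by auto
    have T_eq: "T n = (\<lambda>t. ?x t - ?y t)" by (simp add: T_def toeplitz_def fun_eq_iff)
    have xi: "integrable circle_measure ?x" "integrable circle_measure ?y"
      using Lp_integrable(1)[OF HpD(1)] x y p0 by auto
    have Tk: "fourier_coeff (T n) k = fourier_coeff ?x k - fourier_coeff ?y k" for k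
      unfolding T_eq by (rule fourier_coeff_diff[OF xi])
    show "T n \<in> Hp p"
      unfolding Hp_def using Lp_diff(1)[OF HpD(1)[OF x] HpD(1)[OF y] p0(2)] HpD(2)[OF x] HpD(2)[OF y]
      by (simp add: Tk) (simp add: T_eq)
    fix k :: int assume k: "0 \<le> k"
    have "(\<lambda>t. D n t * f t) = (\<lambda>t. cnj (boundary_fn (C n) t) * f t - cnj (boundary_fn B t) * f t)"
      by (simp add: D_def algebra_simps)
    then have "fourier_coeff (\<lambda>t. D n t * f t) k = fourier_coeff (\<lambda>t. cnj (boundary_fn (C n) t) * f t) k - fourier_coeff (\<lambda>t. cnj (boundary_fn B t) * f t) k"
      using fourier_coeff_diff[OF Lp_integrable(1)[OF LC p0(3)] Lp_integrable(1)[OF LB p0(3)]] by simp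
    then show "fourier_coeff (T n) k = fourier_coeff (\<lambda>t. D n t * f t) k"
      unfolding Tk using fourier_coeff_riesz_proj[OF p LC k] fourier_coeff_riesz_proj[OF p LB k] by simp
  qed
  obtain R where R: "0 \<le> R" "\<And>u v. u \<in> Hp p \<Longrightarrow> v \<in> Lp p \<Longrightarrow> (\<And>k. 0 \<le> k \<Longrightarrow> fourier_coeff u k = fourier_coeff v k)
     \<Longrightarrow> p_int p u \<le> R * p_int p v"
    using riesz_bound[OF p] by blast
  have "(\<lambda>n. p_int p (T n)) \<longlonglongrightarrow> 0"
  \<comment> \<open>The constant is uniform in \<open>n\<close>: \<open>R\<close> bounds the
    projection, one factor \<open>2 powr p\<close> comes from \<open>norm (D n t) \<le> 2\<close>
    and the other from the triangle inequality.\<close>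
  proof (rule LIMSEQ_0_by_approx[where c="2 powr p * (R * 2 powr p)"])
    fix e :: real assume e: "0 < e"
    obtain q where q: "trig q" "p_int p (\<lambda>t. f t - q t) < e" by (rule trig_dense_Lp[OF f p0(1) e])
    have Dq: "(\<lambda>t. D n t * q t) \<in> Lp p" for n by (rule Lp_mult_bounded(1)[OF Lp_trig[OF q(1) p0(2)] mD bD p0(2)])
    have Df: "(\<lambda>t. D n t * f t) \<in> Lp p" for n by (rule Lp_mult_bounded(1)[OF f mD bD p0(2)])
    have fq: "(\<lambda>t. f t - q t) \<in> Lp p" by (rule Lp_diff(1)[OF f Lp_trig[OF q(1) p0(2)] p0(2)])
    define w where "w n = riesz_proj p (\<lambda>t. D n t * q t)" for n
    have w: "w n \<in> Hp p" and wc: "\<And>k. 0 \<le> k \<Longrightarrow> fourier_coeff (w n) k = fourier_coeff (\<lambda>t. D n t * q t) k" for n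
      unfolding w_def using riesz_proj_Hp[OF p Dq] by auto
    have wlim: "(\<lambda>n. p_int p (w n)) \<longlonglongrightarrow> 0"
      unfolding w_def by (rule riesz_proj_tendsto_trig[OF mD bD Dneg Dlim q(1) p])
    have le: "p_int p (T n) \<le> 2 powr p * (R * 2 powr p) * e + 2 powr p * p_int p (w n)" for n
    proof -
      have i: "integrable circle_measure (T n)" "integrable circle_measure (w n)"
        "integrable circle_measure (\<lambda>t. D n t * f t)" "integrable circle_measure (\<lambda>t. D n t * q t)"
        using Lp_integrable(1)[OF _ p0(3)] HpD(1) T w Df Dq by blast+
      have d: "(\<lambda>t. T n t - w n t) \<in> Hp p"
        unfolding Hp_def using Lp_diff(1)[OF HpD(1)[OF T] HpD(1)[OF w] p0(2)] HpD(2)[OF T] HpD(2)[OF w]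
        by (simp add: fourier_coeff_diff[OF i(1,2)])
      have "p_int p (\<lambda>t. T n t - w n t) \<le> R * p_int p (\<lambda>t. D n t * (f t - q t))"
      proof (rule R(2)[OF d])
        show "(\<lambda>t. D n t * (f t - q t)) \<in> Lp p" by (rule Lp_mult_bounded(1)[OF fq mD bD p0(2)])
        fix k :: int assume "0 \<le> k"
        then show "fourier_coeff (\<lambda>t. T n t - w n t) k = fourier_coeff (\<lambda>t. D n t * (f t - q t)) k"
          unfolding right_diff_distrib fourier_coeff_diff[OF i(1,2)] fourier_coeff_diff[OF i(3,4)] by (simp add: Tc wc)
      qed
      also have "\<dots> \<le> R * (2 powr p * p_int p (\<lambda>t. f t - q t))"
        by (intro mult_left_mono p_int_mult_bounded[OF fq mD bD p0(2)] R(1))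
      also have "\<dots> \<le> R * (2 powr p * e)"
        using q(2) R(1) by (intro mult_left_mono) auto
      finally have 1: "p_int p (\<lambda>t. T n t - w n t) \<le> R * (2 powr p * e)" .
      have "p_int p (\<lambda>t. (T n t - w n t) + w n t) \<le> 2 powr p * (p_int p (\<lambda>t. T n t - w n t) + p_int p (w n))"
        by (rule p_int_add_le[OF HpD(1)[OF d] HpD(1)[OF w] p0(2)])
      also have "\<dots> \<le> 2 powr p * (R * (2 powr p * e) + p_int p (w n))"
        using 1 by (intro mult_left_mono add_right_mono) auto
      finally show ?thesis by (simp add: algebra_simps)
    qed
    have "(\<lambda>n. 2 powr p * p_int p (w n)) \<longlonglongrightarrow> 2 powr p * 0" by (intro tendsto_intros wlim)
    then show "\<exists>y. y \<longlonglongrightarrow> 0 \<and> (\<forall>n. p_int p (T n) \<le> 2 powr p * (R * 2 powr p) * e + y n)"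
      using le by (intro exI[of _ "\<lambda>n. 2 powr p * p_int p (w n)"]) simp
  qed (use R(1) in auto)
  then show ?thesis by (simp add: T_def[abs_def])
qed

text \<open>For \<open>D n\<close> bounded by 2, L^2 convergence gives L^1 convergence and then
  convergence in \<open>p_int p\<close>, as
  \<open>norm (D n) powr p \<le> 2 powr (p - 1) * norm (D n)\<close>. The factor \<open>g\<close>
  may be unbounded, so it is first replaced by a trigonometric polynomial.\<close>

lemma p_int_mult_tendsto_0:
  assumes D: "\<And>n. D n \<in> borel_measurable circle_measure" "\<And>n. AE t in circle_measure. norm (D n t) \<le> 2"
    and lim: "(\<lambda>n. p_int 2 (D n)) \<longlonglongrightarrow> 0" and g: "g \<in> Lp p" and p: "1 < p"
  shows "(\<lambda>n. p_int p (\<lambda>t. D n t * g t)) \<longlonglongrightarrow> 0"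
proof -
  have p0: "0 < p" "0 \<le> p" "1 \<le> p" using p by auto
  have DL: "D n \<in> Lp r" if "0 \<le> r" for n r by (rule Lp_bounded[OF D that])
  have L1: "(\<lambda>n. LINT t|circle_measure. norm (D n t)) \<longlonglongrightarrow> 0"
    by (rule p_int_tendsto_0_imp_L1[OF DL _ lim]) auto
  have Dp: "p_int p (D n) \<le> 2 powr (p - 1) * (LINT t|circle_measure. norm (D n t))" for n
  proof -
    have "p_int p (D n) \<le> (LINT t|circle_measure. 2 powr (p - 1) * norm (D n t))"
      unfolding p_int_def
    proof (rule integral_mono_AE)
      show "AE t in circle_measure. norm (D n t) powr p \<le> 2 powr (p - 1) * norm (D n t)"
        using D(2)[of n]
      proof eventually_elim
        case (elim t)
        show ?case
        proof (cases "D n t = 0")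
          case False
          have "norm (D n t) powr p = norm (D n t) powr (p - 1) * norm (D n t) powr 1"
            by (subst powr_add[symmetric]) simp
          also have "\<dots> \<le> 2 powr (p - 1) * norm (D n t) powr 1"
            using elim p by (intro mult_right_mono powr_mono2) auto
          finally show ?thesis by simp
        qed (use p in simp)
      qed
    qed (use DL[of p n] DL[of 1 n] p Lp_integrable(1)[OF DL[of 1 n]] in \<open>auto dest: LpD\<close>)
    then show ?thesis by simp
  qed
  show ?thesis
  proof (rule LIMSEQ_0_by_approx[where c="2 powr p * 2 powr p"])
    fix e :: real assume e: "0 < e"
    obtain q where q: "trig q" "p_int p (\<lambda>t. g t - q t) < e" by (rule trig_dense_Lp[OF g p0(1) e])
    obtain K where K: "\<And>t. norm (q t) \<le> K" using trig_bounded[OF q(1)] by blast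
    have qL: "q \<in> Lp p" by (rule Lp_trig[OF q(1) p0(2)])
    have gq: "(\<lambda>t. g t - q t) \<in> Lp p" by (rule Lp_diff(1)[OF g qL p0(2)])
    define y where "y n = 2 powr p * (K powr p * (2 powr (p - 1) * (LINT t|circle_measure. norm (D n t))))" for n
    have "y \<longlonglongrightarrow> 2 powr p * (K powr p * (2 powr (p - 1) * 0))" unfolding y_def by (intro tendsto_intros L1)
    moreover have "p_int p (\<lambda>t. D n t * g t) \<le> 2 powr p * 2 powr p * e + y n" for n
    proof -
      have "p_int p (\<lambda>t. D n t * (g t - q t) + q t * D n t) \<le> 2 powr p * (p_int p (\<lambda>t. D n t * (g t - q t)) + p_int p (\<lambda>t. q t * D n t))"
        by (rule p_int_add_le[OF Lp_mult_bounded(1)[OF gq D p0(2)] Lp_mult_bounded(1)[OF DL[OF p0(2)] LpD(1)[OF qL] _ p0(2)]])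
           (use K p0 in auto)
      also have "\<dots> \<le> 2 powr p * (2 powr p * p_int p (\<lambda>t. g t - q t) + K powr p * p_int p (D n))"
        by (intro mult_left_mono add_mono p_int_mult_bounded[OF gq D p0(2)] p_int_mult_bounded[OF DL[OF p0(2)] LpD(1)[OF qL] _ p0(2)])
           (use K p0 in auto)
      also have "\<dots> \<le> 2 powr p * (2 powr p * e + K powr p * (2 powr (p - 1) * (LINT t|circle_measure. norm (D n t))))"
        using q(2) Dp by (intro mult_left_mono add_mono) auto
      finally show ?thesis by (simp add: y_def algebra_simps)
    qed
    ultimately show "\<exists>y. y \<longlonglongrightarrow> 0 \<and> (\<forall>n. p_int p (\<lambda>t. D n t * g t) \<le> 2 powr p * 2 powr p * e + y n)"
      by (intro exI[of _ y]) simp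
  qed auto
qed

lemma boundary_fn_partial_products_tendsto:
  fixes b :: "nat \<Rightarrow> complex \<Rightarrow> complex"
  assumes b: "\<And>n. 1 \<le> n \<Longrightarrow> b n \<in> Hinf" "\<And>n z. 1 \<le> n \<Longrightarrow> z \<in> ball 0 1 \<Longrightarrow> norm (b n z) \<le> 1"
    and B: "B \<in> Hinf"
    and lim: "\<And>K. compact K \<Longrightarrow> K \<subseteq> ball 0 1 \<Longrightarrow> uniform_limit K (\<lambda>N z. \<Prod>i\<in>{1..N}. b i z) B sequentially"
    and z0: "z0 \<in> ball 0 1" "B z0 \<noteq> 0"
  shows "(\<lambda>N. p_int 2 (\<lambda>t. boundary_fn (\<lambda>z. \<Prod>i\<in>{1..N}. b i z) t - boundary_fn B t)) \<longlonglongrightarrow> 0"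
proof -
  define P where "P N z = (\<Prod>i\<in>{1..N}. b i z)" for N z
  have P: "P N \<in> Hinf" for N unfolding P_def by (rule Hinf_prod) (use b in auto)
  have P1: "norm (P N z) \<le> 1" if "z \<in> ball 0 1" for N z
    unfolding P_def prod_norm[symmetric] by (intro prod_le_1) (use b that in auto)
  have bP: "AE t in circle_measure. norm (boundary_fn (P N) t) \<le> 1" for N
    by (rule boundary_fn_bound[OF P]) (rule P1)
  have PL: "boundary_fn (P N) \<in> Lp 2" for N
    by (rule Lp_bounded[OF boundary_fn_measurable[OF P] bP]) simp
  have Plim: "(\<lambda>N. P N z) \<longlonglongrightarrow> B z" if "z \<in> ball 0 1" for z
    using tendsto_uniform_limitI[OF lim[of "{z}"]] that by (simp add: P_def)
  have mono: "norm (P M z) \<le> norm (P N z)" if "z \<in> ball 0 1" "N \<le> M" for N M z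
    unfolding P_def prod_norm[symmetric] using that(2,1)
  proof (induction M rule: dec_induct)
    case (step M)
    have "norm (b (Suc M) z) * (\<Prod>i\<in>{1..M}. norm (b i z)) \<le> 1 * (\<Prod>i\<in>{1..M}. norm (b i z))"
      using b(2) step by (intro mult_right_mono prod_nonneg) auto
    then show ?case using step by (simp add: mult.commute)
  qed simp
  \<comment> \<open>The moduli at \<open>z0\<close> decrease in \<open>N\<close>, so they stay above
    their limit; this permits the division below, uniformly in \<open>N\<close>.\<close>
  have Bz0: "norm (B z0) \<le> norm (P N z0)" for N
    by (rule tendsto_upperbound[OF tendsto_norm[OF Plim[OF z0(1)]]])
       (use mono[OF z0(1)] in \<open>auto simp: eventually_sequentially\<close>)
  define k where "k = 4 * pi * ((1 + norm z0) / (1 - norm z0)) / norm (B z0)"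
  have k0: "0 \<le> k" using z0 by (auto simp: k_def)
  have dist: "p_int 2 (\<lambda>t. boundary_fn (P N) t - boundary_fn (P M) t) \<le> k * norm (P N z0 - P M z0)" if NM: "N \<le> M" for N M
  proof -
    \<comment> \<open>The earlier factor has modulus at most 1 on the circle, so two partial
      products are no further apart than the tail \<open>D\<close> is from 1.\<close>
    define D where "D z = (\<Prod>i\<in>{Suc N..M}. b i z)" for z
    have D: "D \<in> Hinf" unfolding D_def by (rule Hinf_prod) (use b in auto)
    have D1: "norm (D z) \<le> 1" if "z \<in> ball 0 1" for z
      unfolding D_def prod_norm[symmetric] by (intro prod_le_1) (use b that in auto)
    have PD: "P M = (\<lambda>z. P N z * D z)"
    proof
      fix z
      have "{1..M} = {1..N} \<union> {Suc N..M}" using NM by auto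
      then show "P M z = P N z * D z" unfolding P_def D_def by (simp add: prod.union_disjoint)
    qed
    have "AE t in circle_measure. boundary_fn (P M) t = boundary_fn (P N) t * boundary_fn D t"
      unfolding PD by (rule boundary_fn_mult[OF P D])
    then have "AE t in circle_measure. boundary_fn (P N) t - boundary_fn (P M) t = boundary_fn (P N) t * (1 - boundary_fn D t)"
      by eventually_elim (simp add: algebra_simps)
    then have "p_int 2 (\<lambda>t. boundary_fn (P N) t - boundary_fn (P M) t) = p_int 2 (\<lambda>t. boundary_fn (P N) t * (1 - boundary_fn D t))"
      by (rule p_int_AE_cong[rotated]) (intro borel_measurable_diff boundary_fn_measurable P)
    also have "\<dots> \<le> 1 powr 2 * p_int 2 (\<lambda>t. 1 - boundary_fn D t)"
    proof (rule p_int_mult_bounded[OF _ boundary_fn_measurable[OF P] bP])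
      have "boundary_fn D \<in> Lp 2"
        by (rule Lp_bounded[OF boundary_fn_measurable[OF D] boundary_fn_bound[OF D D1]]) auto
      then show "(\<lambda>t. 1 - boundary_fn D t) \<in> Lp 2" by (intro Lp_diff(1)[OF Lp_continuous]) auto
    qed simp
    also have "\<dots> \<le> 4 * pi * ((1 + norm z0) / (1 - norm z0)) * norm (1 - D z0)"
      using boundary_fn_distance_1[OF D D1, of z0] z0(1) by simp
    also have "\<dots> \<le> 4 * pi * ((1 + norm z0) / (1 - norm z0)) * (norm (P N z0 - P M z0) / norm (B z0))"
    proof (rule mult_left_mono)
      have "norm (B z0) * norm (1 - D z0) \<le> norm (P N z0) * norm (1 - D z0)"
        by (rule mult_right_mono[OF Bz0]) simp
      also have "\<dots> = norm (P N z0 - P M z0)" by (simp add: PD norm_mult[symmetric] algebra_simps)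
      finally show "norm (1 - D z0) \<le> norm (P N z0 - P M z0) / norm (B z0)" using z0(2) by (simp add: field_simps)
    qed (use z0(1) in simp)
    finally show ?thesis by (simp add: k_def)
  qed
  have cauchy: "\<exists>N0. \<forall>m\<ge>N0. \<forall>n\<ge>N0. p_int 2 (\<lambda>t. boundary_fn (P m) t - boundary_fn (P n) t) < e" if e: "0 < e" for e
  proof -
    have "Cauchy (\<lambda>N. P N z0)" by (rule LIMSEQ_imp_Cauchy[OF Plim[OF z0(1)]])
    moreover have "0 < e / (k + 1)" using e k0 by simp
    ultimately obtain N0 where N0: "\<And>m n. m \<ge> N0 \<Longrightarrow> n \<ge> N0 \<Longrightarrow> norm (P m z0 - P n z0) < e / (k + 1)"
      unfolding Cauchy_iff by blast
    have *: "p_int 2 (\<lambda>t. boundary_fn (P m) t - boundary_fn (P n) t) < e" if "m \<ge> N0" "m \<le> n" for m n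
    proof -
      have "p_int 2 (\<lambda>t. boundary_fn (P m) t - boundary_fn (P n) t) \<le> k * norm (P m z0 - P n z0)" by (rule dist[OF that(2)])
      also have "\<dots> \<le> k * (e / (k + 1))" using N0[of m n] that k0 by (intro mult_left_mono) auto
      also have "\<dots> < (k + 1) * (e / (k + 1))" using k0 e by (intro mult_strict_right_mono) auto
      also have "\<dots> = e" using k0 by simp
      finally show ?thesis .
    qed
    have "p_int 2 (\<lambda>t. boundary_fn (P m) t - boundary_fn (P n) t) < e" if "m \<ge> N0" "n \<ge> N0" for m n
      using *[of m n] *[of n m] that p_int_diff_commute[of 2 "boundary_fn (P m)" "boundary_fn (P n)"] by (cases "m \<le> n") auto
    then show ?thesis by blast
  qed
  obtain h where h: "h \<in> Lp 2" "(\<lambda>N. p_int 2 (\<lambda>t. boundary_fn (P N) t - h t)) \<longlonglongrightarrow> 0"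
    by (rule Lp_complete[of 2 "\<lambda>N. boundary_fn (P N)", OF _ PL cauchy]) auto
  have hi: "integrable circle_measure h" using Lp_integrable(1)[OF h(1)] by simp
  have Bi: "integrable circle_measure (boundary_fn B)"
    using boundary_fn_mult_integrable[OF B, of "\<lambda>t. 1"] by simp
  \<comment> \<open>Completeness only yields some limit \<open>h\<close>; its coefficients are
    limits of Taylor coefficients of the partial products, which identify it.\<close>
  have "AE t in circle_measure. h t = boundary_fn B t"
  proof (rule fourier_coeff_eq_imp_AE_eq[OF hi Bi])
    fix j
    have 1: "(\<lambda>N. fourier_coeff (boundary_fn (P N)) j) \<longlonglongrightarrow> fourier_coeff h j"
      by (rule fourier_coeff_tendsto_Lp[OF PL h(1) _ h(2)]) simp
    have "(\<lambda>N. taylor_coeff (P N) (nat j)) \<longlonglongrightarrow> taylor_coeff B (nat j)"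
      by (rule taylor_coeff_tendsto[OF HinfD(1)[OF P] HinfD(1)[OF B]]) (use lim in \<open>simp add: P_def[abs_def]\<close>)
    then have "(\<lambda>N. fourier_coeff (boundary_fn (P N)) j) \<longlonglongrightarrow> fourier_coeff (boundary_fn B) j"
      by (cases "0 \<le> j") (simp_all add: fourier_coeff_boundary_fn[OF P] fourier_coeff_boundary_fn[OF B])
    with 1 show "fourier_coeff h j = fourier_coeff (boundary_fn B) j" by (rule LIMSEQ_unique)
  qed
  then have "p_int 2 (\<lambda>t. boundary_fn (P N) t - h t) = p_int 2 (\<lambda>t. boundary_fn (P N) t - boundary_fn B t)" for N
    using LpD(1)[OF Lp_diff(1)[OF PL h(1)]] by (intro p_int_AE_cong) auto
  then show ?thesis using h(2) by (simp add: P_def[abs_def])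
qed

theorem theorem3p2:
  fixes p :: real and b :: "nat \<Rightarrow> complex \<Rightarrow> complex" and B :: "complex \<Rightarrow> complex"
  assumes "1 < p"
    and "\<forall>n\<ge>1. b n \<in> Hinf \<and> (\<forall>z\<in>ball 0 1. norm (b n z) \<le> 1)"
    and "B \<in> Hinf"
    and "\<forall>K. compact K \<and> K \<subseteq> ball 0 1 \<longrightarrow>
           uniform_limit K (\<lambda>N z. \<Prod>i\<in>{1..N}. b i z) B sequentially"
  shows "\<forall>f\<in>Hp p.
    (\<lambda>N. Lp_norm p (\<lambda>t. f t -
        (boundary_fn B t * toeplitz p (\<lambda>s. cnj (boundary_fn B s)) f t +
         (\<Sum>n=1..N. boundary_fn (\<lambda>z. \<Prod>i\<in>{1..n-1}. b i z) t *
            Qop p (b n) (toeplitz p (\<lambda>s. cnj (boundary_fn (\<lambda>z. \<Prod>i\<in>{1..n-1}. b i z) s)) f) t))))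
    \<longlonglongrightarrow> 0"
proof
  fix f assume f: "f \<in> Hp p"
  note p = assms(1)
  have p0: "0 < p" "0 \<le> p" "1 \<le> p" using p by auto
  have b: "b n \<in> Hinf" "\<And>z. z \<in> ball 0 1 \<Longrightarrow> norm (b n z) \<le> 1" if "1 \<le> n" for n
    using assms(2) that by auto
  have B: "B \<in> Hinf" by (rule assms(3))
  define P where "P N z = (\<Prod>i\<in>{1..N}. b i z)" for N z
  have lim: "uniform_limit K P B sequentially" if "compact K" "K \<subseteq> ball 0 1" for K
    using assms(4) that by (simp add: P_def[abs_def])
  have P: "P N \<in> Hinf" for N unfolding P_def by (rule Hinf_prod) (use b in auto)
  have P1: "norm (P N z) \<le> 1" if "z \<in> ball 0 1" for N z
    unfolding P_def prod_norm[symmetric] by (intro prod_le_1) (use b that in auto)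
  have B1: "norm (B z) \<le> 1" if "z \<in> ball 0 1" for z
  proof -
    have "(\<lambda>N. P N z) \<longlonglongrightarrow> B z" using tendsto_uniform_limitI[OF lim[of "{z}"]] that by simp
    from tendsto_norm[OF this] show ?thesis by (rule tendsto_upperbound) (use P1[OF that] in auto)
  qed
  define \<beta> where "\<beta> N = boundary_fn (P N)" for N
  have mP: "\<beta> N \<in> borel_measurable circle_measure" for N unfolding \<beta>_def by (rule boundary_fn_measurable[OF P])
  have bP: "AE t in circle_measure. norm (\<beta> N t) \<le> 1" for N
    unfolding \<beta>_def by (rule boundary_fn_bound[OF P]) (rule P1)
  have bB: "AE t in circle_measure. norm (boundary_fn B t) \<le> 1"
    by (rule boundary_fn_bound[OF B]) (rule B1)
  define g where "g N = toeplitz p (\<lambda>s. cnj (\<beta> N s)) f" for N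
  define G where "G = toeplitz p (\<lambda>s. cnj (boundary_fn B s)) f"
  have fL: "f \<in> Lp p" by (rule HpD(1)[OF f])
  have gH: "g N \<in> Hp p" for N
    unfolding g_def toeplitz_def \<beta>_def by (rule riesz_proj_Hp(1)[OF p boundary_fn_Lp(2)[OF P fL p0(2)]])
  have GH: "G \<in> Hp p"
    unfolding G_def toeplitz_def by (rule riesz_proj_Hp(1)[OF p boundary_fn_Lp(2)[OF B fL p0(2)]])
  note gL = HpD(1)[OF gH] and GL = HpD(1)[OF GH]
  have \<beta>0: "\<beta> 0 = (\<lambda>t. 1)" by (simp add: \<beta>_def P_def[abs_def] fun_eq_iff)
  \<comment> \<open>\<open>g 0\<close> is a chosen projection of \<open>f\<close> itself, hence
    known to equal \<open>f\<close> only almost everywhere.\<close>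
  have g0: "AE t in circle_measure. g 0 t = f t"
  proof (rule Hp_fourier_coeff_eq_imp_AE_eq[OF gH f p0(3)])
    show "fourier_coeff (g 0) k = fourier_coeff f k" if "0 \<le> k" for k
      unfolding g_def \<beta>0 toeplitz_def using fourier_coeff_riesz_proj[OF p _ that, of f] fL by simp
  qed
  have PSuc: "P n = (\<lambda>z. P (n - 1) z * b n z)" if "1 \<le> n" for n
    using that by (cases n) (auto simp: P_def fun_eq_iff)
  \<comment> \<open>The conjugate symbol of \<open>b n\<close> takes \<open>g (n - 1)\<close> to
    \<open>g n\<close>, and the analytic factor \<open>b n\<close> turns
    \<open>\<beta> (n - 1)\<close> into \<open>\<beta> n\<close>, so each summand is a difference of
    consecutive terms.\<close>
  have Q: "AE t in circle_measure. \<beta> (n - 1) t * Qop p (b n) (g (n - 1)) t = \<beta> (n - 1) t * g (n - 1) t - \<beta> n t * g n t" if n: "1 \<le> n" for n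
  proof -
    have "toeplitz p (\<lambda>t. cnj (boundary_fn (b n) t)) (g (n - 1)) = g n"
      unfolding g_def \<beta>_def PSuc[OF n] by (rule toeplitz_cnj_mult[OF b(1)[OF n] P fL p])
    then have Qeq: "Qop p (b n) (g (n - 1)) t = g (n - 1) t - toeplitz p (boundary_fn (b n)) (g n) t" for t
      by (simp add: Qop_def Pop_def)
    have "AE t in circle_measure. \<beta> n t = \<beta> (n - 1) t * boundary_fn (b n) t"
      unfolding \<beta>_def by (subst PSuc[OF n]) (rule boundary_fn_mult[OF P b(1)[OF n]])
    then show ?thesis
      using toeplitz_boundary_Hp[OF b(1)[OF n] gH p, of n]
    proof eventually_elim
      case (elim t)
      show ?case unfolding Qeq elim by (simp add: algebra_simps)
    qed
  qed
  define E where "E N t = f t - (boundary_fn B t * G t + (\<Sum>n=1..N. \<beta> (n - 1) t * Qop p (b n) (g (n - 1)) t))" for N t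
  \<comment> \<open>The remainder as telescoping produces it, equal to \<open>E\<close> only almost
    everywhere; the estimates are made on the two summands of \<open>E'\<close>.\<close>
  define E' where "E' N t = \<beta> N t * (g N t - G t) + (\<beta> N t - boundary_fn B t) * G t" for N t
  have E_eq: "AE t in circle_measure. E' N t = E N t" for N
  proof -
    have "AE t in circle_measure. \<forall>n\<in>{1..N}. \<beta> (n - 1) t * Qop p (b n) (g (n - 1)) t = \<beta> (n - 1) t * g (n - 1) t - \<beta> n t * g n t"
      by (rule AE_finite_allI) (use Q in auto)
    then show ?thesis using g0
    proof eventually_elim
      case (elim t)
      have "(\<Sum>n=1..N. \<beta> (n - 1) t * Qop p (b n) (g (n - 1)) t) = (\<Sum>n=1..N. \<beta> (n - 1) t * g (n - 1) t - \<beta> n t * g n t)"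
        using elim(1) by (intro sum.cong) auto
      also have "\<dots> = \<beta> 0 t * g 0 t - \<beta> N t * g N t"
        by (induction N) auto
      also have "\<dots> = f t - \<beta> N t * g N t" using elim(2) by (simp add: \<beta>0)
      finally show ?case by (simp add: E_def E'_def algebra_simps)
    qed
  qed
  have gG: "(\<lambda>t. g N t - G t) \<in> Lp p" for N by (rule Lp_diff(1)[OF gL GL p0(2)])
  have mD: "(\<lambda>t. \<beta> N t - boundary_fn B t) \<in> borel_measurable circle_measure" for N
    by (intro borel_measurable_diff mP boundary_fn_measurable B)
  have bD: "AE t in circle_measure. norm (\<beta> N t - boundary_fn B t) \<le> 2" for N
    using bP[of N] bB
  proof eventually_elim
    case (elim t)
    then show ?case using norm_triangle_ineq4[of "\<beta> N t" "boundary_fn B t"] by simp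
  qed
  note L1 = Lp_mult_bounded(1)[OF gG mP bP p0(2)]
  note L2 = Lp_mult_bounded(1)[OF GL mD bD p0(2)]
  have lim1: "(\<lambda>N. p_int p (\<lambda>t. g N t - G t)) \<longlonglongrightarrow> 0"
    unfolding g_def G_def \<beta>_def by (rule toeplitz_cnj_tendsto[OF p fL P P1 B B1 lim])
  have lim2: "(\<lambda>N. p_int p (\<lambda>t. (\<beta> N t - boundary_fn B t) * G t)) \<longlonglongrightarrow> 0"
  proof (cases "\<forall>z\<in>ball 0 1. B z = 0")
    \<comment> \<open>Here the \<open>\<beta> N\<close> need not tend to 0 in norm, but the zero
      symbol makes \<open>G\<close> vanish almost everywhere.\<close>
    case True
    have "AE t in circle_measure. boundary_fn B t = 0"
      using boundary_fn_bound[OF B, of 0] True by simp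
    then have 0: "AE t in circle_measure. cnj (boundary_fn B t) * f t = 0" by eventually_elim simp
    have "AE t in circle_measure. G t = (\<lambda>t. 0) t"
    proof (rule Hp_fourier_coeff_eq_imp_AE_eq[OF GH _ p0(3)])
      show "(\<lambda>t. 0) \<in> Hp p" using p0 by (auto simp: Hp_def fourier_coeff_def intro!: Lp_continuous)
      fix k :: int assume k: "0 \<le> k"
      have L: "(\<lambda>t. cnj (boundary_fn B t) * f t) \<in> Lp p" by (rule boundary_fn_Lp(2)[OF B fL p0(2)])
      show "fourier_coeff G k = fourier_coeff (\<lambda>t. 0) k"
        unfolding G_def toeplitz_def fourier_coeff_riesz_proj[OF p L k]
        by (rule fourier_coeff_AE_cong[OF LpD(1)[OF L] 0])
    qed
    then have "AE t in circle_measure. (\<beta> N t - boundary_fn B t) * G t = 0" for N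
      by eventually_elim simp
    then have "p_int p (\<lambda>t. (\<beta> N t - boundary_fn B t) * G t) = p_int p (\<lambda>t. 0)" for N
      by (intro p_int_AE_cong LpD(1)[OF L2])
    then show ?thesis by (simp add: p_int_def)
  next
    case False
    then obtain z0 where z0: "z0 \<in> ball 0 1" "B z0 \<noteq> 0" by blast
    have "(\<lambda>N. p_int 2 (\<lambda>t. \<beta> N t - boundary_fn B t)) \<longlonglongrightarrow> 0"
      unfolding \<beta>_def P_def[abs_def]
      by (rule boundary_fn_partial_products_tendsto[OF b B _ z0]) (use lim in \<open>auto simp: P_def[abs_def]\<close>)
    then show ?thesis by (rule p_int_mult_tendsto_0[OF mD bD _ GL p])
  qed
  have le: "p_int p (E N) \<le> 2 powr p * (p_int p (\<lambda>t. g N t - G t) + p_int p (\<lambda>t. (\<beta> N t - boundary_fn B t) * G t))" for N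
  proof -
    have E'L: "E' N \<in> Lp p" unfolding E'_def by (rule Lp_add(1)[OF L1 L2 p0(2)])
    have "p_int p (E N) = p_int p (E' N)" by (rule p_int_AE_cong[OF LpD(1)[OF E'L] E_eq, symmetric])
    also have "\<dots> \<le> 2 powr p * (p_int p (\<lambda>t. \<beta> N t * (g N t - G t)) + p_int p (\<lambda>t. (\<beta> N t - boundary_fn B t) * G t))"
      unfolding E'_def by (rule p_int_add_le[OF L1 L2 p0(2)])
    also have "\<dots> \<le> 2 powr p * (p_int p (\<lambda>t. g N t - G t) + p_int p (\<lambda>t. (\<beta> N t - boundary_fn B t) * G t))"
      using p_int_mult_bounded[OF gG mP bP p0(2), of N] by (intro mult_left_mono add_right_mono) auto
    finally show ?thesis .
  qed
  have "(\<lambda>N. 2 powr p * (p_int p (\<lambda>t. g N t - G t) + p_int p (\<lambda>t. (\<beta> N t - boundary_fn B t) * G t))) \<longlonglongrightarrow> 2 powr p * (0 + 0)"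
    by (intro tendsto_intros lim1 lim2)
  then have bound_lim: "(\<lambda>N. 2 powr p * (p_int p (\<lambda>t. g N t - G t) + p_int p (\<lambda>t. (\<beta> N t - boundary_fn B t) * G t))) \<longlonglongrightarrow> 0"
    by simp
  have "(\<lambda>N. p_int p (E N)) \<longlonglongrightarrow> 0"
    by (rule tendsto_sandwich[OF _ _ tendsto_const bound_lim]; intro always_eventually allI le p_int_nonneg)
  then have "(\<lambda>N. p_int p (E N) powr (1/p)) \<longlonglongrightarrow> 0"
    using p0 by (intro tendsto_zero_powrI[OF _ tendsto_const]) auto
  then show "(\<lambda>N. Lp_norm p (\<lambda>t. f t -
        (boundary_fn B t * toeplitz p (\<lambda>s. cnj (boundary_fn B s)) f t +
         (\<Sum>n=1..N. boundary_fn (\<lambda>z. \<Prod>i\<in>{1..n-1}. b i z) t *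
            Qop p (b n) (toeplitz p (\<lambda>s. cnj (boundary_fn (\<lambda>z. \<Prod>i\<in>{1..n-1}. b i z) s)) f) t))))
    \<longlonglongrightarrow> 0"
    unfolding Lp_norm_def p_int_def E_def \<beta>_def P_def[abs_def] g_def G_def .
qed

end
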